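(* (Full range completeness) Suppose the boundary conditions (I)–(II) are co-normal with respect to $l$ and that $L$ is positive definite. Then the eigenfunctions $(y_n)$ of the boundary-value problem $-y''+qy=\lambda By$ on $G$ with boundary conditions (I)–(II) form a Riesz basis for $\mathcal{L}^2(G)$ and can be chosen to form an orthonormal basis for $\mathcal{D}(F)$ (with respect to the $F$ inner product). In addition $(y_n)$ is orthogonal with respect to $[\cdot,\cdot]$.
   Context: Graph and spaces. $G$ is an oriented graph with finitely many edges $e_1,\dots,e_K$, each of length $1$; $e_i$ is identified with $[0,1]$, with $0$ the initial and $1$ the terminal point. A complex-valued function $y$ on $G$ is a tuple $(y_1,\dots,y_K)$ with $y_i=y|_{e_i}$ a function on $[0,1]$. Put $\mathcal{L}^2(G)=\bigoplus_{i=1}^K L^2(0,1)$ and $\mathcal{H}^m(G)=\bigoplus_{i=1}^K H^m(0,1)$ (Sobolev spaces), $\int_G h\,dt=\sum_i\int_0^1 h_i\,dt$, $(f,g)=\int_G f\bar g\,dt$, $\|f\|^2=(f,f)$. Equation. $q$ is real-valued and essentially bounded on $G$; $b=1$ on the edges $e_1,\dots,e_p$ and $b=-1$ on $e_{p+1},\dots,e_K$; $(By)(x)=b(x)y(x)$; $ly=-y''+qy$; $[f,g]=(Bf,g)$ for $f,g\in\mathcal{L}^2(G)$. Boundary conditions. At the nodes of $G$ one imposes in total $2K$ linearly independent linear homogeneous conditions with constant coefficients, each involving only the values of $y$ and $y'$ at the edge ends incident to one node, which are formally self-adjoint, i.e. $(lx,y)=(x,ly)$ for all $x,y\in\mathcal{H}^2(G)$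 satisfying the conditions. They are written as (I) $\sum_{j=1}^K[\alpha_{ij}y_j(0)+\gamma_{ij}y_j(1)]=0$, $i=1,\dots,J$; (II) $\sum_{j=1}^K[\alpha_{ij}y_j(0)+\beta_{ij}y_j'(0)+\gamma_{ij}y_j(1)+\delta_{ij}y_j'(1)]=0$, $i=J+1,\dots,2K$, where all Dirichlet-like conditions are in (I), that is, every linear combination of (I)–(II) containing no derivative terms is a linear combination of the conditions (I) alone. Operator. $Lf=-f''+qf$ with domain $\mathcal{D}(L)=\{f: f,f'\in AC,\ Lf\in\mathcal{L}^2(G),\ f\text{ satisfies (I) and (II)}\}$, a self-adjoint operator in $\mathcal{L}^2(G)$. $L$ positive definite means $(Ly,y)>0$ for all $y\in\mathcal{D}(L)\setminus\{0\}$. Co-normal conditions and the form $F$. $\mathcal{D}(F)=\{y\in\mathcal{H}^1(G): y \text{ satisfies (I)}\}$. For a function $y$ on the set $\partial G$ of the $2K$ edge ends, $\int_{\partial G}y\,d\sigma=\sum_{i=1}^K[y_i(1)-y_i(0)]$. The boundary conditions are called co-normal (or elliptic) with respect to $l$ if there is a function $f$ on $\partial G$ (one scalar for each of the $2K$ edge ends) such that, for $x\in\mathcal{D}(F)\cap\mathcal{H}^2(G)$, one has $\int_{\partial G}(fx+x')\bar y\,d\sigma=0$ for all $y\in\mathcal{D}(F)$ if and only if $x$ satisfies (II). For co-normal conditions with such an $f$ fixed, $F(x,y)=\int_{\partial G}fx\bar y\,d\sigma+\int_G(x'\bar y'+qx\bar y)\,dt$ for $x,y\in\mathcal{D}(F)$.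 When $L$ is positive definite, $\mathcal{D}(F)$ is a Hilbert space with inner product $F$. *)

theory Defs
  imports "HOL-Analysis.Analysis" "Graph_Theory.Digraph"
begin

section \<open>Functions on one edge, identified with the unit interval\<close>

text \<open>
  Absolute continuity on \<open>[0,1]\<close> in the form of the fundamental theorem of calculus: \<open>u\<close> is
  absolutely continuous with (almost everywhere, equivalently weak) derivative \<open>g\<close> iff \<open>g\<close> is
  Lebesgue integrable and \<open>u\<close> is an indefinite integral of \<open>g\<close>.
\<close>

definition has_ac_deriv :: "(real \<Rightarrow> complex) \<Rightarrow> (real \<Rightarrow> complex) \<Rightarrow> bool" where
  "has_ac_deriv u g \<longleftrightarrow>
     integrable (lebesgue_on {0..1}) g \<and>
     (\<forall>t\<in>{0..1}. u t = u 0 + integral\<^sup>L (lebesgue_on {0..t}) g)"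

definition AC :: "(real \<Rightarrow> complex) \<Rightarrow> bool" where
  "AC u \<longleftrightarrow> (\<exists>g. has_ac_deriv u g)"

text \<open>
  The derivative of an absolutely continuous function is determined up to a null set. As usual for
  Sobolev functions, the continuous representative is taken whenever there is one; this makes the
  values of the derivative at the end points \<open>0\<close> and \<open>1\<close> meaningful for functions in \<open>H\<^sup>2(0,1)\<close>.
\<close>

definition edge_deriv :: "(real \<Rightarrow> complex) \<Rightarrow> real \<Rightarrow> complex" where
  "edge_deriv u = (SOME g. has_ac_deriv u g \<and>
     ((\<exists>h. has_ac_deriv u h \<and> continuous_on {0..1} h) \<longrightarrow> continuous_on {0..1} g))"

definition L2_edge :: "(real \<Rightarrow> complex) \<Rightarrow> bool" where
  "L2_edge u \<longleftrightarrow>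
     u \<in> borel_measurable (lebesgue_on {0..1}) \<and>
     integrable (lebesgue_on {0..1}) (\<lambda>t. (cmod (u t))\<^sup>2)"


section \<open>Functions on the graph\<close>

text \<open>
  A function on a graph with edges \<open>1, \<dots>, K\<close> is a function of the edge \<open>i \<in> {1..K}\<close> and the
  parameter \<open>t \<in> {0..1}\<close> on it; values for other arguments never matter. The edge ends of edge
  \<open>i\<close> are \<open>(i, 0)\<close> and \<open>(i, 1)\<close>, so a function on the set of edge ends is a function of the same
  type of which only the values at \<open>t = 0\<close> and \<open>t = 1\<close> are used.
\<close>

type_synonym gfun = "nat \<Rightarrow> real \<Rightarrow> complex"

definition gderiv :: "gfun \<Rightarrow> gfun" where
  "gderiv y = (\<lambda>i. edge_deriv (y i))"

definition L2_graph :: "nat \<Rightarrow> gfun set" where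
  "L2_graph K = {y. \<forall>i\<in>{1..K}. L2_edge (y i)}"

definition H1_graph :: "nat \<Rightarrow> gfun set" where
  "H1_graph K = {y. (\<forall>i\<in>{1..K}. AC (y i)) \<and> gderiv y \<in> L2_graph K}"

definition H2_graph :: "nat \<Rightarrow> gfun set" where
  "H2_graph K = {y. (\<forall>i\<in>{1..K}. AC (y i) \<and> AC (gderiv y i)) \<and> gderiv (gderiv y) \<in> L2_graph K}"

definition graph_integral :: "nat \<Rightarrow> gfun \<Rightarrow> complex" where
  "graph_integral K h = (\<Sum>i=1..K. integral\<^sup>L (lebesgue_on {0..1}) (h i))"

definition boundary_integral :: "nat \<Rightarrow> gfun \<Rightarrow> complex" where
  "boundary_integral K h = (\<Sum>i=1..K. h i 1 - h i 0)"

definition ip :: "nat \<Rightarrow> gfun \<Rightarrow> gfun \<Rightarrow> complex" where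
  "ip K f g = graph_integral K (\<lambda>i t. f i t * cnj (g i t))"

definition L2_norm_graph :: "nat \<Rightarrow> gfun \<Rightarrow> real" where
  "L2_norm_graph K f = sqrt (Re (ip K f f))"

definition lincomb :: "nat \<Rightarrow> (nat \<Rightarrow> complex) \<Rightarrow> (nat \<Rightarrow> gfun) \<Rightarrow> gfun" where
  "lincomb N c y = (\<lambda>i t. \<Sum>n<N. c n * y n i t)"

definition gdiff :: "gfun \<Rightarrow> gfun \<Rightarrow> gfun" where
  "gdiff u v = (\<lambda>i t. u i t - v i t)"

text \<open>
  An \<open>F\<close>-orthonormal sequence of eigenfunctions tends to \<open>0\<close> in the norm of the space of square
  integrable functions, so it cannot itself be a Riesz basis there; the multiples of norm \<open>1\<close> can.
\<close>

definition normalised :: "nat \<Rightarrow> gfun \<Rightarrow> gfun" where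
  "normalised K y = (\<lambda>i t. y i t / of_real (L2_norm_graph K y))"

text \<open>A Riesz basis: a complete sequence that is equivalent to an orthonormal one.\<close>

definition riesz_basis_L2 :: "nat \<Rightarrow> (nat \<Rightarrow> gfun) \<Rightarrow> bool" where
  "riesz_basis_L2 K y \<longleftrightarrow>
     (\<forall>n. y n \<in> L2_graph K) \<and>
     (\<forall>u\<in>L2_graph K. \<forall>\<epsilon>>0. \<exists>N c. L2_norm_graph K (gdiff u (lincomb N c y)) < \<epsilon>) \<and>
     (\<exists>A>0. \<exists>B>0. \<forall>N c.
        A * (\<Sum>n<N. (cmod (c n))\<^sup>2) \<le> (L2_norm_graph K (lincomb N c y))\<^sup>2 \<and>
        (L2_norm_graph K (lincomb N c y))\<^sup>2 \<le> B * (\<Sum>n<N. (cmod (c n))\<^sup>2))"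

definition orthonormal_basis_wrt :: "(gfun \<Rightarrow> gfun \<Rightarrow> complex) \<Rightarrow> gfun set \<Rightarrow> (nat \<Rightarrow> gfun) \<Rightarrow> bool" where
  "orthonormal_basis_wrt \<Phi> V y \<longleftrightarrow>
     (\<forall>n. y n \<in> V) \<and>
     (\<forall>m n. \<Phi> (y m) (y n) = (if m = n then 1 else 0)) \<and>
     (\<forall>u\<in>V. (\<lambda>N. let r = gdiff u (lincomb N (\<lambda>n. \<Phi> u (y n)) y) in \<Phi> r r) \<longlonglongrightarrow> 0)"


section \<open>Boundary value problems on graphs\<close>

text \<open>
  The data: the oriented graph, the number \<open>K\<close> of edges, the number \<open>p\<close> of edges with \<open>b = 1\<close>, the
  potential \<open>q\<close>, the number \<open>J\<close> of conditions in (I), and the coefficients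
  \<open>\<alpha>\<^sub>i\<^sub>j, \<beta>\<^sub>i\<^sub>j, \<gamma>\<^sub>i\<^sub>j, \<delta>\<^sub>i\<^sub>j\<close> of \<open>y\<^sub>j(0), y\<^sub>j'(0), y\<^sub>j(1), y\<^sub>j'(1)\<close> in the \<open>i\<close>-th condition.
\<close>

record 'v graph_bvp =
  graph_of :: "('v, nat) pre_digraph"
  nedges :: nat
  npos :: nat
  potential :: "nat \<Rightarrow> real \<Rightarrow> real"
  ndir :: nat
  coeff_a :: "nat \<Rightarrow> nat \<Rightarrow> complex"
  coeff_b :: "nat \<Rightarrow> nat \<Rightarrow> complex"
  coeff_c :: "nat \<Rightarrow> nat \<Rightarrow> complex"
  coeff_d :: "nat \<Rightarrow> nat \<Rightarrow> complex"

definition satisfies_I :: "'v graph_bvp \<Rightarrow> gfun \<Rightarrow> bool" where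
  "satisfies_I P y \<longleftrightarrow> (\<forall>i\<in>{1..ndir P}.
     (\<Sum>j=1..nedges P. coeff_a P i j * y j 0 + coeff_c P i j * y j 1) = 0)"

definition satisfies_II :: "'v graph_bvp \<Rightarrow> gfun \<Rightarrow> bool" where
  "satisfies_II P y \<longleftrightarrow> (\<forall>i\<in>{ndir P + 1..2 * nedges P}.
     (\<Sum>j=1..nedges P. coeff_a P i j * y j 0 + coeff_b P i j * gderiv y j 0
        + coeff_c P i j * y j 1 + coeff_d P i j * gderiv y j 1) = 0)"

definition l_expr :: "'v graph_bvp \<Rightarrow> gfun \<Rightarrow> gfun" where
  "l_expr P y = (\<lambda>i t. - gderiv (gderiv y) i t + of_real (potential P i t) * y i t)"

definition b_weight :: "'v graph_bvp \<Rightarrow> nat \<Rightarrow> complex" where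
  "b_weight P i = (if i \<le> npos P then 1 else - 1)"

definition B_op :: "'v graph_bvp \<Rightarrow> gfun \<Rightarrow> gfun" where
  "B_op P y = (\<lambda>i t. b_weight P i * y i t)"

definition indef_ip :: "'v graph_bvp \<Rightarrow> gfun \<Rightarrow> gfun \<Rightarrow> complex" where
  "indef_ip P f g = ip (nedges P) (B_op P f) g"

text \<open>The coefficients of the conditions (I) at derivatives are required to vanish.\<close>

definition form_I_II :: "'v graph_bvp \<Rightarrow> bool" where
  "form_I_II P \<longleftrightarrow> ndir P \<le> 2 * nedges P \<and>
     (\<forall>i\<in>{1..ndir P}. \<forall>j\<in>{1..nedges P}. coeff_b P i j = 0 \<and> coeff_d P i j = 0)"

definition conditions_independent :: "'v graph_bvp \<Rightarrow> bool" where
  "conditions_independent P \<longleftrightarrow> (\<forall>c :: nat \<Rightarrow> complex.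
     (\<forall>j\<in>{1..nedges P}.
        (\<Sum>i=1..2 * nedges P. c i * coeff_a P i j) = 0 \<and>
        (\<Sum>i=1..2 * nedges P. c i * coeff_b P i j) = 0 \<and>
        (\<Sum>i=1..2 * nedges P. c i * coeff_c P i j) = 0 \<and>
        (\<Sum>i=1..2 * nedges P. c i * coeff_d P i j) = 0)
     \<longrightarrow> (\<forall>i\<in>{1..2 * nedges P}. c i = 0))"

text \<open>
  Every linear combination of all conditions without derivative terms is a linear combination of
  the conditions (I).
\<close>

definition dirichlet_like_in_I :: "'v graph_bvp \<Rightarrow> bool" where
  "dirichlet_like_in_I P \<longleftrightarrow> (\<forall>c :: nat \<Rightarrow> complex.
     (\<forall>j\<in>{1..nedges P}.
        (\<Sum>i=1..2 * nedges P. c i * coeff_b P i j) = 0 \<and>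
        (\<Sum>i=1..2 * nedges P. c i * coeff_d P i j) = 0)
     \<longrightarrow> (\<exists>d :: nat \<Rightarrow> complex. \<forall>j\<in>{1..nedges P}.
        (\<Sum>i=1..2 * nedges P. c i * coeff_a P i j) = (\<Sum>i=1..ndir P. d i * coeff_a P i j) \<and>
        (\<Sum>i=1..2 * nedges P. c i * coeff_c P i j) = (\<Sum>i=1..ndir P. d i * coeff_c P i j)))"

text \<open>Each condition involves only edge ends incident to one node.\<close>

definition conditions_local :: "'v graph_bvp \<Rightarrow> bool" where
  "conditions_local P \<longleftrightarrow> (\<forall>i\<in>{1..2 * nedges P}. \<exists>v\<in>verts (graph_of P). \<forall>j\<in>{1..nedges P}.
     (tail (graph_of P) j \<noteq> v \<longrightarrow> coeff_a P i j = 0 \<and> coeff_b P i j = 0) \<and>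
     (head (graph_of P) j \<noteq> v \<longrightarrow> coeff_c P i j = 0 \<and> coeff_d P i j = 0))"

definition formally_self_adjoint :: "'v graph_bvp \<Rightarrow> bool" where
  "formally_self_adjoint P \<longleftrightarrow>
     (\<forall>x\<in>H2_graph (nedges P). \<forall>y\<in>H2_graph (nedges P).
        satisfies_I P x \<and> satisfies_II P x \<and> satisfies_I P y \<and> satisfies_II P y \<longrightarrow>
        ip (nedges P) (l_expr P x) y = ip (nedges P) x (l_expr P y))"

definition potential_bounded :: "'v graph_bvp \<Rightarrow> bool" where
  "potential_bounded P \<longleftrightarrow> (\<forall>i\<in>{1..nedges P}.
     potential P i \<in> borel_measurable (lebesgue_on {0..1}) \<and>
     (\<exists>C. AE t in lebesgue_on {0..1}. \<bar>potential P i t\<bar> \<le> C))"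

definition graph_bvp_setting :: "'v graph_bvp \<Rightarrow> bool" where
  "graph_bvp_setting P \<longleftrightarrow>
     wf_digraph (graph_of P) \<and> arcs (graph_of P) = {1..nedges P} \<and> 1 \<le> nedges P \<and>
     npos P \<le> nedges P \<and> potential_bounded P \<and>
     form_I_II P \<and> conditions_independent P \<and> dirichlet_like_in_I P \<and>
     conditions_local P \<and> formally_self_adjoint P"

text \<open>The operator \<open>L\<close> is \<^const>\<open>l_expr\<close> on the following domain.\<close>

definition dom_L :: "'v graph_bvp \<Rightarrow> gfun set" where
  "dom_L P = {y. (\<forall>i\<in>{1..nedges P}. AC (y i) \<and> AC (gderiv y i)) \<and>
     l_expr P y \<in> L2_graph (nedges P) \<and> satisfies_I P y \<and> satisfies_II P y}"

definition nontrivial :: "'v graph_bvp \<Rightarrow> gfun \<Rightarrow> bool" where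
  "nontrivial P y \<longleftrightarrow> (\<exists>i\<in>{1..nedges P}. \<exists>t\<in>{0..1}. y i t \<noteq> 0)"

text \<open>\<open>(Ly,y)\<close> is real by formal self-adjointness, so it is compared with \<open>0\<close> via its real part.\<close>

definition L_positive_definite :: "'v graph_bvp \<Rightarrow> bool" where
  "L_positive_definite P \<longleftrightarrow>
     (\<forall>y\<in>dom_L P. nontrivial P y \<longrightarrow> 0 < Re (ip (nedges P) (l_expr P y) y))"

definition dom_F :: "'v graph_bvp \<Rightarrow> gfun set" where
  "dom_F P = {y \<in> H1_graph (nedges P). satisfies_I P y}"

definition conormal_with :: "'v graph_bvp \<Rightarrow> gfun \<Rightarrow> bool" where
  "conormal_with P f \<longleftrightarrow> (\<forall>x \<in> dom_F P \<inter> H2_graph (nedges P).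
     (\<forall>y\<in>dom_F P. boundary_integral (nedges P)
        (\<lambda>i t. (f i t * x i t + gderiv x i t) * cnj (y i t)) = 0)
     \<longleftrightarrow> satisfies_II P x)"

definition F_form :: "'v graph_bvp \<Rightarrow> gfun \<Rightarrow> gfun \<Rightarrow> gfun \<Rightarrow> complex" where
  "F_form P f x y =
     boundary_integral (nedges P) (\<lambda>i t. f i t * x i t * cnj (y i t)) +
     graph_integral (nedges P) (\<lambda>i t. gderiv x i t * cnj (gderiv y i t)
        + of_real (potential P i t) * x i t * cnj (y i t))"

definition eigenfunction :: "'v graph_bvp \<Rightarrow> complex \<Rightarrow> gfun \<Rightarrow> bool" where
  "eigenfunction P \<mu> y \<longleftrightarrow> y \<in> dom_L P \<and> nontrivial P y \<and>
     (\<forall>i\<in>{1..nedges P}. AE t in lebesgue_on {0..1}. l_expr P y i t = \<mu> * B_op P y i t)"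

end

theory Submission
  imports Defs "HOL-Library.Function_Algebras" "HOL-Complex_Analysis.Great_Picard"
begin

text \<open>
  On \<open>V\<close>, the domain of the form \<open>F\<close>, the form \<open>F\<close> is an inner product equivalent to that of
  the Sobolev space, and the indefinite product \<open>b(x,y) = [x,y]\<close> is a compact Hermitian form for it.
  Maximising \<open>\<bar>b\<bar>\<close> on successive orthogonal complements gives an \<open>F\<close>-orthonormal basis \<open>y\<close> of
  \<open>V\<close> with \<open>b(y\<^sub>n,v) = \<mu>\<^sub>n F(y\<^sub>n,v)\<close> for all \<open>v\<close>; since the conditions are co-normal, each
  \<open>y\<^sub>n\<close> is an eigenfunction with eigenvalue \<open>1/\<mu>\<^sub>n\<close>.

  The Riesz basis property says that the norm of \<open>T(x,y) = \<Sum> \<bar>\<mu>\<^sub>n\<bar> F(x,y\<^sub>n) F(y\<^sub>n,y)\<close> is equivalent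
  to that of \<open>L\<^sup>2\<close>. Following Beals, this follows from an \<open>F\<close>-bounded operator \<open>W\<close> on \<open>V\<close> that is symmetric
  for \<open>b\<close> and satisfies \<open>b(Wx,x) \<ge> \<delta> \<parallel>x\<parallel>\<^sup>2\<close>. Here \<open>W = BX\<close>, where on each edge \<open>X\<close> is
  the identity minus a small multiple of scaling operators at both ends, chosen such that \<open>Xx\<close>
  vanishes at the ends. Hence \<open>Wx\<close> satisfies the conditions (I) whatever they are.
\<close>

section \<open>Hermitian forms\<close>

text \<open>The obstacle is the node conditions. Multiplication by the sign b would be the ideal W,
  as b(Bx,x) is the square of the L2 norm, but Bx may leave V when a condition in (I) couples edges
  of opposite sign. A cutoff vanishing at the edge ends would repair this and destroy the lower
  bound. Dilations avoid both: s f(s^2 t) near an end has at most the L2 norm of f and multiplies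
  the end value by s, its adjoint multiplies it by 1/s. Subtracting these pairs at both ends with
  weight 1/(s + 1/s) removes the end values, and at least 1 - 4/(s + 1/s) times the identity is
  left. This is positive for s > 2 + sqrt 3; the choice s = 4 gives 1/17. W alone only bounds the L2
  norm by that of T. The reverse bound is duality: T(u,u) = b(Ju,u) with a sign operator J that
  preserves T. Two properties of F have to be earned: it is Hermitian although f is an arbitrary
  complex function, and it is coercive on V although positivity is given only on the smaller domain
  of L.\<close>

locale hermitian_form = vector_space scale
  for scale :: "complex \<Rightarrow> 'a::ab_group_add \<Rightarrow> 'a" (infixr "*c" 75) +
  fixes V :: "'a set" and F :: "'a \<Rightarrow> 'a \<Rightarrow> complex"
  assumes subspace_V: "subspace V"
    and add_left: "\<lbrakk>x \<in> V; y \<in> V; z \<in> V\<rbrakk> \<Longrightarrow> F (x + y) z = F x z + F y z"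
    and scale_left: "\<lbrakk>x \<in> V; z \<in> V\<rbrakk> \<Longrightarrow> F (c *c x) z = c * F x z"
    and herm: "\<lbrakk>x \<in> V; y \<in> V\<rbrakk> \<Longrightarrow> F y x = cnj (F x y)"
begin

definition sq :: "'a \<Rightarrow> real" where "sq x = Re (F x x)"

lemmas V_add [simp] = subspace_add[OF subspace_V]
lemmas V_scale [simp] = subspace_scale[OF subspace_V]
lemmas V_diff [simp] = subspace_diff[OF subspace_V]
lemmas V_uminus [simp] = subspace_neg[OF subspace_V]
lemmas V_zero [simp] = subspace_0[OF subspace_V]

lemma V_sum [simp]: "(\<And>i. i \<in> A \<Longrightarrow> f i \<in> V) \<Longrightarrow> sum f A \<in> V"
  by (rule subspace_sum[OF subspace_V])

lemma add_right: "\<lbrakk>x \<in> V; y \<in> V; z \<in> V\<rbrakk> \<Longrightarrow> F z (x + y) = F z x + F z y"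
  by (metis herm add_left V_add complex_cnj_add)

lemma scale_right: "\<lbrakk>x \<in> V; z \<in> V\<rbrakk> \<Longrightarrow> F z (c *c x) = cnj c * F z x"
  by (metis herm scale_left V_scale complex_cnj_mult)

lemma diff_left: "\<lbrakk>x \<in> V; y \<in> V; z \<in> V\<rbrakk> \<Longrightarrow> F (x - y) z = F x z - F y z"
  by (metis V_diff add_left add_diff_cancel diff_add_cancel)

lemma diff_right: "\<lbrakk>x \<in> V; y \<in> V; z \<in> V\<rbrakk> \<Longrightarrow> F z (x - y) = F z x - F z y"
  by (metis V_diff add_right add_diff_cancel diff_add_cancel)

lemma zero_left [simp]: "z \<in> V \<Longrightarrow> F 0 z = 0"
  using diff_left[of z z z] by simp

lemma sum_left: "\<lbrakk>\<And>i. i \<in> A \<Longrightarrow> f i \<in> V; z \<in> V\<rbrakk> \<Longrightarrow> F (sum f A) z = (\<Sum>i\<in>A. F (f i) z)"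
  by (induction A rule: infinite_finite_induct) (simp_all add: add_left)

lemma self_eq_sq: "x \<in> V \<Longrightarrow> F x x = of_real (sq x)"
  using herm[of x x] unfolding sq_def by (simp add: complex_eq_iff)

lemma sq_scale: "x \<in> V \<Longrightarrow> sq (c *c x) = (cmod c)\<^sup>2 * sq x"
proof -
  assume x: "x \<in> V"
  then have "F (c *c x) (c *c x) = (c * cnj c) * F x x"
    by (simp add: scale_left scale_right)
  also have "\<dots> = of_real ((cmod c)\<^sup>2 * sq x)"
    by (simp add: self_eq_sq[OF x] complex_norm_square[symmetric])
  finally show ?thesis by (simp add: sq_def)
qed

lemma sq_add: "\<lbrakk>x \<in> V; y \<in> V\<rbrakk> \<Longrightarrow> sq (x + y) = sq x + sq y + 2 * Re (F x y)"
  using herm[of x y] unfolding sq_def by (simp add: add_left add_right)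

lemma sq_diff: "\<lbrakk>x \<in> V; y \<in> V\<rbrakk> \<Longrightarrow> sq (x - y) = sq x + sq y - 2 * Re (F x y)"
  using herm[of x y] unfolding sq_def by (simp add: diff_left diff_right)

lemma sq_zero [simp]: "sq 0 = 0"
  by (simp add: sq_def)

lemma hermitian_form_subspace:
  assumes M: "subspace M" "M \<subseteq> V"
  shows "hermitian_form scale M F"
proof
  have MV: "x \<in> V" if "x \<in> M" for x using M that by blast
  show "F y x = cnj (F x y)" if "x \<in> M" "y \<in> M" for x y
    using herm MV that by blast
qed (use M in \<open>simp_all add: add_left scale_left subset_iff\<close>)

end

lemma hermitian_form_lincomb:
  fixes scale :: "complex \<Rightarrow> 'a::ab_group_add \<Rightarrow> 'a"
  assumes "hermitian_form scale V F" "hermitian_form scale V G"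
  shows "hermitian_form scale V (\<lambda>x y. of_real r * F x y + of_real s * G x y)"
proof -
  interpret F: hermitian_form scale V F by fact
  interpret G: hermitian_form scale V G by fact
  show ?thesis
  proof
    show "of_real r * F y x + of_real s * G y x = cnj (of_real r * F x y + of_real s * G x y)"
      if "x \<in> V" "y \<in> V" for x y
      using F.herm[OF that] G.herm[OF that] by simp
  qed (auto simp: F.subspace_V F.add_left G.add_left F.scale_left G.scale_left algebra_simps)
qed

text \<open>Only a semi-inner product on a carrier set, since functions on the graph have arbitrary
  values off the edges and may differ on null sets: \<open>sq x = 0\<close> does not force
  \<open>x = 0\<close>. Conclusions that would usually say that a vector is zero say that it is
  null.\<close>

locale semi_inner = hermitian_form +
  assumes sq_nonneg: "x \<in> V \<Longrightarrow> 0 \<le> sq x"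
begin

lemma Cauchy_Schwarz_sq:
  assumes x: "x \<in> V" and y: "y \<in> V"
  shows "(cmod (F x y))\<^sup>2 \<le> sq x * sq y"
proof -
  define a where "a = (cmod (F x y))\<^sup>2"
  have a0: "a \<ge> 0" by (simp add: a_def)
  \<comment> \<open>Expand the square of \<open>x - (t * F x y) *c y\<close>; the factor
    \<open>F x y\<close> turns the cross term into the real number \<open>t * a\<close>.\<close>
  have main: "2 * t * a \<le> sq x + t\<^sup>2 * a * sq y" for t :: real
  proof -
    have "0 \<le> sq (x - (of_real t * F x y) *c y)"
      using x y by (intro sq_nonneg) simp
    also have "\<dots> = sq x + t\<^sup>2 * a * sq y - 2 * Re (cnj (of_real t * F x y) * F x y)"
      using x y by (simp add: sq_diff sq_scale scale_right norm_mult power_mult_distrib a_def)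
    also have "cnj (of_real t * F x y) * F x y = of_real (t * a)"
      by (simp add: a_def complex_norm_square mult_ac del: of_real_power)
    finally show ?thesis by simp
  qed
  show ?thesis
  proof (cases "sq y = 0")
    case True
    have "a = 0"
    proof (rule ccontr)
      assume "a \<noteq> 0"
      \<comment> \<open>With \<open>sq y = 0\<close> the bound is linear in \<open>t\<close>; this
        \<open>t\<close> makes its left side \<open>sq x + 1\<close>.\<close>
      then show False using main[of "(sq x + 1) / (2 * a)"] True by simp
    qed
    then show ?thesis using True by (simp add: a_def)
  next
    case False
    then have p: "sq y > 0" using sq_nonneg[OF y] by simp
    have "2 * a / sq y \<le> sq x + a / sq y"
      using main[of "1 / sq y"] p by (simp add: power2_eq_square)
    then have "a \<le> sq x * sq y" using p by (simp add: field_simps)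
    then show ?thesis by (simp add: a_def)
  qed
qed

definition nrm :: "'a \<Rightarrow> real" where "nrm x = sqrt (sq x)"

lemma nrm_nonneg [simp]: "x \<in> V \<Longrightarrow> 0 \<le> nrm x"
  by (simp add: nrm_def sq_nonneg)

lemma nrm_power2 [simp]: "x \<in> V \<Longrightarrow> (nrm x)\<^sup>2 = sq x"
  by (simp add: nrm_def sq_nonneg)

lemma Cauchy_Schwarz: "\<lbrakk>x \<in> V; y \<in> V\<rbrakk> \<Longrightarrow> cmod (F x y) \<le> nrm x * nrm y"
  by (rule power2_le_imp_le) (simp_all add: Cauchy_Schwarz_sq power_mult_distrib)

lemma nrm_triangle: "\<lbrakk>x \<in> V; y \<in> V\<rbrakk> \<Longrightarrow> nrm (x + y) \<le> nrm x + nrm y"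
proof (rule power2_le_imp_le)
  assume xy: "x \<in> V" "y \<in> V"
  have "Re (F x y) \<le> nrm x * nrm y"
    using Cauchy_Schwarz[OF xy] complex_Re_le_cmod order_trans by blast
  then show "(nrm (x + y))\<^sup>2 \<le> (nrm x + nrm y)\<^sup>2"
    using xy by (simp add: sq_add power2_sum)
qed simp

lemma nrm_minus_commute: "\<lbrakk>x \<in> V; y \<in> V\<rbrakk> \<Longrightarrow> nrm (x - y) = nrm (y - x)"
  using sq_diff[of x y] sq_diff[of y x] herm[of x y] by (simp add: nrm_def)

lemma nrm_triangle_diff: "\<lbrakk>x \<in> V; y \<in> V\<rbrakk> \<Longrightarrow> nrm (x - y) \<le> nrm x + nrm y"
  using nrm_triangle[of x "0 - y"] nrm_minus_commute[of 0 y] by simp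

lemma nrm_diff_ge: "\<lbrakk>x \<in> V; y \<in> V\<rbrakk> \<Longrightarrow> \<bar>nrm x - nrm y\<bar> \<le> nrm (x - y)"
  using nrm_triangle[of "x - y" y] nrm_triangle[of "y - x" x] nrm_minus_commute[of x y] by simp

definition tends_to :: "(nat \<Rightarrow> 'a) \<Rightarrow> 'a \<Rightarrow> bool" where
  "tends_to u x \<longleftrightarrow> (\<lambda>n. sq (u n - x)) \<longlonglongrightarrow> 0"

definition cauchy_seq :: "(nat \<Rightarrow> 'a) \<Rightarrow> bool" where
  "cauchy_seq u \<longleftrightarrow> (\<forall>e>0. \<exists>N. \<forall>m\<ge>N. \<forall>n\<ge>N. sq (u m - u n) < e)"

definition is_complete :: bool where
  "is_complete \<longleftrightarrow> (\<forall>u. (\<forall>n. u n \<in> V) \<longrightarrow> cauchy_seq u \<longrightarrow> (\<exists>x\<in>V. tends_to u x))"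

lemma is_completeE:
  assumes "is_complete" "\<And>n. u n \<in> V" "cauchy_seq u"
  obtains x where "x \<in> V" "tends_to u x"
  using assms unfolding is_complete_def by blast

lemma tends_to_nrm: "tends_to u x \<Longrightarrow> (\<lambda>n. nrm (u n - x)) \<longlonglongrightarrow> 0"
  unfolding tends_to_def nrm_def using tendsto_real_sqrt by fastforce

lemma tends_to_form:
  assumes b: "hermitian_form scale V b"
    and bd: "\<And>x y. \<lbrakk>x \<in> V; y \<in> V\<rbrakk> \<Longrightarrow> cmod (b x y) \<le> C * nrm x * nrm y"
    and "tends_to u x" and u: "\<And>n. u n \<in> V" and x: "x \<in> V" and v: "v \<in> V"
  shows "(\<lambda>n. b (u n) v) \<longlonglongrightarrow> b x v"
proof -
  interpret b: hermitian_form scale V b by fact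
  have "(\<lambda>n. b (u n) v - b x v) \<longlonglongrightarrow> 0"
  proof (rule tendsto_0_le)
    show "(\<lambda>n. nrm (u n - x)) \<longlonglongrightarrow> 0" using assms tends_to_nrm by blast
    show "\<forall>\<^sub>F n in sequentially. norm (b (u n) v - b x v) \<le> norm (nrm (u n - x)) * (C * nrm v)"
    proof (intro always_eventually allI)
      fix n
      have "b (u n) v - b x v = b (u n - x) v" using u x v by (simp add: b.diff_left)
      then show "norm (b (u n) v - b x v) \<le> norm (nrm (u n - x)) * (C * nrm v)"
        using bd[of "u n - x" v] u x v by (simp add: mult_ac)
    qed
  qed
  then show ?thesis by (simp add: LIM_zero_iff)
qed

lemma tends_to_left:
  "\<lbrakk>tends_to u x; \<And>n. u n \<in> V; x \<in> V; v \<in> V\<rbrakk> \<Longrightarrow> (\<lambda>n. F (u n) v) \<longlonglongrightarrow> F x v"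
  by (rule tends_to_form[where C=1]) (auto simp: hermitian_form_axioms Cauchy_Schwarz)

lemma tends_to_sq:
  assumes "tends_to u x" "\<And>n. u n \<in> V" "x \<in> V"
  shows "(\<lambda>n. sq (u n)) \<longlonglongrightarrow> sq x"
proof -
  have "(\<lambda>n. nrm (u n) - nrm x) \<longlonglongrightarrow> 0"
    by (rule tendsto_0_le[OF tends_to_nrm[OF assms(1)], where K=1])
       (use assms nrm_diff_ge in \<open>auto intro!: always_eventually\<close>)
  then have "(\<lambda>n. nrm (u n)) \<longlonglongrightarrow> nrm x" by (simp add: LIM_zero_iff)
  from tendsto_power[OF this, of 2] show ?thesis using assms by simp
qed

lemma semi_inner_subspace:
  assumes "subspace M" "M \<subseteq> V"
  shows "semi_inner scale M F"
proof -
  interpret M: hermitian_form scale M F by (rule hermitian_form_subspace[OF assms])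
  show ?thesis
  proof
    show "0 \<le> M.sq x" if "x \<in> M" for x
      using sq_nonneg[of x] that assms(2) unfolding M.sq_def sq_def by blast
  qed
qed

text \<open>Cauchy--Schwarz for the nonnegative forms \<open>mF + b\<close> and \<open>mF - b\<close>.\<close>

lemma bound_from_diagonal:
  assumes b: "hermitian_form scale V b" and m: "0 \<le> m"
    and diag: "\<And>u. u \<in> V \<Longrightarrow> \<bar>Re (b u u)\<bar> \<le> m * sq u"
    and u: "u \<in> V" and v: "v \<in> V"
  shows "cmod (b u v) \<le> 2 * m * nrm u * nrm v"
proof -
  have bnd: "cmod (of_real m * F u v + of_real s * b u v) \<le> 2 * m * nrm u * nrm v"
    if s: "s = 1 \<or> s = -1" for s :: real
  proof -
    let ?G = "\<lambda>x y. of_real m * F x y + of_real s * b x y"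
    interpret G: hermitian_form scale V ?G
      using hermitian_form_lincomb[OF hermitian_form_axioms b, of m s] .
    have Gsq: "G.sq x = m * sq x + s * Re (b x x)" for x by (simp add: G.sq_def sq_def)
    interpret G: semi_inner scale V ?G
    proof
      show "0 \<le> G.sq x" if "x \<in> V" for x using diag[OF that] s by (auto simp: Gsq)
    qed
    have le: "G.sq x \<le> 2 * m * sq x" if "x \<in> V" for x using diag[OF that] s by (auto simp: Gsq)
    have "(cmod (?G u v))\<^sup>2 \<le> G.sq u * G.sq v" by (rule G.Cauchy_Schwarz_sq[OF u v])
    also have "\<dots> \<le> (2 * m * sq u) * (2 * m * sq v)"
      using le u v m by (intro mult_mono) (auto simp: G.sq_nonneg sq_nonneg)
    also have "\<dots> = (2 * m * nrm u * nrm v)\<^sup>2" 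
      using u v by (simp only: power_mult_distrib nrm_power2) (simp only: power2_eq_square mult_ac)
    finally show ?thesis by (rule power2_le_imp_le) (use m u v in simp)
  qed
  have "cmod (2 * b u v) \<le> cmod (of_real m * F u v + of_real 1 * b u v)
      + cmod (of_real m * F u v + of_real (-1) * b u v)"
    using norm_triangle_ineq4[of "of_real m * F u v + of_real 1 * b u v"
        "of_real m * F u v + of_real (-1) * b u v"] by simp
  also have "\<dots> \<le> 2 * m * nrm u * nrm v + 2 * m * nrm u * nrm v"
    by (intro add_mono bnd) auto
  finally show ?thesis by (simp add: norm_mult)
qed

section \<open>Orthonormal sequences and projections\<close>

definition orthonormal :: "(nat \<Rightarrow> 'a) \<Rightarrow> nat set \<Rightarrow> bool" where
  "orthonormal y A \<longleftrightarrow> (\<forall>i\<in>A. y i \<in> V \<and> (\<forall>j\<in>A. F (y i) (y j) = (if i = j then 1 else 0)))"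

lemma orthonormal_subset: "orthonormal y A \<Longrightarrow> B \<subseteq> A \<Longrightarrow> orthonormal y B"
  unfolding orthonormal_def by (meson subsetD)

lemma form_lincomb:
  assumes "orthonormal y A" "finite B" "B \<subseteq> A" "k \<in> A"
  shows "F (\<Sum>j\<in>B. c j *c y j) (y k) = (if k \<in> B then c k else 0)"
proof -
  have yV: "y j \<in> V" if "j \<in> A" for j using assms that by (auto simp: orthonormal_def)
  have "F (\<Sum>j\<in>B. c j *c y j) (y k) = (\<Sum>j\<in>B. c j * F (y j) (y k))"
    using assms yV by (subst sum_left) (auto simp: scale_left subset_iff)
  also have "\<dots> = (\<Sum>j\<in>B. if j = k then c j else 0)"
    using assms by (intro sum.cong) (auto simp: orthonormal_def subset_iff)
  finally show ?thesis using assms by simp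
qed

lemma sq_lincomb:
  assumes "orthonormal y B" "finite B"
  shows "sq (\<Sum>j\<in>B. c j *c y j) = (\<Sum>j\<in>B. (cmod (c j))\<^sup>2)"
proof -
  let ?x = "\<Sum>j\<in>B. c j *c y j"
  have yV: "y j \<in> V" if "j \<in> B" for j using assms that by (auto simp: orthonormal_def)
  have xV: "?x \<in> V" using yV by simp
  have "F ?x ?x = (\<Sum>j\<in>B. c j * F (y j) ?x)"
    using yV xV by (subst sum_left) (auto simp: scale_left)
  also have "\<dots> = (\<Sum>j\<in>B. of_real ((cmod (c j))\<^sup>2))"
  proof (rule sum.cong)
    fix j assume j: "j \<in> B"
    have "F (y j) ?x = cnj (c j)"
      using form_lincomb[OF assms(1,2) order_refl j, of c] herm[OF xV yV[OF j]] j by simp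
    then show "c j * F (y j) ?x = of_real ((cmod (c j))\<^sup>2)" by (simp add: complex_norm_square[symmetric])
  qed simp
  finally show ?thesis by (simp add: sq_def)
qed

lemma sq_remainder:
  assumes o: "orthonormal y B" "finite B" and u: "u \<in> V"
  shows "sq (u - (\<Sum>j\<in>B. F u (y j) *c y j)) = sq u - (\<Sum>j\<in>B. (cmod (F u (y j)))\<^sup>2)"
proof -
  let ?x = "\<Sum>j\<in>B. F u (y j) *c y j"
  have yV: "y j \<in> V" if "j \<in> B" for j using assms that by (auto simp: orthonormal_def)
  have xV: "?x \<in> V" using yV by simp
  have "F ?x u = (\<Sum>j\<in>B. F u (y j) * F (y j) u)"
    using yV u by (subst sum_left) (auto simp: scale_left)
  also have "\<dots> = (\<Sum>j\<in>B. of_real ((cmod (F u (y j)))\<^sup>2))"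
  proof (rule sum.cong)
    fix j assume "j \<in> B"
    then show "F u (y j) * F (y j) u = of_real ((cmod (F u (y j)))\<^sup>2)"
      using herm[OF u yV[of j]] by (simp only: complex_norm_square)
  qed simp
  finally have "Re (F u ?x) = (\<Sum>j\<in>B. (cmod (F u (y j)))\<^sup>2)"
    using herm[OF xV u] by simp
  then show ?thesis using sq_diff[OF u xV] sq_lincomb[OF o] by simp
qed

lemma remainder_orthogonal:
  assumes o: "orthonormal y B" "finite B" and u: "u \<in> V" and "k \<in> B"
  shows "F (u - (\<Sum>j\<in>B. F u (y j) *c y j)) (y k) = 0"
proof -
  have yV: "y j \<in> V" if "j \<in> B" for j using assms that by (auto simp: orthonormal_def)
  then show ?thesis using assms form_lincomb[OF o order_refl \<open>k \<in> B\<close>, of "\<lambda>j. F u (y j)"]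
    by (simp add: diff_left)
qed

text \<open>Riesz-Fischer: by \<open>sq_lincomb\<close> the differences of partial sums are blocks
  of the scalar series, so the partial sums are Cauchy; each coefficient is constant from stage
  \<open>Suc k\<close> on and passes to the limit.\<close>

lemma orthonormal_series:
  assumes "is_complete" and o: "orthonormal y UNIV" and s: "summable (\<lambda>k. (cmod (c k))\<^sup>2)"
  shows "\<exists>x\<in>V. tends_to (\<lambda>N. \<Sum>j<N. c j *c y j) x \<and> (\<forall>k. F x (y k) = c k)"
proof -
  let ?u = "\<lambda>N. \<Sum>j<N. c j *c y j"
  have yV: "y j \<in> V" for j using o by (auto simp: orthonormal_def)
  have uV: "?u N \<in> V" for N using yV by simp
  have "cauchy_seq ?u" unfolding cauchy_seq_def
  proof (intro allI impI)
    fix e :: real assume "e > 0"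
    then obtain N where N: "\<And>m n. m \<ge> N \<Longrightarrow> norm (\<Sum>k\<in>{m..<n}. (cmod (c k))\<^sup>2) < e"
      using s unfolding summable_Cauchy by metis
    have *: "sq (?u n - ?u m) < e" if "N \<le> m" "m \<le> n" for m n
    proof -
      have "?u n - ?u m = (\<Sum>j\<in>{m..<n}. c j *c y j)"
        using that sum_diff_nat_ivl[of 0 m n "\<lambda>j. c j *c y j"] by (simp add: lessThan_atLeast0)
      then show ?thesis using N[of m n] that sq_lincomb[OF orthonormal_subset[OF o], of "{m..<n}" c]
        by simp
    qed
    have "sq (?u m - ?u n) < e" if "N \<le> m" "N \<le> n" for m n
    proof (cases "m \<le> n")
      case True
      have "sq (?u m - ?u n) = sq (?u n - ?u m)"
        using nrm_minus_commute[OF uV[of m] uV[of n]] by (simp add: nrm_def)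
      then show ?thesis using * that True by simp
    qed (use * that in simp)
    then show "\<exists>N. \<forall>m\<ge>N. \<forall>n\<ge>N. sq (?u m - ?u n) < e" by blast
  qed
  with is_completeE[OF assms(1) uV] obtain x where x: "x \<in> V" "tends_to ?u x" .
  have "F x (y k) = c k" for k
  proof (rule LIMSEQ_unique)
    show "(\<lambda>N. F (?u N) (y k)) \<longlonglongrightarrow> F x (y k)" by (rule tends_to_left[OF x(2) uV x(1) yV])
    have "F (?u N) (y k) = c k" if "N > k" for N
      using form_lincomb[OF o, of "{..<N}" k c] that by simp
    then show "(\<lambda>N. F (?u N) (y k)) \<longlonglongrightarrow> c k"
      by (intro tendsto_eventually eventually_sequentiallyI[of "Suc k"]) auto
  qed
  then show ?thesis using x by blast
qed

lemma Bessel: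
  assumes o: "orthonormal y UNIV" and u: "u \<in> V"
  shows "summable (\<lambda>k. (cmod (F u (y k)))\<^sup>2)"
proof (rule summableI_nonneg_bounded)
  show "(\<Sum>k<n. (cmod (F u (y k)))\<^sup>2) \<le> sq u" for n
  proof -
    have yV: "y j \<in> V" for j using o by (auto simp: orthonormal_def)
    have "0 \<le> sq (u - (\<Sum>j<n. F u (y j) *c y j))"
      using u yV by (intro sq_nonneg) simp
    then show ?thesis using sq_remainder[OF orthonormal_subset[OF o], of "{..<n}" u] u by simp
  qed
qed simp

text \<open>The limit of a minimising sequence is the orthogonal projection onto the closure of \<open>D\<close>.\<close>

lemma dense_if_orthogonal_complement_null:
  assumes "is_complete" and D: "subspace D" "D \<subseteq> V"
    and null: "\<And>x. \<lbrakk>x \<in> V; \<And>d. d \<in> D \<Longrightarrow> F x d = 0\<rbrakk> \<Longrightarrow> sq x = 0"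
    and x: "x \<in> V" and "0 < e"
  shows "\<exists>d\<in>D. sq (x - d) < e"
proof -
  define \<delta> where "\<delta> = (INF d\<in>D. sq (x - d))"
  have D0: "0 \<in> D" using D by (simp add: subspace_0)
  have DV: "d \<in> V" if "d \<in> D" for d using D that by auto
  have bb: "bdd_below ((\<lambda>d. sq (x - d)) ` D)"
    using DV x by (intro bdd_belowI[of _ 0]) (auto intro!: sq_nonneg)
  have lower: "\<delta> \<le> sq (x - d)" if "d \<in> D" for d
    unfolding \<delta>_def by (rule cINF_lower[OF bb that])
  have "\<exists>d\<in>D. sq (x - d) < \<delta> + inverse (Suc n)" for n
    using cINF_less_iff[OF _ bb, of "\<delta> + inverse (Suc n)"] D0 unfolding \<delta>_def by fastforce
  then obtain d where dD: "\<And>n. d n \<in> D" and d: "\<And>n. sq (x - d n) < \<delta> + inverse (Suc n)" by metis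
  have dV: "d n \<in> V" for n using dD DV by blast
  \<comment> \<open>Parallelogram law: the midpoint of \<open>d m\<close> and \<open>d n\<close>
    lies in \<open>D\<close>, so its squared distance from \<open>x\<close> is at least
    \<open>\<delta>\<close>.\<close>
  have par: "sq (d m - d n) \<le> 2 * inverse (Suc m) + 2 * inverse (Suc n)" for m n
  proof -
    have mid: "(1/2) *c (d m + d n) \<in> D" using dD D by (intro subspace_scale subspace_add) auto
    have eq: "(x - d m) + (x - d n) = 2 *c (x - (1/2) *c (d m + d n))"
    proof -
      have "2 *c (x - (1/2) *c (d m + d n)) = 2 *c x - (d m + d n)"
        by (simp add: scale_right_diff_distrib)
      also have "2 *c x = x + x"
        by (metis one_add_one scale_left_distrib scale_one)
      finally show ?thesis by simp
    qed
    have "4 * \<delta> \<le> 4 * sq (x - (1/2) *c (d m + d n))" using lower[OF mid] by simp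
    also have "\<dots> = sq ((x - d m) + (x - d n))" unfolding eq using x dV by (subst sq_scale) auto
    also have "\<dots> + sq ((x - d m) - (x - d n)) = 2 * sq (x - d m) + 2 * sq (x - d n)"
      using x dV by (subst sq_add, simp, simp, subst sq_diff) simp_all
    finally have "4 * \<delta> + sq (d n - d m) \<le> 2 * sq (x - d m) + 2 * sq (x - d n)" by simp
    moreover have "sq (d n - d m) = sq (d m - d n)"
      using nrm_minus_commute[OF dV[of m] dV[of n]] by (simp add: nrm_def)
    ultimately show ?thesis using d[of m] d[of n] by linarith
  qed
  have "cauchy_seq d" unfolding cauchy_seq_def
  proof (intro allI impI)
    fix e :: real assume "e > 0"
    then obtain N where N: "inverse (real (Suc N)) < e / 4" using reals_Archimedean[of "e/4"] by auto
    have "sq (d m - d n) < e" if "m \<ge> N" "n \<ge> N" for m n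
    proof -
      have "inverse (real (Suc m)) \<le> inverse (real (Suc N))" "inverse (real (Suc n)) \<le> inverse (real (Suc N))"
        using that by (auto intro!: le_imp_inverse_le)
      then show ?thesis using par[of m n] N by linarith
    qed
    then show "\<exists>N. \<forall>m\<ge>N. \<forall>n\<ge>N. sq (d m - d n) < e" by blast
  qed
  with is_completeE[OF assms(1) dV] obtain h where h: "h \<in> V" "tends_to d h" .
  have lim: "(\<lambda>n. sq (x - d n - z)) \<longlonglongrightarrow> sq (x - h - z)" if "z \<in> V" for z
  proof (rule tends_to_sq)
    have "sq (x - d n - z - (x - h - z)) = sq (d n - h)" for n
    proof -
      have "x - d n - z - (x - h - z) = h - d n" by simp
      then show ?thesis using nrm_minus_commute[OF h(1) dV[of n]] by (simp add: nrm_def)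
    qed
    then show "tends_to (\<lambda>n. x - d n - z) (x - h - z)" using h by (simp add: tends_to_def)
  qed (use x dV h that in auto)
  have "sq (x - h - 0) \<le> \<delta> + 0"
  proof (rule LIMSEQ_le[OF lim])
    show "(\<lambda>n. \<delta> + inverse (Suc n)) \<longlonglongrightarrow> \<delta> + 0"
      by (intro tendsto_add tendsto_const LIMSEQ_inverse_real_of_nat)
    show "\<exists>N. \<forall>n\<ge>N. sq (x - d n - 0) \<le> \<delta> + inverse (Suc n)"
      using d less_imp_le by auto
  qed simp
  then have up: "sq (x - h) \<le> \<delta>" by simp
  \<comment> \<open>\<open>D\<close> need not be closed, so \<open>h\<close> may lie outside it. The
    bound holds for the competitors \<open>d n + c *c z\<close>, which are in \<open>D\<close>, and
    passes to the limit.\<close>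
  have ge: "\<delta> \<le> sq (x - h - c *c z)" if "z \<in> D" for c z
  proof (rule LIMSEQ_le_const[OF lim])
    show "c *c z \<in> V" using that DV by simp
    have "\<delta> \<le> sq (x - (d n + c *c z))" for n
      using that dD D by (intro lower subspace_add subspace_scale) auto
    then show "\<exists>N. \<forall>n\<ge>N. \<delta> \<le> sq (x - d n - c *c z)" by (simp add: diff_diff_eq)
  qed
  have "F (x - h) z = 0" if z: "z \<in> D" for z
  proof (rule ccontr)
    assume nz: "F (x - h) z \<noteq> 0"
    define a where "a = (cmod (F (x - h) z))\<^sup>2"
    have a: "a > 0" using nz by (simp add: a_def)
    have zV: "z \<in> V" "x - h \<in> V" using z DV x h by auto
    \<comment> \<open>Small enough for \<open>t * sq z < 2\<close>, so that moving from
      \<open>h\<close> along \<open>z\<close> would come strictly closer to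
      \<open>x\<close>.\<close>
    define t where "t = 1 / (sq z + 1)"
    have sz: "sq z \<ge> 0" using sq_nonneg zV by auto
    then have t: "t > 0" by (simp add: t_def)
    have "sq (x - h - (of_real t * F (x - h) z) *c z)
        = sq (x - h) + t\<^sup>2 * a * sq z - 2 * Re (cnj (of_real t * F (x - h) z) * F (x - h) z)"
      using zV by (simp add: sq_diff sq_scale scale_right norm_mult power_mult_distrib a_def)
    also have "cnj (of_real t * F (x - h) z) * F (x - h) z = of_real (t * a)"
      by (simp add: a_def complex_norm_square mult_ac del: of_real_power)
    finally have "0 \<le> t\<^sup>2 * a * sq z - 2 * (t * a)"
      using ge[OF z, of "of_real t * F (x - h) z"] up by simp
    then have "0 \<le> (t * a) * (t * sq z - 2)" by (simp add: power2_eq_square algebra_simps)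
    moreover have "t * sq z - 2 < 0" using sz by (simp add: t_def field_simps)
    ultimately show False using mult_pos_pos[OF t a] by (simp add: zero_le_mult_iff)
  qed
  then have "sq (x - h) = 0" using x h by (intro null) auto
  then have "\<delta> = 0 \<or> \<delta> < 0" using ge[OF D0, of 0] by auto
  then have "\<delta> < e" using \<open>0 < e\<close> by auto
  then show ?thesis using cINF_less_iff[OF _ bb, of e] D0 unfolding \<delta>_def by blast
qed

end

section \<open>Compact Hermitian forms\<close>

text \<open>Dependent choice with the whole history: each new entry may depend on all earlier ones.
  Locality of \<open>\<Phi>\<close> ensures that an extension does not spoil what was already
  established.\<close>

lemma dependent_sequence:
  fixes \<Phi> :: "(nat \<Rightarrow> 'b) \<Rightarrow> nat \<Rightarrow> bool"
  assumes ex: "\<And>n y. (\<And>i. i < n \<Longrightarrow> \<Phi> y i) \<Longrightarrow> \<exists>e. \<Phi> (y(n := e)) n"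
    and local: "\<And>y y' n. (\<And>i. i \<le> n \<Longrightarrow> y i = y' i) \<Longrightarrow> \<Phi> y n \<Longrightarrow> \<Phi> y' n"
  shows "\<exists>y. \<forall>n. \<Phi> y n"
proof -
  have "\<exists>f. \<forall>n. (\<forall>i<n. \<Phi> (f n) i) \<and> (\<forall>i<n. f (Suc n) i = f n i)"
  proof (rule dependent_nat_choice)
    fix y n assume y: "\<forall>i<n. \<Phi> y i"
    then obtain e where e: "\<Phi> (y(n := e)) n" using ex by blast
    have "\<Phi> (y(n := e)) i" if "i < Suc n" for i
    proof (cases "i = n")
      case False
      then show ?thesis using y that by (intro local[of i y "y(n := e)"]) auto
    qed (use e in simp)
    then show "\<exists>y'. (\<forall>i<Suc n. \<Phi> y' i) \<and> (\<forall>i<n. y' i = y i)"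
      by (intro exI[of _ "y(n := e)"]) auto
  qed simp
  then obtain f where f: "\<And>n i. i < n \<Longrightarrow> \<Phi> (f n) i" "\<And>n i. i < n \<Longrightarrow> f (Suc n) i = f n i"
    by blast
  \<comment> \<open>Stage \<open>Suc i\<close> fixes entry \<open>i\<close> for good, so the
    diagonal \<open>f (Suc i) i\<close> agrees with every later stage.\<close>
  have stable: "f n i = f (Suc i) i" if "i < n" for n i
    using that
  proof (induction n)
    case (Suc n)
    then show ?case using f(2)[of i n] by (cases "i = n") auto
  qed simp
  have "\<Phi> (\<lambda>i. f (Suc i) i) n" for n
  proof (rule local[OF _ f(1)[OF lessI]])
    show "f (Suc n) i = f (Suc i) i" if "i \<le> n" for i
      using that by (intro stable) simp
  qed
  then show ?thesis by blast
qed

text \<open>Rellich's theorem in abstract form. Only an \<open>S\<close>-Cauchy subsequence is asked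
  for, without a limit, because completeness is available for \<open>F\<close> only.\<close>

locale compact_embedding = F: semi_inner scale V F + S: semi_inner scale V S
  for scale :: "complex \<Rightarrow> 'a::ab_group_add \<Rightarrow> 'a" (infixr "*c" 75) and V F S +
  fixes C :: real
  assumes C_pos: "0 < C"
    and S_le_F: "x \<in> V \<Longrightarrow> S.sq x \<le> C * F.sq x"
    and complete: "F.is_complete"
    and compact: "\<lbrakk>\<And>n. u n \<in> V; \<And>n. F.sq (u n) \<le> D\<rbrakk> \<Longrightarrow>
      \<exists>r::nat \<Rightarrow> nat. strict_mono r \<and> S.cauchy_seq (\<lambda>n. u (r n))"

locale compact_form = compact_embedding + b: hermitian_form scale V b for b +
  assumes b_le: "\<lbrakk>x \<in> V; y \<in> V\<rbrakk> \<Longrightarrow> cmod (b x y) \<le> S.nrm x * S.nrm y"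
begin

lemma S_nrm_le: "x \<in> V \<Longrightarrow> S.nrm x \<le> sqrt C * F.nrm x"
  using S_le_F[of x] by (simp add: S.nrm_def F.nrm_def flip: real_sqrt_mult)

lemma b_le_F: "\<lbrakk>x \<in> V; y \<in> V\<rbrakk> \<Longrightarrow> cmod (b x y) \<le> C * F.nrm x * F.nrm y"
proof -
  assume xy: "x \<in> V" "y \<in> V"
  have "cmod (b x y) \<le> S.nrm x * S.nrm y" by (rule b_le[OF xy])
  also have "\<dots> \<le> (sqrt C * F.nrm x) * (sqrt C * F.nrm y)"
    using xy S_nrm_le C_pos by (intro mult_mono) auto
  also have "\<dots> = (sqrt C * sqrt C) * F.nrm x * F.nrm y" by (simp only: mult_ac)
  finally show ?thesis using C_pos by simp
qed

lemma b_sq_le: "x \<in> V \<Longrightarrow> \<bar>b.sq x\<bar> \<le> C * F.sq x"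
  using order_trans[OF abs_Re_le_cmod b_le_F[of x x]] F.nrm_power2[of x]
  by (simp add: b.sq_def power2_eq_square mult.assoc)

text \<open>A maximising sequence of \<open>b\<close> is almost in the kernel of the nonnegative form \<open>mF - b\<close>;
  compactness of \<open>b\<close> then makes it \<open>F\<close>-Cauchy.\<close>

lemma maximum_attained:
  assumes M: "F.subspace M" "M \<subseteq> V"
    and closed: "\<And>u x. \<lbrakk>\<And>n. u n \<in> M; x \<in> V; F.tends_to u x\<rbrakk> \<Longrightarrow> x \<in> M"
    and m: "0 < m" "\<And>u. u \<in> M \<Longrightarrow> b.sq u \<le> m * F.sq u"
    and sup: "\<And>e. 0 < e \<Longrightarrow> \<exists>u\<in>M. F.sq u \<le> 1 \<and> m - e < b.sq u"
  shows "\<exists>y\<in>M. F.sq y = 1 \<and> (\<forall>v\<in>M. b y v = of_real m * F y v)"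
proof -
  have MV: "x \<in> V" if "x \<in> M" for x using M that by blast
  define H where "H = (\<lambda>x y. of_real m * F x y + of_real (-1) * b x y)"
  interpret G: hermitian_form scale M H unfolding H_def
    by (rule hermitian_form_lincomb[OF F.hermitian_form_subspace[OF M] b.hermitian_form_subspace[OF M]])
  have Gsq: "G.sq x = m * F.sq x - b.sq x" for x
    unfolding G.sq_def F.sq_def b.sq_def by (simp add: H_def)
  interpret G: semi_inner scale M H
    by standard (use m(2) Gsq in simp)
  have "\<forall>n. \<exists>u\<in>M. F.sq u \<le> 1 \<and> m - inverse (real (Suc n)) < b.sq u"
    using sup by simp
  then obtain w where w: "\<And>n. w n \<in> M" "\<And>n. F.sq (w n) \<le> 1" "\<And>n. m - inverse (real (Suc n)) < b.sq (w n)"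
    by metis
  have wV: "w n \<in> V" for n using w MV by blast
  obtain r where r: "strict_mono r" "S.cauchy_seq (\<lambda>n. w (r n))"
    using compact[of w 1] wV w(2) by blast
  define u where "u n = w (r n)" for n
  have uM: "u n \<in> M" and uV: "u n \<in> V" and u1: "F.sq (u n) \<le> 1" for n
    using w wV by (auto simp: u_def)
  have r_ge: "inverse (real (Suc (r n))) \<le> inverse (real (Suc n))" for n
    using seq_suble[OF r(1), of n] by (intro le_imp_inverse_le) auto
  have b_ge: "m - inverse (real (Suc n)) < b.sq (u n)" for n
    using w(3)[of "r n"] r_ge[of n] unfolding u_def by linarith
  have Gu: "G.sq (u n) \<le> inverse (real (Suc n))" for n
    using b_ge[of n] mult_left_mono[OF u1[of n], of m] m(1) unfolding Gsq by linarith
  have Gle: "G.sq v \<le> (m + C) * F.sq v" if "v \<in> M" for v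
    using b_sq_le[OF MV[OF that]] by (simp add: Gsq algebra_simps)
  \<comment> \<open>Split \<open>m * F.sq v\<close> into \<open>G.sq v + b.sq v\<close>.
    Cauchy-Schwarz for \<open>H\<close> makes the first part small, as \<open>G.sq (u n)\<close>
    tends to 0; the second is small because \<open>u\<close> is \<open>S\<close>-Cauchy.\<close>
  have key: "m * F.sq v \<le> S.nrm v * (S.nrm (u k) + S.nrm (u n))
      + (sqrt (inverse (real (Suc k))) + sqrt (inverse (real (Suc n)))) * G.nrm v" 
    if v: "v = u k - u n" for v k n
  proof -
    have vM: "v \<in> M" using uM v M by (simp add: G.V_diff)
    have vV: "v \<in> V" using vM MV by blast
    have gn: "G.nrm (u j) \<le> sqrt (inverse (real (Suc j)))" for j
      unfolding G.nrm_def using Gu by simp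
    have "H v v = H (u k) v - H (u n) v" using G.diff_left[OF uM uM vM, of k n] v by simp
    then have "cmod (H v v) \<le> cmod (H (u k) v) + cmod (H (u n) v)"
      by (metis norm_triangle_ineq4)
    also have "\<dots> \<le> G.nrm (u k) * G.nrm v + G.nrm (u n) * G.nrm v"
      by (intro add_mono G.Cauchy_Schwarz uM vM)
    also have "\<dots> \<le> sqrt (inverse (real (Suc k))) * G.nrm v + sqrt (inverse (real (Suc n))) * G.nrm v"
      by (intro add_mono mult_right_mono gn) (use vM in auto)
    finally have g: "G.sq v \<le> (sqrt (inverse (real (Suc k))) + sqrt (inverse (real (Suc n)))) * G.nrm v"
      using complex_Re_le_cmod[of "H v v"] unfolding G.sq_def by (simp add: algebra_simps)
    have "b.sq v \<le> S.nrm v * S.nrm v"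
      using complex_Re_le_cmod[of "b v v"] b_le[OF vV vV] unfolding b.sq_def by linarith
    also have "\<dots> \<le> S.nrm v * (S.nrm (u k) + S.nrm (u n))"
    proof (rule mult_left_mono)
      show "S.nrm v \<le> S.nrm (u k) + S.nrm (u n)"
        unfolding v by (rule S.nrm_triangle_diff[OF uV uV])
    qed (use vV in simp)
    finally show ?thesis using g Gsq[of v] by linarith
  qed
  have Sb: "S.nrm (u n) \<le> sqrt C" for n
  proof -
    have "S.sq (u n) \<le> C"
      using S_le_F[OF uV[of n]] mult_left_mono[OF u1[of n], of C] C_pos by linarith
    then show ?thesis by (simp add: S.nrm_def)
  qed
  have Fdiff: "F.sq (u k - u n) \<le> 4" for k n
  proof -
    have "F.nrm (u k - u n) \<le> F.nrm (u k) + F.nrm (u n)"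
      by (rule F.nrm_triangle_diff[OF uV uV])
    also have "F.nrm (u k) + F.nrm (u n) \<le> 1 + 1"
      using u1 by (intro add_mono) (simp_all add: F.nrm_def)
    finally have "(F.nrm (u k - u n))\<^sup>2 \<le> 2\<^sup>2" using uV by (intro power_mono) auto
    then show ?thesis using uV by simp
  qed
  define K where "K = sqrt ((m + C) * 4)"
  have GK: "G.nrm (u k - u n) \<le> K" for k n
  proof -
    have "G.sq (u k - u n) \<le> (m + C) * 4"
      using Gle[of "u k - u n"] uM Fdiff[of k n] m(1) C_pos
        mult_left_mono[OF Fdiff[of k n], of "m + C"] by fastforce
    then show ?thesis by (simp add: G.nrm_def K_def)
  qed
  have K0: "0 < K" using m C_pos by (simp add: K_def)
  have "F.cauchy_seq u" unfolding F.cauchy_seq_def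
  proof (intro allI impI)
    fix e :: real assume e: "e > 0"
    \<comment> \<open>Chosen so that \<open>d * (2 * sqrt C) = m * e / 4\<close>: each of the two
      terms of \<open>key\<close> gets a share of \<open>m * e / 4\<close>.\<close>
    define d where "d = m * e / (4 * (2 * sqrt C))"
    have d: "d > 0" using e m C_pos by (simp add: d_def)
    then obtain N1 where N1: "\<And>k n. k \<ge> N1 \<Longrightarrow> n \<ge> N1 \<Longrightarrow> S.sq (u k - u n) < d\<^sup>2"
      using r(2) unfolding S.cauchy_seq_def u_def by (meson zero_less_power)
    have "(\<lambda>n. sqrt (inverse (real (Suc n)))) \<longlonglongrightarrow> sqrt 0"
      by (intro tendsto_real_sqrt LIMSEQ_inverse_real_of_nat)
    moreover have "m * e / (8 * K) > 0" using e m K0 by simp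
    ultimately have "\<forall>\<^sub>F n in sequentially. sqrt (inverse (real (Suc n))) < m * e / (8 * K)"
      using order_tendstoD(2) by fastforce
    then obtain N2 where N2: "\<And>n. n \<ge> N2 \<Longrightarrow> sqrt (inverse (real (Suc n))) < m * e / (8 * K)"
      unfolding eventually_sequentially by blast
    have "F.sq (u k - u n) < e" if kn: "max N1 N2 \<le> k" "max N1 N2 \<le> n" for k n
    proof -
      let ?v = "u k - u n"
      have "S.nrm ?v < d"
        using N1[of k n] kn d real_sqrt_less_mono[of "S.sq ?v" "d\<^sup>2"] by (simp add: S.nrm_def)
      then have "S.nrm ?v * (S.nrm (u k) + S.nrm (u n)) \<le> d * (2 * sqrt C)"
        using Sb[of k] Sb[of n] uV d by (intro mult_mono) auto
      moreover have "d * (2 * sqrt C) = m * e / 4" using C_pos by (simp add: d_def)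
      ultimately have 1: "S.nrm ?v * (S.nrm (u k) + S.nrm (u n)) \<le> m * e / 4" by linarith
      have "(sqrt (inverse (real (Suc k))) + sqrt (inverse (real (Suc n)))) * G.nrm ?v
          \<le> (m * e / (8 * K) + m * e / (8 * K)) * K"
        using N2[of k] N2[of n] kn GK[of k n] uM e m K0 by (intro mult_mono add_mono) auto
      then have 2: "(sqrt (inverse (real (Suc k))) + sqrt (inverse (real (Suc n)))) * G.nrm ?v \<le> m * e / 4"
        using K0 by (simp add: field_simps)
      have "m * F.sq ?v \<le> m * e / 2" using key[OF refl, of k n] 1 2 by linarith
      also have "\<dots> < m * e" using m e by simp
      finally show ?thesis using m by simp
    qed
    then show "\<exists>N. \<forall>m\<ge>N. \<forall>n\<ge>N. F.sq (u m - u n) < e" by blast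
  qed
  with F.is_completeE[OF complete uV] obtain y where y: "y \<in> V" "F.tends_to u y" .
  have yM: "y \<in> M" by (rule closed[OF uM y])
  have "b y v = of_real m * F y v" if v: "v \<in> M" for v
  proof -
    have vV: "v \<in> V" by (rule MV[OF v])
    have "(\<lambda>n. H (u n) v) \<longlonglongrightarrow> H y v" unfolding H_def
      by (intro tendsto_add tendsto_mult tendsto_const F.tends_to_left[OF y(2) uV y(1) vV]
          F.tends_to_form[OF b.hermitian_form_axioms b_le_F y(2) uV y(1) vV])
    moreover have "(\<lambda>n. H (u n) v) \<longlonglongrightarrow> 0"
    proof (rule tendsto_0_le)
      have "(\<lambda>n. sqrt (inverse (real (Suc n)))) \<longlonglongrightarrow> sqrt 0"
        by (intro tendsto_real_sqrt LIMSEQ_inverse_real_of_nat)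
      then show "(\<lambda>n. sqrt (inverse (real (Suc n)))) \<longlonglongrightarrow> 0" by simp
      show "\<forall>\<^sub>F n in sequentially. norm (H (u n) v) \<le> norm (sqrt (inverse (real (Suc n)))) * G.nrm v"
      proof (intro always_eventually allI)
        fix n
        have "norm (H (u n) v) \<le> G.nrm (u n) * G.nrm v" by (rule G.Cauchy_Schwarz[OF uM v])
        also have "\<dots> \<le> sqrt (inverse (real (Suc n))) * G.nrm v"
          using Gu[of n] v by (intro mult_right_mono) (auto simp: G.nrm_def[of "u n"])
        finally show "norm (H (u n) v) \<le> norm (sqrt (inverse (real (Suc n)))) * G.nrm v" by simp
      qed
    qed
    ultimately have "H y v = 0" by (rule LIMSEQ_unique)
    then show ?thesis by (simp add: H_def)
  qed
  moreover have "F.sq y = 1"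
  proof (rule antisym)
    have lim: "(\<lambda>n. F.sq (u n)) \<longlonglongrightarrow> F.sq y" by (rule F.tends_to_sq[OF y(2) uV y(1)])
    show "F.sq y \<le> 1" using u1 by (intro LIMSEQ_le_const2[OF lim]) auto
    have "1 - inverse (real (Suc n)) / m \<le> F.sq (u n)" for n
    proof -
      have "m * (1 - inverse (real (Suc n)) / m) = m - inverse (real (Suc n))"
        using m(1) by (simp add: right_diff_distrib)
      then have "m * (1 - inverse (real (Suc n)) / m) \<le> m * F.sq (u n)"
        using b_ge[of n] m(2)[OF uM, of n] by linarith
      then show ?thesis using m(1) by (simp only: mult_le_cancel_left_pos)
    qed
    moreover have "(\<lambda>n. 1 - inverse (real (Suc n)) / m) \<longlonglongrightarrow> 1 - 0 / m"
      using m(1) by (intro tendsto_intros LIMSEQ_inverse_real_of_nat) auto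
    ultimately have "1 - 0 / m \<le> F.sq y" by (intro LIMSEQ_le[OF _ lim]) auto
    then show "1 \<le> F.sq y" by simp
  qed
  ultimately show ?thesis using yM by blast
qed

end

text \<open>Lets \<open>maximum_attained\<close>, which treats positive suprema of \<open>b\<close>,
  also produce an eigenvector for a negative extremum.\<close>

lemma (in compact_form) compact_form_uminus: "compact_form scale V F S C (\<lambda>x y. - b x y)"
proof
  show "- b y x = cnj (- b x y)" if "x \<in> V" "y \<in> V" for x y using b.herm[OF that] by simp
qed (auto simp: b.subspace_V b.add_left b.scale_left b_le)

context compact_form
begin

text \<open>The supremum of \<open>\<bar>b.sq\<bar>\<close> on the unit ball is approached by
  \<open>b\<close> or by its negative; in the second case the multiplier is negative. The last
  conclusion keeps the extremality, from which the ordering of the multipliers and the completeness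
  of the eigenvectors are derived later.\<close>

lemma maximum_attained_abs:
  assumes M: "F.subspace M" "M \<subseteq> V"
    and closed: "\<And>u x. \<lbrakk>\<And>n. u n \<in> M; x \<in> V; F.tends_to u x\<rbrakk> \<Longrightarrow> x \<in> M"
    and nonzero: "\<exists>x\<in>M. b.sq x \<noteq> 0"
  shows "\<exists>y\<in>M. \<exists>m::real. m \<noteq> 0 \<and> F.sq y = 1 \<and> (\<forall>v\<in>M. b y v = of_real m * F y v)
    \<and> (\<forall>u\<in>M. \<bar>b.sq u\<bar> \<le> \<bar>m\<bar> * F.sq u)"
proof -
  interpret N: compact_form scale V F S C "\<lambda>x y. - b x y" by (rule compact_form_uminus)
  have Nsq: "N.b.sq x = - b.sq x" for x unfolding N.b.sq_def b.sq_def by simp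
  have MV: "x \<in> V" if "x \<in> M" for x using M that by blast
  define R where "R = (\<lambda>u. \<bar>b.sq u\<bar>) ` {u\<in>M. F.sq u \<le> 1}"
  define m where "m = Sup R"
  have zero: "0 \<in> R" unfolding R_def using M by (intro image_eqI[of _ _ 0]) (auto simp: F.subspace_0)
  have "r \<le> C" if r: "r \<in> R" for r
  proof -
    obtain u where u: "u \<in> M" "F.sq u \<le> 1" "r = \<bar>b.sq u\<bar>" using r unfolding R_def by blast
    then show ?thesis using b_sq_le[OF MV[OF u(1)]] mult_left_mono[OF u(2), of C] C_pos by linarith
  qed
  then have bdd: "bdd_above R" by (rule bdd_aboveI)
  have le: "\<bar>b.sq u\<bar> \<le> m * F.sq u" if u: "u \<in> M" for u
  proof (cases "F.sq u = 0")
    case True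
    then show ?thesis using b_sq_le[OF MV[OF u]] by simp
  next
    case False
    then have p: "F.sq u > 0" using F.sq_nonneg[OF MV[OF u]] by simp
    define w where "w = of_real (1 / sqrt (F.sq u)) *c u"
    have wM: "w \<in> M" using u M by (simp add: w_def F.subspace_scale)
    have c: "(cmod (of_real (1 / sqrt (F.sq u))))\<^sup>2 = 1 / F.sq u"
      using p by (simp add: norm_divide power_divide)
    have "F.sq w = 1" using p F.sq_scale[OF MV[OF u]] c by (simp add: w_def)
    moreover have "b.sq w = b.sq u / F.sq u" using b.sq_scale[OF MV[OF u]] c by (simp add: w_def)
    ultimately have "\<bar>b.sq u / F.sq u\<bar> \<in> R" unfolding R_def using wM by (intro image_eqI[of _ _ w]) auto
    then have "\<bar>b.sq u / F.sq u\<bar> \<le> m" unfolding m_def by (rule cSup_upper[OF _ bdd])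
    then show ?thesis using p by (simp add: field_simps)
  qed
  have m0: "m > 0"
  proof -
    obtain x where x: "x \<in> M" "b.sq x \<noteq> 0" using nonzero by blast
    have "0 < m * F.sq x" using le[OF x(1)] x(2) by linarith
    then show ?thesis using F.sq_nonneg[OF MV[OF x(1)]] by (simp add: zero_less_mult_iff)
  qed
  have sup: "\<exists>u\<in>M. F.sq u \<le> 1 \<and> m - e < \<bar>b.sq u\<bar>" if "0 < e" for e
    using less_cSup_iff[of R "m - e"] zero bdd that unfolding m_def[symmetric] by (auto simp: R_def)
  show ?thesis
  proof (cases "\<forall>e>0. \<exists>u\<in>M. F.sq u \<le> 1 \<and> m - e < b.sq u")
    case True
    have "\<exists>y\<in>M. F.sq y = 1 \<and> (\<forall>v\<in>M. b y v = of_real m * F y v)"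
    proof (rule maximum_attained[OF M closed m0])
      show "b.sq u \<le> m * F.sq u" if "u \<in> M" for u using le[OF that] by linarith
      show "\<exists>u\<in>M. F.sq u \<le> 1 \<and> m - e < b.sq u" if "0 < e" for e using True that by blast
    qed
    then show ?thesis using m0 le by (metis abs_of_pos less_irrefl)
  next
    case False
    then obtain e0 where e0: "e0 > 0" "\<And>u. u \<in> M \<Longrightarrow> F.sq u \<le> 1 \<Longrightarrow> b.sq u \<le> m - e0"
      by (metis linorder_not_less)
    have "\<exists>y\<in>M. F.sq y = 1 \<and> (\<forall>v\<in>M. - b y v = of_real m * F y v)"
    proof (rule N.maximum_attained[OF M closed m0])
      show "N.b.sq u \<le> m * F.sq u" if "u \<in> M" for u using le[OF that] Nsq by simp
      show "\<exists>u\<in>M. F.sq u \<le> 1 \<and> m - e < N.b.sq u" if e: "0 < e" for e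
      proof -
        \<comment> \<open>With slack at most \<open>e0\<close>, the value
          \<open>\<bar>b.sq u\<bar>\<close> exceeds \<open>m - e0\<close>, which
          \<open>b.sq u\<close> never does; hence \<open>b.sq u\<close> is negative.\<close>
        obtain u where u: "u \<in> M" "F.sq u \<le> 1" "m - min e e0 < \<bar>b.sq u\<bar>"
          using sup[of "min e e0"] e e0(1) by auto
        then have "m - e < - b.sq u" using e0(2)[of u] by linarith
        then show ?thesis using u Nsq by auto
      qed
    qed
    then obtain y where y: "y \<in> M" "F.sq y = 1" "\<And>v. v \<in> M \<Longrightarrow> - b y v = of_real m * F y v" by blast
    have "b y v = of_real (-m) * F y v" if "v \<in> M" for v
      using y(3)[OF that] by (metis minus_minus mult_minus_left of_real_minus)
    then show ?thesis using y m0 le by (intro bexI[of _ y] exI[of _ "-m"]) auto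
  qed
qed

end

text \<open>Log-convexity makes the ratios \<open>a (Suc n) / a n\<close> nondecreasing, so a first
  ratio above \<open>M\<close> would force growth faster than \<open>K * M ^ n\<close>.\<close>

lemma log_convex_ratio_bound:
  fixes a :: "nat \<Rightarrow> real"
  assumes nonneg: "\<And>n. 0 \<le> a n" and convex: "\<And>n. (a (Suc n))\<^sup>2 \<le> a n * a (Suc (Suc n))"
    and bound: "\<And>n. a n \<le> K * M ^ n" and M: "0 < M"
  shows "a 1 \<le> M * a 0"
proof (rule ccontr)
  assume "\<not> a 1 \<le> M * a 0"
  then have less: "M * a 0 < a 1" by simp
  have a0: "0 < a 0"
  proof -
    have "a 0 \<noteq> 0"
    proof
      assume "a 0 = 0"
      then have "a 1 = 0" using convex[of 0] by simp
      then show False using less \<open>a 0 = 0\<close> by simp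
    qed
    then show ?thesis using nonneg[of 0] by simp
  qed
  define r where "r = a 1 / a 0"
  have r: "M < r" using less a0 by (simp add: r_def field_simps)
  have step: "0 < a n \<and> r * a n \<le> a (Suc n)" for n
  proof (induction n)
    case 0
    then show ?case using a0 by (simp add: r_def)
  next
    case (Suc n)
    then have p: "0 < a (Suc n)" using r M by (smt (verit) mult_pos_pos)
    have "a n * (r * a (Suc n)) = (r * a n) * a (Suc n)" by simp
    also have "\<dots> \<le> a (Suc n) * a (Suc n)" using Suc p by (intro mult_right_mono) auto
    also have "\<dots> \<le> a n * a (Suc (Suc n))" using convex[of n] by (simp add: power2_eq_square)
    finally show ?case using Suc p by (simp add: mult_le_cancel_left)
  qed
  have grow: "r ^ n * a 0 \<le> a n" for n
  proof (induction n)
    case (Suc n)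
    have "r ^ Suc n * a 0 \<le> r * a n" using Suc r M by (simp add: mult.assoc)
    then show ?case using step[of n] by simp
  qed simp
  have "(r / M) ^ n \<le> K / a 0" for n
    using order_trans[OF grow[of n] bound[of n]] a0 M by (simp add: power_divide field_simps)
  moreover have "1 < r / M" using r M by simp
  then obtain n where "K / a 0 < (r / M) ^ n" using real_arch_pow by blast
  ultimately show False by (meson not_le)
qed

section \<open>Construction of the eigenvectors\<close>

context compact_form
begin

text \<open>An entry is a vector together with its multiplier. The condition at \<open>n\<close>
  refers only to entries up to \<open>n\<close>, as \<open>dependent_sequence\<close> requires; its
  last clause records that the multiplier is extremal on the complement of the earlier
  vectors.\<close>

definition eigen_step :: "(nat \<Rightarrow> 'a \<times> real) \<Rightarrow> nat \<Rightarrow> bool" where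
  "eigen_step z n \<longleftrightarrow> fst (z n) \<in> V \<and> F.sq (fst (z n)) = 1 \<and> snd (z n) \<noteq> 0 \<and>
     (\<forall>j<n. F (fst (z n)) (fst (z j)) = 0) \<and>
     (\<forall>v\<in>V. b (fst (z n)) v = of_real (snd (z n)) * F (fst (z n)) v) \<and>
     (\<forall>u\<in>V. (\<forall>j<n. F u (fst (z j)) = 0) \<longrightarrow> \<bar>b.sq u\<bar> \<le> \<bar>snd (z n)\<bar> * F.sq u)"

lemma eigen_step_orthonormal:
  assumes "\<And>i. i \<in> A \<Longrightarrow> eigen_step z i"
  shows "F.orthonormal (\<lambda>i. fst (z i)) A"
  unfolding F.orthonormal_def
proof (intro ballI conjI)
  fix i j assume ij: "i \<in> A" "j \<in> A"
  show "fst (z i) \<in> V" using assms ij by (auto simp: eigen_step_def)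
  have V: "fst (z i) \<in> V" "fst (z j) \<in> V" using assms ij by (auto simp: eigen_step_def)
  consider "i = j" | "i < j" | "j < i" by linarith
  then show "F (fst (z i)) (fst (z j)) = (if i = j then 1 else 0)"
  proof cases
    case 1
    then show ?thesis using assms[OF ij(1)] F.self_eq_sq[OF V(1)] by (simp add: eigen_step_def)
  next
    case 2
    then have "F (fst (z j)) (fst (z i)) = 0" using assms[OF ij(2)] by (simp add: eigen_step_def)
    then show ?thesis using 2 F.herm[OF V(2,1)] by simp
  next
    case 3
    then show ?thesis using assms[OF ij(1)] by (simp add: eigen_step_def)
  qed
qed

lemma subspace_orthogonal: "(\<And>j. j < n \<Longrightarrow> y j \<in> V) \<Longrightarrow> F.subspace {u\<in>V. \<forall>j<(n::nat). F u (y j) = 0}"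
  unfolding F.subspace_def by (auto simp: F.add_left F.scale_left)

lemma b_eq_zero_right:
  assumes "y \<in> V" "u \<in> V" "\<And>v. v \<in> V \<Longrightarrow> b y v = of_real m * F y v" "F u y = 0"
  shows "b u y = 0"
  using assms(3)[OF assms(2)] b.herm[OF assms(1,2)] F.herm[OF assms(2,1)] assms(4) by simp

text \<open>\<open>unbounded\<close> is infinite dimension in disguise: it keeps \<open>b\<close>
  from vanishing on the complement of finitely many eigenvectors, so the maximisation never
  stops.\<close>

lemma eigen_sequence:
  assumes nondegenerate: "\<And>x. \<lbrakk>x \<in> V; \<And>v. v \<in> V \<Longrightarrow> b x v = 0\<rbrakk> \<Longrightarrow> F.sq x = 0"
    and unbounded: "\<And>B. \<exists>x\<in>V. B * S.sq x < F.sq x"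
  shows "\<exists>z. \<forall>n. eigen_step z n"
proof (rule dependent_sequence)
  fix n and z :: "nat \<Rightarrow> 'a \<times> real"
  assume z: "\<And>i. i < n \<Longrightarrow> eigen_step z i"
  define y where "y i = fst (z i)" for i
  have yV: "y i \<in> V" if "i < n" for i using z[OF that] by (simp add: y_def eigen_step_def)
  have yb: "b (y i) v = of_real (snd (z i)) * F (y i) v" if "i < n" "v \<in> V" for i v
    using z[OF that(1)] that by (simp add: y_def eigen_step_def)
  have o: "F.orthonormal y {..<n}"
    using eigen_step_orthonormal[of "{..<n}" z] z by (simp add: y_def[abs_def])
  define M where "M = {u\<in>V. \<forall>j<n. F u (y j) = 0}"
  have M: "F.subspace M" "M \<subseteq> V" using subspace_orthogonal[of n y] yV by (auto simp: M_def)
  have b_M: "b u (y j) = 0" if "u \<in> M" "j < n" for u j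
    using that yb[OF that(2)] yV[OF that(2)] by (intro b_eq_zero_right[of _ _ "snd (z j)"]) (auto simp: M_def)
  have project: "v - (\<Sum>j<n. F v (y j) *c y j) \<in> M" if v: "v \<in> V" for v
  proof -
    have "(\<Sum>j<n. F v (y j) *c y j) \<in> V" using yV by (intro F.V_sum) auto
    then show ?thesis using F.remainder_orthogonal[OF o _ v] v by (auto simp: M_def)
  qed
  \<comment> \<open>For a first argument in \<open>M\<close> the form \<open>b\<close> ignores
    components of the second along the \<open>y j\<close>, so statements tested on \<open>M\<close>
    extend to \<open>V\<close>.\<close>
  have b_project: "b u v = b u (v - (\<Sum>j<n. F v (y j) *c y j))" if u: "u \<in> M" and v: "v \<in> V" for u v
  proof -
    let ?p = "\<Sum>j<n. F v (y j) *c y j"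
    have uV: "u \<in> V" using u M by blast
    have pV: "?p \<in> V" using yV by (intro F.V_sum) auto
    have "b ?p u = (\<Sum>j<n. F v (y j) * b (y j) u)"
      using yV uV by (subst b.sum_left) (auto simp: b.scale_left)
    also have "\<dots> = 0"
    proof (rule sum.neutral, rule ballI)
      fix j assume "j \<in> {..<n}"
      then have j: "j < n" by simp
      show "F v (y j) * b (y j) u = 0" using b_M[OF u j] b.herm[OF uV yV[OF j]] by simp
    qed
    finally have "b u ?p = 0" using b.herm[OF pV uV] by simp
    then show ?thesis using uV pV v by (simp add: b.diff_right)
  qed
  have nz: "\<exists>x\<in>M. b.sq x \<noteq> 0"
  proof (rule ccontr)
    assume "\<not> ?thesis"
    then have zero: "b.sq x = 0" if "x \<in> M" for x using that by blast
    have bM: "b u v = 0" if uv: "u \<in> M" "v \<in> M" for u v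
    proof -
      \<comment> \<open>The constant 0 in \<open>bound_from_diagonal\<close> is polarisation: a zero
        diagonal gives a zero form.\<close>
      have "cmod (b u v) \<le> 2 * 0 * F.nrm u * F.nrm v"
      proof (rule semi_inner.bound_from_diagonal[OF F.semi_inner_subspace[OF M]
            b.hermitian_form_subspace[OF M] order_refl _ uv])
        show "\<bar>Re (b u u)\<bar> \<le> 0 * F.sq u" if "u \<in> M" for u
          using zero[OF that] by (simp add: b.sq_def)
      qed
      then show ?thesis by simp
    qed
    have null: "F.sq x = 0" if "x \<in> M" for x
      using that M(2) b_project[OF that] bM[OF that project] by (intro nondegenerate) auto
    \<comment> \<open>If every vector of \<open>M\<close> is null, \<open>F.sq v\<close> is a sum of
      \<open>n\<close> squared coefficients, and the eigenvector equation bounds each of them by a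
      multiple of \<open>S.sq v\<close>; this contradicts \<open>unbounded\<close>.\<close>
    define B where "B = (\<Sum>j<n. S.sq (y j) / (snd (z j))\<^sup>2)"
    have "F.sq v \<le> B * S.sq v" if v: "v \<in> V" for v
    proof -
      have "F.sq v = (\<Sum>j<n. (cmod (F v (y j)))\<^sup>2)"
        using F.sq_remainder[OF o _ v] null[OF project[OF v]] by simp
      also have "\<dots> \<le> (\<Sum>j<n. S.sq (y j) / (snd (z j))\<^sup>2 * S.sq v)"
      proof (rule sum_mono)
        fix j assume "j \<in> {..<n}"
        then have j: "j < n" by simp
        have m: "snd (z j) \<noteq> 0" using z[OF j] by (simp add: eigen_step_def)
        have "cmod (F v (y j)) = cmod (F (y j) v)" using F.herm[OF v yV[OF j]] by simp
        also have "\<bar>snd (z j)\<bar> * \<dots> = cmod (b (y j) v)" using yb[OF j v] by (simp add: norm_mult)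
        finally have "(\<bar>snd (z j)\<bar> * cmod (F v (y j)))\<^sup>2 \<le> (S.nrm (y j) * S.nrm v)\<^sup>2"
          using b_le[OF yV[OF j] v] by (intro power_mono) auto
        then have "(snd (z j))\<^sup>2 * (cmod (F v (y j)))\<^sup>2 \<le> S.sq (y j) * S.sq v"
          using yV[OF j] v by (simp add: power_mult_distrib)
        then show "(cmod (F v (y j)))\<^sup>2 \<le> S.sq (y j) / (snd (z j))\<^sup>2 * S.sq v"
          using m by (simp add: pos_le_divide_eq mult.commute)
      qed
      also have "\<dots> = B * S.sq v" by (simp add: B_def sum_distrib_right)
      finally show ?thesis .
    qed
    then show False using unbounded[of B] by (meson not_less)
  qed
  have closed: "x \<in> M" if u: "\<And>n. u n \<in> M" and x: "x \<in> V" "F.tends_to u x" for u x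
  proof -
    have "F x (y j) = 0" if j: "j < n" for j
    proof (rule LIMSEQ_unique)
      show "(\<lambda>n. F (u n) (y j)) \<longlonglongrightarrow> F x (y j)"
        using u M by (intro F.tends_to_left x yV[OF j]) blast
      show "(\<lambda>n. F (u n) (y j)) \<longlonglongrightarrow> 0" using u j by (simp add: M_def)
    qed
    then show ?thesis using x by (simp add: M_def)
  qed
  have "\<exists>y\<in>M. \<exists>m::real. m \<noteq> 0 \<and> F.sq y = 1 \<and> (\<forall>v\<in>M. b y v = of_real m * F y v)
    \<and> (\<forall>u\<in>M. \<bar>b.sq u\<bar> \<le> \<bar>m\<bar> * F.sq u)"
  proof (rule maximum_attained_abs[OF M _ nz])
    fix u x assume "\<And>n::nat. u n \<in> M" "x \<in> V" "F.tends_to u x"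
    then show "x \<in> M" by (rule closed)
  qed
  then obtain e m where e: "e \<in> M" "m \<noteq> 0" "F.sq e = 1" "\<And>v. v \<in> M \<Longrightarrow> b e v = of_real m * F e v"
    "\<And>u. u \<in> M \<Longrightarrow> \<bar>b.sq u\<bar> \<le> \<bar>m\<bar> * F.sq u"
    by auto
  have eV: "e \<in> V" using e M by blast
  \<comment> \<open>From \<open>M\<close> to \<open>V\<close>: paired with \<open>e\<close>, both
    forms vanish on the span of the \<open>y j\<close>.\<close>
  have "b e v = of_real m * F e v" if v: "v \<in> V" for v
  proof -
    let ?p = "\<Sum>j<n. F v (y j) *c y j"
    have pV: "?p \<in> V" using yV by (intro F.V_sum) auto
    have "F ?p e = (\<Sum>j<n. F v (y j) * F (y j) e)"
      using yV eV by (subst F.sum_left) (auto simp: F.scale_left)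
    also have "\<dots> = 0"
    proof (rule sum.neutral, rule ballI)
      fix j assume "j \<in> {..<n}"
      then have j: "j < n" by simp
      show "F v (y j) * F (y j) e = 0" using e(1) j F.herm[OF eV yV[OF j]] by (simp add: M_def)
    qed
    finally have "F e ?p = 0" using F.herm[OF pV eV] by simp
    then have "F e (v - ?p) = F e v" using eV pV v by (simp add: F.diff_right)
    then show ?thesis using b_project[OF e(1) v] e(4)[OF project[OF v]] by simp
  qed
  then have "eigen_step (z(n := (e, m))) n"
    using e eV unfolding eigen_step_def by (auto simp: M_def y_def)
  then show "\<exists>e. eigen_step (z(n := e)) n" by blast
next
  fix z z' :: "nat \<Rightarrow> 'a \<times> real" and n
  assume "\<And>i. i \<le> n \<Longrightarrow> z i = z' i" "eigen_step z n"
  then show "eigen_step z' n" unfolding eigen_step_def by (metis less_imp_le order_refl)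
qed

end

section \<open>Expansion in the eigenvectors and the form of absolute values\<close>

locale spectral_basis = compact_form +
  fixes y :: "nat \<Rightarrow> 'a" and \<mu> :: "nat \<Rightarrow> real"
  assumes orthonormal: "F.orthonormal y UNIV"
    and nonzero: "\<mu> n \<noteq> 0"
    and eigen: "v \<in> V \<Longrightarrow> b (y n) v = of_real (\<mu> n) * F (y n) v"
    and maximal: "\<lbrakk>u \<in> V; \<And>j. j < n \<Longrightarrow> F u (y j) = 0\<rbrakk> \<Longrightarrow> \<bar>b.sq u\<bar> \<le> \<bar>\<mu> n\<bar> * F.sq u"
    and nondegenerate: "\<lbrakk>x \<in> V; \<And>v. v \<in> V \<Longrightarrow> b x v = 0\<rbrakk> \<Longrightarrow> F.sq x = 0"
begin

lemma y_V [simp]: "y n \<in> V"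
  using orthonormal by (simp add: F.orthonormal_def)

lemma F_y: "F (y m) (y n) = (if m = n then 1 else 0)"
  using orthonormal by (simp add: F.orthonormal_def)

lemma b_y: "b (y m) (y n) = (if m = n then of_real (\<mu> n) else 0)"
  by (simp add: eigen F_y)

lemma b_sq_y: "b.sq (y n) = \<mu> n"
  by (simp add: b.sq_def b_y)

lemma F_sq_y [simp]: "F.sq (y n) = 1"
  by (simp add: F.sq_def F_y)

lemma abs_mu_antimono: "n \<le> k \<Longrightarrow> \<bar>\<mu> k\<bar> \<le> \<bar>\<mu> n\<bar>"
  using maximal[of "y k" n] by (simp add: b_sq_y F_y)

text \<open>If the moduli stayed above \<open>e\<close>, compactness would give two members of
  \<open>y\<close> that are \<open>S\<close>-close. But \<open>b\<close> of their difference with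
  the first one equals a multiplier, which keeps their \<open>S\<close>-distance bounded
  below.\<close>

lemma mu_tendsto_zero: "(\<lambda>n. \<bar>\<mu> n\<bar>) \<longlonglongrightarrow> 0"
proof (rule LIMSEQ_I)
  fix e :: real assume e: "0 < e"
  have "\<exists>N. \<bar>\<mu> N\<bar> < e"
  proof (rule ccontr)
    assume "\<not> ?thesis"
    then have ge: "e \<le> \<bar>\<mu> n\<bar>" for n by (meson not_less)
    obtain r :: "nat \<Rightarrow> nat" where r: "strict_mono r" "S.cauchy_seq (\<lambda>n. y (r n))"
      using compact[of y 1] by auto
    have "0 < (e / (2 * sqrt C))\<^sup>2" using e C_pos by simp
    then obtain N where N: "\<And>m n. N \<le> m \<Longrightarrow> N \<le> n \<Longrightarrow> S.sq (y (r m) - y (r n)) < (e / (2 * sqrt C))\<^sup>2"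
      using r(2) unfolding S.cauchy_seq_def by blast
    let ?u = "y (r N)" and ?w = "y (r (Suc N))"
    have ne: "r (Suc N) \<noteq> r N" using strict_monoD[OF r(1), of N "Suc N"] by simp
    have d: "S.nrm (?u - ?w) < e / (2 * sqrt C)"
      using real_sqrt_less_mono[OF N[of N "Suc N"]] e C_pos by (simp add: S.nrm_def)
    have "b (?u - ?w) ?u = of_real (\<mu> (r N))" using ne by (simp add: b.diff_left b_y)
    then have "\<bar>\<mu> (r N)\<bar> \<le> S.nrm (?u - ?w) * S.nrm ?u"
      using b_le[of "?u - ?w" ?u] by simp
    also have "\<dots> \<le> (e / (2 * sqrt C)) * sqrt C"
      using d S_nrm_le[of ?u] C_pos e by (intro mult_mono) (auto simp: F.nrm_def)
    also have "\<dots> < e" using e C_pos by simp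
    finally show False using ge[of "r N"] by simp
  qed
  then obtain N where "\<bar>\<mu> N\<bar> < e" by blast
  then show "\<exists>N. \<forall>n\<ge>N. norm (\<bar>\<mu> n\<bar> - 0) < e"
    using abs_mu_antimono by (auto intro!: exI[of _ N] intro: le_less_trans)
qed

text \<open>\<open>r\<close> lies in the complement of the first \<open>n\<close> vectors for every
  \<open>n\<close>, and there \<open>b\<close> is bounded by a multiple of
  \<open>\<bar>\<mu> n\<bar>\<close>. Letting \<open>n\<close> grow leaves \<open>b r v = 0\<close>,
  and nondegeneracy applies.\<close>

lemma orthogonal_imp_null:
  assumes r: "r \<in> V" "\<And>k. F r (y k) = 0"
  shows "F.sq r = 0"
proof (rule nondegenerate[OF r(1)])
  fix v assume v: "v \<in> V"
  have "cmod (b r v) \<le> 2 * \<bar>\<mu> n\<bar> * F.nrm r * F.nrm v" for n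
  proof -
    define M where "M = {u\<in>V. \<forall>j<n. F u (y j) = 0}"
    have M: "F.subspace M" "M \<subseteq> V" using subspace_orthogonal[of n y] by (auto simp: M_def)
    let ?p = "\<Sum>j<n. F v (y j) *c y j"
    have pV: "?p \<in> V" by simp
    have o: "F.orthonormal y {..<n}" by (rule F.orthonormal_subset[OF orthonormal]) simp
    have vp: "v - ?p \<in> M" using F.remainder_orthogonal[OF o _ v] v by (auto simp: M_def)
    have rM: "r \<in> M" using r by (simp add: M_def)
    have "b r (y j) = 0" for j using r eigen by (intro b_eq_zero_right[of _ _ "\<mu> j"]) auto
    then have "b (y j) r = 0" for j using b.herm[OF r(1) y_V] by simp
    then have "b ?p r = 0" using r by (simp add: b.sum_left b.scale_left)
    then have "b r ?p = 0" using b.herm[OF pV r(1)] by simp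
    then have "b r v = b r (v - ?p)" using r pV v by (simp add: b.diff_right)
    moreover have "cmod (b r (v - ?p)) \<le> 2 * \<bar>\<mu> n\<bar> * F.nrm r * F.nrm (v - ?p)"
    proof (rule semi_inner.bound_from_diagonal[OF F.semi_inner_subspace[OF M] b.hermitian_form_subspace[OF M] _ _ rM vp])
      show "\<bar>Re (b u u)\<bar> \<le> \<bar>\<mu> n\<bar> * F.sq u" if "u \<in> M" for u
        using maximal[of u n] that by (simp add: M_def b.sq_def)
    qed simp
    moreover have "F.nrm (v - ?p) \<le> F.nrm v"
      using F.sq_remainder[OF o _ v] by (simp add: F.nrm_def sum_nonneg)
    ultimately show ?thesis
      using r v by (smt (verit) F.nrm_nonneg abs_ge_zero mult_left_mono mult_nonneg_nonneg)
  qed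
  moreover have "(\<lambda>n. 2 * \<bar>\<mu> n\<bar> * F.nrm r * F.nrm v) \<longlonglongrightarrow> 2 * 0 * F.nrm r * F.nrm v"
    by (intro tendsto_intros mu_tendsto_zero)
  ultimately have "cmod (b r v) \<le> 2 * 0 * F.nrm r * F.nrm v"
    by (intro LIMSEQ_le_const) auto
  then show "b r v = 0" by simp
qed

text \<open>The series converges to some \<open>x\<close> with the coefficients of \<open>u\<close>;
  then \<open>x - u\<close> is a null vector and does not affect convergence.\<close>

lemma fourier:
  assumes u: "u \<in> V"
  shows "F.tends_to (\<lambda>N. \<Sum>j<N. F u (y j) *c y j) u"
proof -
  let ?s = "\<lambda>N. \<Sum>j<N. F u (y j) *c y j"
  obtain x where x: "x \<in> V" "F.tends_to ?s x" "\<And>k. F x (y k) = F u (y k)"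
    using F.orthonormal_series[OF complete orthonormal F.Bessel[OF orthonormal u]] by blast
  have 0: "F.sq (x - u) = 0"
    using x u by (intro orthogonal_imp_null) (auto simp: F.diff_left)
  have sV: "?s N \<in> V" for N by simp
  have le: "F.nrm (?s N - u) \<le> F.nrm (?s N - x)" for N
  proof -
    have "F.nrm ((?s N - x) + (x - u)) \<le> F.nrm (?s N - x) + F.nrm (x - u)"
      using sV[of N] x u by (intro F.nrm_triangle) auto
    then show ?thesis using 0 by (simp add: F.nrm_def[of "x - u"])
  qed
  have "F.sq (?s N - u) \<le> F.sq (?s N - x)" for N
    using le[of N] by (simp add: F.nrm_def)
  then show ?thesis
    using F.sq_nonneg[OF F.V_diff[OF sV u]] unfolding F.tends_to_def
    by (intro tendsto_sandwich[OF _ _ tendsto_const x(2)[unfolded F.tends_to_def]] always_eventually allI)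
qed

lemma parseval_sq:
  assumes u: "u \<in> V"
  shows "(\<lambda>k. (cmod (F u (y k)))\<^sup>2) sums F.sq u"
proof -
  have "(\<lambda>N. F.sq (\<Sum>j<N. F u (y j) *c y j)) \<longlonglongrightarrow> F.sq u"
    by (rule F.tends_to_sq[OF fourier[OF u] _ u]) simp
  then show ?thesis
    unfolding sums_def using F.sq_lincomb[OF F.orthonormal_subset[OF orthonormal]] by simp
qed

lemma parseval_b:
  assumes u: "u \<in> V" and v: "v \<in> V"
  shows "(\<lambda>k. of_real (\<mu> k) * F u (y k) * cnj (F v (y k))) sums b u v"
proof -
  have eq: "b (\<Sum>j<N. F u (y j) *c y j) v = (\<Sum>j<N. of_real (\<mu> j) * F u (y j) * cnj (F v (y j)))" for N
    using v by (subst b.sum_left) (auto simp: b.scale_left eigen F.herm[OF v y_V] intro!: sum.cong)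
  have "(\<lambda>N. b (\<Sum>j<N. F u (y j) *c y j) v) \<longlonglongrightarrow> b u v"
    by (rule F.tends_to_form[OF b.hermitian_form_axioms b_le_F fourier[OF u] _ u v]) simp_all
  then show ?thesis unfolding sums_def eq .
qed

text \<open>The sign of the operator that represents \<open>b\<close> with respect to
  \<open>F\<close>. Coefficients determine a vector only up to null vectors, hence the choice
  operator.\<close>

definition J :: "'a \<Rightarrow> 'a" where
  "J u = (SOME w. w \<in> V \<and> (\<forall>k. F w (y k) = of_real (sgn (\<mu> k)) * F u (y k)))"

lemma J:
  assumes u: "u \<in> V"
  shows J_V: "J u \<in> V" and J_coeff: "F (J u) (y k) = of_real (sgn (\<mu> k)) * F u (y k)"
proof -
  have "(cmod (of_real (sgn (\<mu> k)) * F u (y k)))\<^sup>2 = (cmod (F u (y k)))\<^sup>2" for k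
    using nonzero[of k] by (simp add: norm_mult sgn_if)
  then have "\<exists>w. w \<in> V \<and> (\<forall>k. F w (y k) = of_real (sgn (\<mu> k)) * F u (y k))"
    using F.orthonormal_series[OF complete orthonormal, of "\<lambda>k. of_real (sgn (\<mu> k)) * F u (y k)"]
      F.Bessel[OF orthonormal u] by auto
  from someI_ex[OF this] show "J u \<in> V" "F (J u) (y k) = of_real (sgn (\<mu> k)) * F u (y k)"
    unfolding J_def by blast+
qed

definition T :: "'a \<Rightarrow> 'a \<Rightarrow> complex" where "T u v = b (J u) v"

lemma T_sums:
  assumes u: "u \<in> V" and v: "v \<in> V"
  shows "(\<lambda>k. of_real \<bar>\<mu> k\<bar> * F u (y k) * cnj (F v (y k))) sums T u v"
proof -
  have eq: "of_real (\<mu> k) * F (J u) (y k) = of_real \<bar>\<mu> k\<bar> * F u (y k)" for k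
    unfolding J_coeff[OF u] by (simp add: abs_sgn)
  show ?thesis using parseval_b[OF J_V[OF u] v] unfolding eq T_def .
qed

lemma T_J:
  assumes u: "u \<in> V" and v: "v \<in> V"
  shows "T (J u) v = b u v"
proof -
  have eq: "of_real \<bar>\<mu> k\<bar> * F (J u) (y k) = of_real (\<mu> k) * F u (y k)" for k
    unfolding J_coeff[OF u] by (simp add: sgn_if)
  show ?thesis
    using sums_unique2[OF T_sums[OF J_V[OF u] v, unfolded eq] parseval_b[OF u v]] .
qed

lemma F_sq_J: "u \<in> V \<Longrightarrow> F.sq (J u) = F.sq u"
proof -
  assume u: "u \<in> V"
  have "(cmod (F (J u) (y k)))\<^sup>2 = (cmod (F u (y k)))\<^sup>2" for k
    using J_coeff[OF u] nonzero[of k] by (simp add: norm_mult sgn_if)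
  then show ?thesis using parseval_sq[OF u] parseval_sq[OF J_V[OF u]] sums_unique2 by simp
qed

text \<open>\<open>J\<close> is chosen vector by vector and need not be linear, so the laws are read
  off the series in \<open>T_sums\<close>.\<close>

lemma hermitian_form_T: "hermitian_form scale V T"
proof
  show "F.subspace V" by (rule F.subspace_V)
  show "T (u + v) w = T u w + T v w" if uvw: "u \<in> V" "v \<in> V" "w \<in> V" for u v w
    using sums_add[OF T_sums[OF uvw(1,3)] T_sums[OF uvw(2,3)]] T_sums[of "u + v" w] uvw
    by (intro sums_unique2[of "\<lambda>k. of_real \<bar>\<mu> k\<bar> * F (u + v) (y k) * cnj (F w (y k))"])
       (auto simp: F.add_left algebra_simps)
  show "T (c *c u) w = c * T u w" if uw: "u \<in> V" "w \<in> V" for c u w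
    using sums_mult[OF T_sums[OF uw], of c] T_sums[of "c *c u" w] uw
    by (intro sums_unique2[of "\<lambda>k. of_real \<bar>\<mu> k\<bar> * F (c *c u) (y k) * cnj (F w (y k))"])
       (auto simp: F.scale_left algebra_simps)
  show "T v u = cnj (T u v)" if uv: "u \<in> V" "v \<in> V" for u v
    using T_sums[OF uv(2,1)] sums_cnj[THEN iffD2, OF T_sums[OF uv]]
    by (intro sums_unique2[of "\<lambda>k. of_real \<bar>\<mu> k\<bar> * F v (y k) * cnj (F u (y k))"])
       (auto simp: mult_ac)
qed

sublocale T: hermitian_form scale V T by (rule hermitian_form_T)

lemma T_sq_sums: "u \<in> V \<Longrightarrow> (\<lambda>k. \<bar>\<mu> k\<bar> * (cmod (F u (y k)))\<^sup>2) sums T.sq u"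
proof -
  assume u: "u \<in> V"
  have "Re (of_real \<bar>\<mu> k\<bar> * F u (y k) * cnj (F u (y k))) = \<bar>\<mu> k\<bar> * (cmod (F u (y k)))\<^sup>2" for k
    unfolding mult.assoc complex_norm_square[symmetric] by simp
  then show ?thesis using sums_Re[OF T_sums[OF u u]] by (simp add: T.sq_def)
qed

sublocale T: semi_inner scale V T
proof
  show "0 \<le> T.sq u" if "u \<in> V" for u
    using sums_le[OF _ sums_zero T_sq_sums[OF that]] by simp
qed

lemma T_sq_J: "u \<in> V \<Longrightarrow> T.sq (J u) = T.sq u"
proof -
  assume u: "u \<in> V"
  have eq: "cmod (F (J u) (y k)) = cmod (F u (y k))" for k
    unfolding J_coeff[OF u] using nonzero[of k] by (simp add: norm_mult sgn_if)
  show ?thesis using sums_unique2[OF T_sq_sums[OF J_V[OF u], unfolded eq] T_sq_sums[OF u]] .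
qed

lemma T_sq_le_F: "u \<in> V \<Longrightarrow> T.sq u \<le> C * F.sq u"
proof -
  assume u: "u \<in> V"
  have "T.sq u \<le> cmod (b (J u) u)" by (simp add: T.sq_def T_def complex_Re_le_cmod)
  also have "\<dots> \<le> C * F.nrm (J u) * F.nrm u" by (rule b_le_F[OF J_V[OF u] u])
  also have "\<dots> = C * (F.nrm u)\<^sup>2" using F_sq_J[OF u] by (simp add: F.nrm_def power2_eq_square)
  finally show ?thesis using u by simp
qed

lemma T_sq_lincomb: "T.sq (\<Sum>n<N. d n *c y n) = (\<Sum>n<N. \<bar>\<mu> n\<bar> * (cmod (d n))\<^sup>2)"
proof -
  have eq: "\<bar>\<mu> k\<bar> * (cmod (F (\<Sum>n<N. d n *c y n) (y k)))\<^sup>2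
      = (if k \<in> {..<N} then \<bar>\<mu> k\<bar> * (cmod (d k))\<^sup>2 else 0)" for k
    using F.form_lincomb[OF orthonormal, of "{..<N}" k d] by simp
  have "(\<Sum>n<N. d n *c y n) \<in> V" by simp
  from sums_unique2[OF T_sq_sums[OF this, unfolded eq] sums_If_finite_set] show ?thesis by simp
qed

text \<open>Lax's argument: \<open>JW\<close> is symmetric for the weaker inner product \<open>T\<close>, so its \<open>F\<close>-bound is also a
  \<open>T\<close>-bound. This makes the norm of \<open>T\<close> equivalent to that of \<open>S\<close>.\<close>

lemma T_equiv_S:
  assumes WV: "\<And>x. x \<in> V \<Longrightarrow> W x \<in> V"
    and W_sym: "\<And>x v. \<lbrakk>x \<in> V; v \<in> V\<rbrakk> \<Longrightarrow> b (W x) v = b x (W v)"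
    and W_bdd: "\<And>x. x \<in> V \<Longrightarrow> F.sq (W x) \<le> M * F.sq x" and M: "0 < M"
    and W_pos: "\<And>x. x \<in> V \<Longrightarrow> \<delta> * S.sq x \<le> Re (b (W x) x)" and \<delta>: "0 < \<delta>"
    and u: "u \<in> V"
  shows "S.sq u \<le> sqrt M / \<delta> * T.sq u" and "T.sq u \<le> sqrt M / \<delta> * S.sq u"
proof -
  \<comment> \<open>Since \<open>T (J w) v = b w v\<close>, symmetry of \<open>W\<close> for
    \<open>b\<close> becomes symmetry of \<open>A\<close> for \<open>T\<close>; since
    \<open>J\<close> preserves \<open>F.sq\<close>, the \<open>F\<close>-bound of \<open>W\<close>
    is also one of \<open>A\<close>.\<close>
  define A where "A x = J (W x)" for x
  have AV: "A x \<in> V" if "x \<in> V" for x using that by (simp add: A_def J_V WV)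
  have TA: "T (A x) v = b (W x) v" if "x \<in> V" "v \<in> V" for x v
    using that by (simp add: A_def T_J WV)
  have A_sym: "T (A x) v = T x (A v)" if "x \<in> V" "v \<in> V" for x v
  proof -
    have "T x (A v) = cnj (b (W v) x)" using that T.herm[OF AV[OF that(2)] that(1)] TA by simp
    also have "\<dots> = b x (W v)" using that b.herm[OF WV[OF that(2)] that(1)] by simp
    finally show ?thesis using that TA W_sym by simp
  qed
  have A_bdd: "F.sq (A x) \<le> M * F.sq x" if "x \<in> V" for x
    using that by (simp add: A_def F_sq_J WV W_bdd)
  have T_A: "T.sq (A x) \<le> M * T.sq x" if x: "x \<in> V" for x
  proof -
    have itV: "(A ^^ n) x \<in> V" for n by (induction n) (use x AV in auto)
    have "T.sq ((A ^^ 1) x) \<le> M * T.sq ((A ^^ 0) x)"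
    \<comment> \<open>Applied to \<open>T.sq ((A ^^ n) x)\<close>: symmetry with Cauchy-Schwarz
      gives log-convexity, and the \<open>F\<close>-bound of \<open>A\<close> together with
      \<open>T_sq_le_F\<close> gives the growth rate \<open>M\<close>.\<close>
    proof (rule log_convex_ratio_bound[where K = "C * F.sq x"])
      show "0 \<le> T.sq ((A ^^ n) x)" for n using itV by (rule T.sq_nonneg)
      show "(T.sq ((A ^^ Suc n) x))\<^sup>2 \<le> T.sq ((A ^^ n) x) * T.sq ((A ^^ Suc (Suc n)) x)" for n
      proof -
        let ?w = "(A ^^ n) x"
        have w: "?w \<in> V" "A ?w \<in> V" "A (A ?w) \<in> V" using itV AV by blast+
        have "(T.sq (A ?w))\<^sup>2 = (cmod (T ?w (A (A ?w))))\<^sup>2"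
          using A_sym[OF w(1,2)] T.self_eq_sq[OF w(2)] by (metis norm_of_real power2_abs)
        also have "\<dots> \<le> T.sq ?w * T.sq (A (A ?w))" by (rule T.Cauchy_Schwarz_sq[OF w(1,3)])
        finally show ?thesis by simp
      qed
      show "T.sq ((A ^^ n) x) \<le> C * F.sq x * M ^ n" for n
      proof -
        have "F.sq ((A ^^ n) x) \<le> M ^ n * F.sq x"
        proof (induction n)
          case (Suc n)
          have "F.sq ((A ^^ Suc n) x) \<le> M * F.sq ((A ^^ n) x)" using A_bdd[OF itV] by simp
          also have "\<dots> \<le> M * (M ^ n * F.sq x)" using Suc M by (intro mult_left_mono) auto
          finally show ?case by simp
        qed simp
        then have "C * F.sq ((A ^^ n) x) \<le> C * (M ^ n * F.sq x)" using C_pos by simp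
        then show ?thesis using T_sq_le_F[OF itV[of n]] by (simp add: mult_ac)
      qed
    qed (rule M)
    then show ?thesis by simp
  qed
  have S_le: "S.sq x \<le> sqrt M / \<delta> * T.sq x" if x: "x \<in> V" for x
  proof -
    have "\<delta> * S.sq x \<le> Re (T (A x) x)" using W_pos[OF x] TA[OF x x] by simp
    also have "\<dots> \<le> T.nrm (A x) * T.nrm x"
      using order_trans[OF complex_Re_le_cmod T.Cauchy_Schwarz[OF AV[OF x] x]] .
    also have "\<dots> \<le> (sqrt M * T.nrm x) * T.nrm x"
    proof (rule mult_right_mono)
      show "T.nrm (A x) \<le> sqrt M * T.nrm x"
        using T_A[OF x] by (simp add: T.nrm_def flip: real_sqrt_mult)
    qed (use x in simp)
    also have "\<dots> = sqrt M * T.sq x" using T.nrm_power2[OF x] by (simp add: power2_eq_square mult.assoc)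
    finally show ?thesis using \<delta> by (simp add: field_simps)
  qed
  show "S.sq u \<le> sqrt M / \<delta> * T.sq u" by (rule S_le[OF u])
  define K where "K = sqrt M / \<delta>"
  have K: "K > 0" using M \<delta> by (simp add: K_def)
  \<comment> \<open>The reverse bound by duality: estimate \<open>b (J u) u\<close> by the
    \<open>S\<close>-norms and apply the first bound to \<open>J u\<close>, whose
    \<open>T\<close>-square is that of \<open>u\<close>.\<close>
  have "T.sq u \<le> cmod (b (J u) u)" by (simp add: T.sq_def T_def complex_Re_le_cmod)
  also have "\<dots> \<le> S.nrm (J u) * S.nrm u" by (rule b_le[OF J_V[OF u] u])
  finally have "(T.sq u)\<^sup>2 \<le> (S.nrm (J u) * S.nrm u)\<^sup>2"
    using T.sq_nonneg[OF u] by (intro power_mono)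
  also have "\<dots> = S.sq (J u) * S.sq u" using u J_V by (simp add: power_mult_distrib)
  also have "\<dots> \<le> (K * T.sq u) * S.sq u"
    using S_le[OF J_V[OF u]] T_sq_J[OF u] S.sq_nonneg[OF u] by (intro mult_right_mono) (auto simp: K_def)
  finally have *: "T.sq u * T.sq u \<le> T.sq u * (K * S.sq u)" by (simp add: power2_eq_square mult_ac)
  have "T.sq u \<le> K * S.sq u"
  proof (cases "T.sq u = 0")
    case True
    then show ?thesis using K S.sq_nonneg[OF u] by simp
  next
    case False
    then show ?thesis using * T.sq_nonneg[OF u] by (simp add: mult_le_cancel_left)
  qed
  then show "T.sq u \<le> sqrt M / \<delta> * S.sq u" by (simp add: K_def)
qed

lemma S_sq_y_pos: "0 < S.sq (y n)"
proof -
  have "cmod (b (y n) (y n)) \<le> S.nrm (y n) * S.nrm (y n)" by (rule b_le) simp_all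
  then have "\<bar>\<mu> n\<bar> \<le> S.sq (y n)"
    using S.nrm_power2[of "y n"] by (simp add: b_y power2_eq_square)
  then show ?thesis using nonzero[of n] by linarith
qed

text \<open>\<open>T\<close> is diagonal in \<open>y\<close>; after normalisation its weights are
  \<open>\<bar>\<mu> n\<bar> / S.sq (y n)\<close>, and these lie between \<open>1 / K\<close> and
  \<open>K\<close> by the hypotheses at \<open>y n\<close>. The second factor \<open>K\<close> is
  the passage between \<open>S\<close> and \<open>T\<close> for the combination itself.\<close>

lemma riesz_bounds:
  assumes K: "0 < K" and S_T: "\<And>u. u \<in> V \<Longrightarrow> S.sq u \<le> K * T.sq u"
    and T_S: "\<And>u. u \<in> V \<Longrightarrow> T.sq u \<le> K * S.sq u"
  shows "1 / K\<^sup>2 * (\<Sum>n<N. (cmod (c n))\<^sup>2) \<le> S.sq (\<Sum>n<N. (c n / of_real (S.nrm (y n))) *c y n)"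
    and "S.sq (\<Sum>n<N. (c n / of_real (S.nrm (y n))) *c y n) \<le> K\<^sup>2 * (\<Sum>n<N. (cmod (c n))\<^sup>2)"
proof -
  let ?u = "\<Sum>n<N. (c n / of_real (S.nrm (y n))) *c y n"
  have Ty: "T.sq (y n) = \<bar>\<mu> n\<bar>" for n
    using T_sq_lincomb[of "\<lambda>k. if k = n then 1 else 0" "Suc n"]
    by (simp add: if_distrib if_distribR cong: if_cong)
  have uV: "?u \<in> V" by simp
  have coeff: "(cmod (c n / of_real (S.nrm (y n))))\<^sup>2 = (cmod (c n))\<^sup>2 / S.sq (y n)" for n
    by (simp add: norm_divide power_divide)
  have Tu: "T.sq ?u = (\<Sum>n<N. (\<bar>\<mu> n\<bar> / S.sq (y n)) * (cmod (c n))\<^sup>2)"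
    unfolding T_sq_lincomb coeff by simp
  have up: "\<bar>\<mu> n\<bar> / S.sq (y n) \<le> K" for n
    using T_S[of "y n"] S_sq_y_pos[of n] by (simp add: Ty field_simps)
  have lo: "1 / K \<le> \<bar>\<mu> n\<bar> / S.sq (y n)" for n
    using S_T[of "y n"] S_sq_y_pos[of n] K by (simp add: Ty field_simps)
  have "T.sq ?u \<le> K * (\<Sum>n<N. (cmod (c n))\<^sup>2)"
    unfolding Tu sum_distrib_left by (intro sum_mono mult_right_mono up) simp
  then have "K * T.sq ?u \<le> K * (K * (\<Sum>n<N. (cmod (c n))\<^sup>2))" using K by simp
  then show "S.sq ?u \<le> K\<^sup>2 * (\<Sum>n<N. (cmod (c n))\<^sup>2)"
    using S_T[OF uV] by (simp add: power2_eq_square mult.assoc)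
  have "1 / K * (\<Sum>n<N. (cmod (c n))\<^sup>2) \<le> T.sq ?u"
    unfolding Tu sum_distrib_left by (intro sum_mono mult_right_mono lo) simp
  also have "\<dots> \<le> K * S.sq ?u" by (rule T_S[OF uV])
  finally show "1 / K\<^sup>2 * (\<Sum>n<N. (cmod (c n))\<^sup>2) \<le> S.sq ?u"
    using K by (simp add: power2_eq_square field_simps)
qed

end

section \<open>Lebesgue measure on the unit interval\<close>

abbreviation I01 :: "real measure" where "I01 \<equiv> lebesgue_on {0..1}"

interpretation I01: finite_measure I01
  by (rule finite_measure_lebesgue_on) simp

interpretation I01_pair: pair_sigma_finite I01 I01
  by (simp add: pair_sigma_finite_def I01.sigma_finite_measure_axioms)

lemma measurable_ident_I01 [measurable]: "(\<lambda>x. x) \<in> borel_measurable I01"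
  using id_borel_measurable_lebesgue_on[of "{0..1::real}"] by (simp add: id_def)

text \<open>Integrals over \<open>{0..t}\<close> become integrals of truncated functions over the
  fixed measure \<open>I01\<close>, the form in which absolutely continuous functions are handled
  below.\<close>

lemma integral_upto:
  fixes g :: "real \<Rightarrow> complex"
  assumes "t \<in> {0..1}"
  shows "integral\<^sup>L (lebesgue_on {0..t}) g = (LINT x|I01. (if x \<le> t then g x else 0))"
proof -
  have "(LINT x|I01. (if x \<le> t then g x else 0)) = (LINT x|I01. (if x \<in> {0..t} then g x else 0))"
    using assms by (intro Bochner_Integration.integral_cong) auto
  then show ?thesis using assms by (subst (asm) integral_restrict) auto
qed

lemma integrable_if_I01:
  fixes g :: "real \<Rightarrow> 'b::{banach, second_countable_topology}"
  assumes "integrable I01 g" "{x \<in> {0..1}. P x} \<in> sets I01"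
  shows "integrable I01 (\<lambda>x. if P x then g x else 0)"
proof -
  have "integrable I01 (\<lambda>x. indicator {x \<in> {0..1}. P x} x *\<^sub>R g x)"
    using assms by (intro integrable_mult_indicator)
  then show ?thesis
    by (rule Bochner_Integration.integrable_cong[THEN iffD1, rotated 2]) (auto simp: indicator_def)
qed

lemma sets_I01_upto: "{x \<in> {0..1}. x \<le> t} \<in> sets I01" "{x \<in> {0..1}. t \<le> x} \<in> sets I01"
   "{x \<in> {0..1}. x < t} \<in> sets I01" "{x \<in> {0..1}. t < x} \<in> sets I01"
  by (measurable, simp)+

lemma integrable_upto:
  fixes g :: "real \<Rightarrow> 'b::{banach, second_countable_topology}"
  shows "integrable I01 g \<Longrightarrow> integrable I01 (\<lambda>x. if x \<le> t then g x else 0)"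
  by (intro integrable_if_I01 sets_I01_upto)

lemma AE_I01_neq: "AE x in I01. x \<noteq> t"
proof -
  have "AE x in lebesgue. x \<noteq> t"
    by (intro AE_completion AE_lborel_singleton)
  then show ?thesis by (subst AE_restrict_space_iff) (auto elim: eventually_mono)
qed

text \<open>Closed half-lines generate the Borel sets and are stable under intersection, so
  vanishing integrals of the zero extension spread to all Borel sets, and from there, up to null
  sets, to Lebesgue sets.\<close>

lemma AE_eq_0_if_integrals_zero:
  fixes f :: "real \<Rightarrow> complex"
  assumes f: "integrable I01 f" and zero: "\<And>t. t \<in> {0..1} \<Longrightarrow> integral\<^sup>L (lebesgue_on {0..t}) f = 0"
  shows "AE x in I01. f x = 0"
proof -
  define h where "h x = (if x \<in> {0..1} then f x else 0)" for x
  have h: "integrable lebesgue h"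
    unfolding h_def[abs_def] by (rule iffD2[OF Lebesgue_Measure.integrable_restrict_UNIV f]) simp
  have int_h: "integrable lebesgue (\<lambda>x. indicator A x *\<^sub>R h x)" if "A \<in> sets lebesgue" for A
    using integrable_mult_indicator[OF that h] .
  have h_total: "integral\<^sup>L lebesgue h = 0"
    unfolding h_def[abs_def] by (subst Lebesgue_Measure.integral_restrict_UNIV) (use zero[of 1] in auto)
  have borel: "(LINT x|lebesgue. indicator A x *\<^sub>R h x) = 0" if "A \<in> sets borel" for A
  proof -
    have "Int_stable (range (\<lambda>a::real. {..a}))"
      by (auto simp: Int_stable_def)
    moreover have "range (\<lambda>a::real. {..a}) \<subseteq> Pow UNIV" by simp
    moreover have "A \<in> sigma_sets UNIV (range (\<lambda>a::real. {..a}))"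
      using that by (simp add: borel_eq_atMost)
    ultimately show ?thesis
    proof (induction rule: sigma_sets_induct_disjoint)
      case (basic A)
      then obtain a where A: "A = {..a}" by auto
      show ?case
      proof (cases "a < 0")
        case True
        then have "(\<lambda>x. indicator A x *\<^sub>R h x) = (\<lambda>x. 0)"
          by (auto simp: A h_def indicator_def)
        then show ?thesis by simp
      next
        case False
        then have "(\<lambda>x. indicator A x *\<^sub>R h x) = (\<lambda>x. if x \<in> {0..min a 1} then f x else 0)"
          by (auto simp: A h_def indicator_def)
        then show ?thesis 
            using zero[of "min a 1"] False Lebesgue_Measure.integral_restrict_UNIV[of "{0..min a 1}" f]
            by (simp only:) simp
      qed
    next
      case empty
      then show ?case by simp
    next
      case (compl A)
      then have A: "A \<in> sets borel" by (simp add: borel_eq_atMost)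
      have "(\<lambda>x. indicator (UNIV - A) x *\<^sub>R h x) = (\<lambda>x. h x - indicator A x *\<^sub>R h x)"
        by (auto simp: indicator_def)
      then show ?case using h int_h[of A] A compl.IH h_total by simp
    next
      case (union A)
      then have A: "A i \<in> sets borel" for i by (auto simp: borel_eq_atMost)
      have "set_integrable lebesgue (\<Union>i. A i) h"
        unfolding set_integrable_def using A by (intro int_h) auto
      then have "set_lebesgue_integral lebesgue (\<Union>i. A i) h = (\<Sum>i. set_lebesgue_integral lebesgue (A i) h)"
        using union.hyps(1) A by (intro lebesgue_integral_countable_add) (auto simp: disjoint_family_on_def)
      then show ?case using union.IH by (simp add: set_lebesgue_integral_def)
    qed
  qed
  show ?thesis
  proof (rule I01.density_zero[OF f])
    fix B assume B: "B \<in> sets I01"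
    then have A: "B \<in> sets lebesgue" and sub: "B \<subseteq> {0..1}"
      using sets_restrict_space_iff[of "{0..1}" lebesgue B] by auto
    obtain S N N' where S: "B = S \<union> N" "N \<subseteq> N'" "N' \<in> null_sets lborel" "S \<in> sets lborel"
      using sets_completionE[OF A] by metis
    have "AE x in lebesgue. x \<notin> N'" using S(3) by (intro AE_completion AE_not_in)
    then have "AE x in lebesgue. indicator B x *\<^sub>R h x = indicator S x *\<^sub>R h x"
      by (rule eventually_mono) (use S in \<open>auto simp: indicator_def\<close>)
    then have "(LINT x|lebesgue. indicator B x *\<^sub>R h x) = (LINT x|lebesgue. indicator S x *\<^sub>R h x)"
      using int_h[OF A] int_h[of S] S(4) by (intro integral_cong_AE) auto
    also have "\<dots> = 0" using borel[of S] S(4) by simp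
    also have "(\<lambda>x. indicator B x *\<^sub>R h x) = (\<lambda>x. indicator {0..1} x *\<^sub>R (indicator B x *\<^sub>R f x))"
      using sub by (auto simp: h_def indicator_def)
    finally show "set_lebesgue_integral I01 B f = 0"
      unfolding set_lebesgue_integral_def by (subst Bochner_Integration.integral_restrict_space) auto
  qed
qed

lemma AE_eq_imp_eq_continuous:
  fixes f g :: "real \<Rightarrow> complex"
  assumes "continuous_on {0..1} f" "continuous_on {0..1} g" "AE x in I01. f x = g x" "t \<in> {0..1}"
  shows "f t = g t"
proof -
  have "(LINT x|I01. norm (f x - g x)) = 0"
    using assms(3) by (intro integral_eq_zero_AE) auto
  moreover have "continuous_on {0..1} (\<lambda>x. norm (f x - g x))"
    using assms(1,2) by (intro continuous_intros)
  ultimately have "\<forall>x\<in>{0..1}. norm (f x - g x) = 0"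
    using integralL_eq_0_iff[of 0 1 "\<lambda>x. norm (f x - g x)"] by simp
  then show ?thesis using assms(4) by simp
qed

lemma continuous_imp_measurable_I01: 
  fixes f :: "real \<Rightarrow> complex"
  shows "continuous_on {0..1} f \<Longrightarrow> f \<in> borel_measurable I01"
  by (rule continuous_imp_measurable_on_sets_lebesgue) auto

section \<open>Absolutely continuous functions on an edge\<close>

lemma ac_derivD:
  assumes "has_ac_deriv u g"
  shows "integrable I01 g" "t \<in> {0..1} \<Longrightarrow> u t = u 0 + (LINT x|I01. (if x \<le> t then g x else 0))"
proof -
  show "integrable I01 g" using assms by (simp add: has_ac_deriv_def)
  show "u t = u 0 + (LINT x|I01. (if x \<le> t then g x else 0))" if "t \<in> {0..1}"
  proof -
    have "u t = u 0 + integral\<^sup>L (lebesgue_on {0..t}) g" using assms that unfolding has_ac_deriv_def by blast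
    then show ?thesis unfolding integral_upto[OF that] .
  qed
qed

lemma ac_derivI:
  assumes "integrable I01 g" "\<And>t. t \<in> {0..1} \<Longrightarrow> u t = u 0 + (LINT x|I01. (if x \<le> t then g x else 0))"
  shows "has_ac_deriv u g"
  unfolding has_ac_deriv_def
proof (intro conjI ballI)
  show "u t = u 0 + integral\<^sup>L (lebesgue_on {0..t}) g" if "t \<in> {0..1}" for t
    using assms(2)[OF that] unfolding integral_upto[OF that] .
qed (rule assms(1))

lemma ac_deriv_cong:
  assumes "has_ac_deriv u g" "\<And>t. t \<in> {0..1} \<Longrightarrow> v t = u t" "AE x in I01. h x = g x"
    "h \<in> borel_measurable I01"
  shows "has_ac_deriv v h"
proof (rule ac_derivI)
  note g = ac_derivD(1)[OF assms(1)]
  show h: "integrable I01 h"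
    using assms(3,4) g by (subst integrable_cong_AE[of _ _ g]) auto
  show "v t = v 0 + (LINT x|I01. (if x \<le> t then h x else 0))" if "t \<in> {0..1}" for t
  proof -
    have "(LINT x|I01. (if x \<le> t then h x else 0)) = (LINT x|I01. (if x \<le> t then g x else 0))"
      by (rule integral_cong_AE)
         (use assms(3) integrable_upto[OF h] integrable_upto[OF g] in \<open>auto elim: eventually_mono\<close>)
    then show ?thesis using ac_derivD(2)[OF assms(1) that] assms(2)[OF that] assms(2)[of 0] by simp
  qed
qed

lemma ac_deriv_unique:
  assumes "has_ac_deriv u g" "has_ac_deriv u h"
  shows "AE x in I01. g x = h x"
proof -
  note gh = ac_derivD(1)[OF assms(1)] ac_derivD(1)[OF assms(2)]
  have "AE x in I01. g x - h x = 0"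
  proof (rule AE_eq_0_if_integrals_zero)
    show "integrable I01 (\<lambda>x. g x - h x)" using gh by simp
    fix t :: real assume t: "t \<in> {0..1}"
    have "(LINT x|I01. (if x \<le> t then g x - h x else 0))
        = (LINT x|I01. (if x \<le> t then g x else 0) - (if x \<le> t then h x else 0))"
      by (intro Bochner_Integration.integral_cong) auto
    also have "\<dots> = 0"
      using ac_derivD(2)[OF assms(1) t] ac_derivD(2)[OF assms(2) t]
      by (subst Bochner_Integration.integral_diff) (auto intro!: integrable_upto gh)
    finally show "integral\<^sup>L (lebesgue_on {0..t}) (\<lambda>x. g x - h x) = 0"
      by (simp add: integral_upto[OF t])
  qed
  then show ?thesis by simp
qed

lemma ac_continuous:
  assumes "has_ac_deriv u g"
  shows "continuous_on {0..1} u"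
proof -
  have "continuous_on {0..1} (\<lambda>t. u 0 + integral\<^sup>L (lebesgue_on {0..t}) g)"
    using ac_derivD(1)[OF assms] by (intro continuous_intros indefinite_integral_continuous_real)
  then show ?thesis
    using assms unfolding has_ac_deriv_def by (elim conjE continuous_on_eq) (metis (no_types))
qed

lemma ac_const: "has_ac_deriv (\<lambda>_. c) (\<lambda>_. 0)"
  by (rule ac_derivI) auto

lemma ac_ident: "has_ac_deriv complex_of_real (\<lambda>_. 1)"
  unfolding has_ac_deriv_def by (auto simp: measure_restrict_space scaleR_conv_of_real)

lemma ac_add:
  assumes "has_ac_deriv u g" "has_ac_deriv v h"
  shows "has_ac_deriv (\<lambda>t. u t + v t) (\<lambda>t. g t + h t)"
proof (rule ac_derivI)
  note gh = ac_derivD(1)[OF assms(1)] ac_derivD(1)[OF assms(2)]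
  show "integrable I01 (\<lambda>t. g t + h t)" using gh by simp
  fix t :: real assume t: "t \<in> {0..1}"
  have "(LINT x|I01. (if x \<le> t then g x + h x else 0))
      = (LINT x|I01. (if x \<le> t then g x else 0) + (if x \<le> t then h x else 0))"
    by (intro Bochner_Integration.integral_cong) auto
  also have "\<dots> = (LINT x|I01. (if x \<le> t then g x else 0)) + (LINT x|I01. (if x \<le> t then h x else 0))"
    by (intro Bochner_Integration.integral_add integrable_upto gh)
  finally show "u t + v t = u 0 + v 0 + (LINT x|I01. (if x \<le> t then g x + h x else 0))"
    using ac_derivD(2)[OF assms(1) t] ac_derivD(2)[OF assms(2) t] by simp
qed

lemma ac_scale:
  assumes "has_ac_deriv u g"
  shows "has_ac_deriv (\<lambda>t. c * u t) (\<lambda>t. c * g t)"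
proof (rule ac_derivI)
  note g = ac_derivD(1)[OF assms]
  show "integrable I01 (\<lambda>t. c * g t)" using g by simp
  fix t :: real assume t: "t \<in> {0..1}"
  have "(LINT x|I01. (if x \<le> t then c * g x else 0)) = (LINT x|I01. c * (if x \<le> t then g x else 0))"
    by (intro Bochner_Integration.integral_cong) auto
  then show "c * u t = c * u 0 + (LINT x|I01. (if x \<le> t then c * g x else 0))"
    using ac_derivD(2)[OF assms t] by (simp add: algebra_simps)
qed

lemma ac_diff:
  assumes "has_ac_deriv u g" "has_ac_deriv v h"
  shows "has_ac_deriv (\<lambda>t. u t - v t) (\<lambda>t. g t - h t)"
  using ac_add[OF assms(1) ac_scale[OF assms(2), of "-1"]] by simp

lemma ac_cnj:
  assumes "has_ac_deriv u g"
  shows "has_ac_deriv (\<lambda>t. cnj (u t)) (\<lambda>t. cnj (g t))"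
proof (rule ac_derivI)
  note g = ac_derivD(1)[OF assms]
  show "integrable I01 (\<lambda>t. cnj (g t))" using g by simp
  fix t :: real assume t: "t \<in> {0..1}"
  have "(LINT x|I01. (if x \<le> t then cnj (g x) else 0)) = (LINT x|I01. cnj (if x \<le> t then g x else 0))"
    by (intro Bochner_Integration.integral_cong) auto
  then show "cnj (u t) = cnj (u 0) + (LINT x|I01. (if x \<le> t then cnj (g x) else 0))"
    using ac_derivD(2)[OF assms t] by simp
qed

lemma ac_primitive:
  assumes "integrable I01 g"
  shows "has_ac_deriv (\<lambda>t. c + (LINT x|I01. (if x \<le> t then g x else 0))) g"
proof (rule ac_derivI)
  have "(LINT x|I01. (if x \<le> 0 then g x else 0)) = 0"
    by (rule integral_eq_zero_AE) (use AE_I01_neq[of 0] in \<open>auto elim!: lebesgue_on_mono\<close>)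
  then show "c + (LINT x|I01. (if x \<le> t then g x else 0))
    = c + (LINT x|I01. (if x \<le> 0 then g x else 0)) + (LINT x|I01. (if x \<le> t then g x else 0))" for t
    by simp
qed (rule assms)

text \<open>Fubini on the unit square, split along the diagonal.\<close>

lemma fubini_triangles:
  fixes g h :: "real \<Rightarrow> complex"
  assumes g: "integrable I01 g" and h: "integrable I01 h"
  shows "(LINT s|I01. g s * (LINT r|I01. (if r \<le> s then h r else 0)))
    + (LINT s|I01. (LINT r|I01. (if r \<le> s then g r else 0)) * h s) = integral\<^sup>L I01 g * integral\<^sup>L I01 h"
proof -
  have [measurable]: "g \<in> borel_measurable I01" "h \<in> borel_measurable I01" using g h by auto
  have prod: "integrable (I01 \<Otimes>\<^sub>M I01) (\<lambda>(r, s). g r * h s)"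
    by (rule I01_pair.Fubini_integrable) (use g h in \<open>auto simp: norm_mult\<close>)
  have part: "integrable (I01 \<Otimes>\<^sub>M I01) (\<lambda>(r, s). if r \<le> s then g r * h s else 0)"
    by (rule Bochner_Integration.integrable_bound[OF prod]) auto
  have part': "integrable (I01 \<Otimes>\<^sub>M I01) (\<lambda>(r, s). if s < r then g r * h s else 0)"
    by (rule Bochner_Integration.integrable_bound[OF prod]) auto
  have 1: "(LINT s|I01. (LINT r|I01. (if r \<le> s then g r else 0)) * h s)
      = (LINT s|I01. (LINT r|I01. (if r \<le> s then g r * h s else 0)))"
  proof (rule Bochner_Integration.integral_cong)
    fix s
    have "(LINT r|I01. (if r \<le> s then g r * h s else 0)) = (LINT r|I01. (if r \<le> s then g r else 0) * h s)"
      by (intro Bochner_Integration.integral_cong) auto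
    then show "(LINT r|I01. (if r \<le> s then g r else 0)) * h s = (LINT r|I01. (if r \<le> s then g r * h s else 0))"
      by simp
  qed simp
  \<comment> \<open>The diagonal is a null set on each section, so it can be removed here; the two
    triangles then become disjoint and cover the square.\<close>
  have 2: "(LINT s|I01. g s * (LINT r|I01. (if r \<le> s then h r else 0)))
      = (LINT s|I01. (LINT r|I01. (if r < s then g s * h r else 0)))"
  proof (rule Bochner_Integration.integral_cong)
    fix s
    have "(LINT r|I01. (if r < s then g s * h r else 0)) = (LINT r|I01. (if r < s then h r * g s else 0))"
      by (simp add: mult.commute cong: if_cong)
    also have "\<dots> = (LINT r|I01. (if r \<le> s then h r else 0) * g s)"
    proof (rule integral_cong_AE)
      show "(\<lambda>r. if r < s then h r * g s else 0) \<in> borel_measurable I01"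
        "(\<lambda>r. (if r \<le> s then h r else 0) * g s) \<in> borel_measurable I01" by measurable
      show "AE r in I01. (if r < s then h r * g s else 0) = (if r \<le> s then h r else 0) * g s"
        using AE_I01_neq[of s] by (rule lebesgue_on_mono) auto
    qed
    finally show "g s * (LINT r|I01. (if r \<le> s then h r else 0)) = (LINT r|I01. (if r < s then g s * h r else 0))"
      by simp
  qed simp
  have 3: "(LINT s|I01. (LINT r|I01. (if r < s then g s * h r else 0)))
      = (LINT s|I01. (LINT r|I01. (if s < r then g r * h s else 0)))"
    using I01_pair.Fubini_integral[of "\<lambda>r s. if s < r then g r * h s else 0"] part' by simp
  have 4: "(LINT s|I01. (LINT r|I01. (if s < r then g r * h s else 0)))
    + (LINT s|I01. (LINT r|I01. (if r \<le> s then g r * h s else 0))) = (LINT s|I01. (LINT r|I01. g r * h s))"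
  proof -
    have ig: "integrable I01 (\<lambda>r. g r * h s)" for s using g by simp
    have "(LINT r|I01. g r * h s) = (LINT r|I01. (if s < r then g r * h s else 0))
        + (LINT r|I01. (if r \<le> s then g r * h s else 0))" for s
    proof -
      have "(LINT r|I01. g r * h s)
        = (LINT r|I01. (if s < r then g r * h s else 0) + (if r \<le> s then g r * h s else 0))"
        by (intro Bochner_Integration.integral_cong) auto
      also have "\<dots> = (LINT r|I01. (if s < r then g r * h s else 0))
        + (LINT r|I01. (if r \<le> s then g r * h s else 0))"
        by (intro Bochner_Integration.integral_add integrable_if_I01 ig sets_I01_upto)
      finally show ?thesis .
    qed
    then show ?thesis
      using I01_pair.integrable_snd[OF part] I01_pair.integrable_snd[OF part']
      by (simp add: Bochner_Integration.integral_add)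
  qed
  show ?thesis using 1 2 3 4 by simp
qed

lemma ac_mult:
  assumes "has_ac_deriv u g" "has_ac_deriv v h"
  shows "has_ac_deriv (\<lambda>t. u t * v t) (\<lambda>t. g t * v t + u t * h t)"
proof (rule ac_derivI)
  note g = ac_derivD(1)[OF assms(1)] and h = ac_derivD(1)[OF assms(2)]
  note cu = ac_continuous[OF assms(1)] and cv = ac_continuous[OF assms(2)]
  have bounded_mult: "integrable I01 (\<lambda>t. k t * w t)"
    if k: "integrable I01 k" and w: "continuous_on {0..1} w" for k w :: "real \<Rightarrow> complex"
  proof -
    have "compact (w ` {0..1})" by (intro compact_continuous_image w) simp
    then obtain B where B: "\<And>t. t \<in> {0..1} \<Longrightarrow> norm (w t) \<le> B"
      using compact_imp_bounded bounded_iff by (metis imageI)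
    have [measurable]: "w \<in> borel_measurable I01" by (rule continuous_imp_measurable_I01[OF w])
    have [measurable]: "k \<in> borel_measurable I01" using k by auto
    have "norm (k t * w t) \<le> norm (of_real B * k t)" if "t \<in> {0..1}" for t
    proof -
      have "0 \<le> B" using B[OF that] norm_ge_zero order_trans by blast
      moreover have "norm (k t) * norm (w t) \<le> norm (k t) * B" by (rule mult_left_mono[OF B[OF that]]) simp
      ultimately show ?thesis by (simp add: norm_mult mult.commute)
    qed
    then have AE: "AE t in I01. norm (k t * w t) \<le> norm (of_real B * k t)" by (intro AE_I2) simp
    show ?thesis
    proof (rule Bochner_Integration.integrable_bound[OF _ _ AE])
      show "integrable I01 (\<lambda>t. of_real B * k t)" using k by simp
    qed measurable
  qed
  have ig: "integrable I01 (\<lambda>t. g t * v t)" by (rule bounded_mult[OF g cv])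
  have ih: "integrable I01 (\<lambda>t. u t * h t)" using bounded_mult[OF h cu] by (simp add: mult.commute)
  show "integrable I01 (\<lambda>t. g t * v t + u t * h t)" using ig ih by simp
  fix t :: real assume t: "t \<in> {0..1}"
  \<comment> \<open>With both derivatives cut off at \<open>t\<close>, Fubini on the full square
    yields the product rule at \<open>t\<close> for \<open>u - u 0\<close> and
    \<open>v - v 0\<close>; \<open>f2\<close> and \<open>f3\<close> restore the initial
    values.\<close>
  define g' where "g' x = (if x \<le> t then g x else 0)" for x
  define h' where "h' x = (if x \<le> t then h x else 0)" for x
  have g': "integrable I01 g'" and h': "integrable I01 h'"
    unfolding g'_def[abs_def] h'_def[abs_def] by (intro integrable_upto g h)+
  have G: "(LINT r|I01. (if r \<le> s then g' r else 0)) = u s - u 0" if "s \<in> {0..1}" "s \<le> t" for s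
  proof -
    have "(LINT r|I01. (if r \<le> s then g' r else 0)) = (LINT r|I01. (if r \<le> s then g r else 0))"
      using that by (intro Bochner_Integration.integral_cong) (auto simp: g'_def)
    then show ?thesis using ac_derivD(2)[OF assms(1) that(1)] by simp
  qed
  have H: "(LINT r|I01. (if r \<le> s then h' r else 0)) = v s - v 0" if "s \<in> {0..1}" "s \<le> t" for s
  proof -
    have "(LINT r|I01. (if r \<le> s then h' r else 0)) = (LINT r|I01. (if r \<le> s then h r else 0))"
      using that by (intro Bochner_Integration.integral_cong) (auto simp: h'_def)
    then show ?thesis using ac_derivD(2)[OF assms(2) that(1)] by simp
  qed
  have gt: "integral\<^sup>L I01 g' = u t - u 0" using ac_derivD(2)[OF assms(1) t] by (simp add: g'_def[abs_def])
  have ht: "integral\<^sup>L I01 h' = v t - v 0" using ac_derivD(2)[OF assms(2) t] by (simp add: h'_def[abs_def])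
  have f1: "(LINT s|I01. g' s * (v s - v 0)) + (LINT s|I01. (u s - u 0) * h' s) = (u t - u 0) * (v t - v 0)"
  proof -
    have "(LINT s|I01. g' s * (v s - v 0)) = (LINT s|I01. g' s * (LINT r|I01. (if r \<le> s then h' r else 0)))"
      using H by (intro Bochner_Integration.integral_cong) (auto simp: g'_def)
    moreover have "(LINT s|I01. (u s - u 0) * h' s) = (LINT s|I01. (LINT r|I01. (if r \<le> s then g' r else 0)) * h' s)"
      using G by (intro Bochner_Integration.integral_cong) (auto simp: h'_def)
    ultimately show ?thesis using fubini_triangles[OF g' h'] gt ht by simp
  qed
  have f2: "(LINT s|I01. g' s * (v s - v 0)) = (LINT s|I01. g' s * v s) - (u t - u 0) * v 0"
    using bounded_mult[OF g' cv] g' gt by (simp add: right_diff_distrib)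
  have f3: "(LINT s|I01. (u s - u 0) * h' s) = (LINT s|I01. u s * h' s) - u 0 * (v t - v 0)"
  proof -
    have "integrable I01 (\<lambda>s. u s * h' s)" using bounded_mult[OF h' cu] by (simp add: mult.commute)
    then show ?thesis using h' ht by (simp add: left_diff_distrib)
  qed
  have "(LINT x|I01. (if x \<le> t then g x * v x + u x * h x else 0))
      = (LINT s|I01. g' s * v s + u s * h' s)"
    by (intro Bochner_Integration.integral_cong) (auto simp: g'_def h'_def)
  also have "\<dots> = (LINT s|I01. g' s * v s) + (LINT s|I01. u s * h' s)"
    using bounded_mult[OF g' cv] bounded_mult[OF h' cu] by (simp add: mult.commute)
  finally have f4: "(LINT x|I01. (if x \<le> t then g x * v x + u x * h x else 0))
      = (LINT s|I01. g' s * v s) + (LINT s|I01. u s * h' s)" .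
  show "u t * v t = u 0 * v 0 + (LINT x|I01. (if x \<le> t then g x * v x + u x * h x else 0))"
    using f1 unfolding f2 f3 f4 by (simp add: algebra_simps)
qed

lemma integration_by_parts:
  assumes "has_ac_deriv u g" "has_ac_deriv v h"
    and "integrable I01 (\<lambda>t. g t * v t)" "integrable I01 (\<lambda>t. u t * h t)"
  shows "(LINT t|I01. g t * v t) + (LINT t|I01. u t * h t) = u 1 * v 1 - u 0 * v 0"
proof -
  have "(LINT x|I01. (if x \<le> 1 then g x * v x + u x * h x else 0)) = (LINT x|I01. g x * v x + u x * h x)"
    by (intro Bochner_Integration.integral_cong) auto
  then show ?thesis using ac_derivD(2)[OF ac_mult[OF assms(1,2)], of 1] assms(3,4) by simp
qed

text \<open>If some derivative is continuous, the chosen one is too, and continuous functions that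
  agree almost everywhere on the interval agree at each of its points. This gives the end values of
  derivatives their meaning.\<close>

lemma edge_deriv:
  assumes "has_ac_deriv u g"
  shows ac_edge_deriv: "has_ac_deriv u (edge_deriv u)"
    and edge_deriv_AE: "AE t in I01. edge_deriv u t = g t"
    and edge_deriv_continuous: "\<lbrakk>continuous_on {0..1} g; t \<in> {0..1}\<rbrakk> \<Longrightarrow> edge_deriv u t = g t"
proof -
  let ?P = "\<lambda>g. has_ac_deriv u g \<and>
     ((\<exists>h. has_ac_deriv u h \<and> continuous_on {0..1} h) \<longrightarrow> continuous_on {0..1} g)"
  have "\<exists>g. ?P g" using assms by blast
  then have P: "?P (edge_deriv u)" unfolding edge_deriv_def by (rule someI_ex)
  then show d: "has_ac_deriv u (edge_deriv u)" by blast
  show ae: "AE t in I01. edge_deriv u t = g t" by (rule ac_deriv_unique[OF d assms])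
  show "edge_deriv u t = g t" if "continuous_on {0..1} g" "t \<in> {0..1}"
  proof (rule AE_eq_imp_eq_continuous[OF _ that(1) ae that(2)])
    show "continuous_on {0..1} (edge_deriv u)" using P assms that(1) by blast
  qed
qed

section \<open>Square integrable functions on an edge\<close>

definition escale :: "complex \<Rightarrow> (real \<Rightarrow> complex) \<Rightarrow> real \<Rightarrow> complex" where
  "escale c f = (\<lambda>t. c * f t)"

definition eip :: "(real \<Rightarrow> complex) \<Rightarrow> (real \<Rightarrow> complex) \<Rightarrow> complex" where
  "eip f g = (LINT t|I01. f t * cnj (g t))"

lemma borel_measurable_cnj [measurable, simp]:
  "f \<in> borel_measurable M \<Longrightarrow> (\<lambda>x. cnj (f x)) \<in> borel_measurable M"
  by (rule borel_measurable_continuous_on[of cnj]) (auto intro: continuous_intros)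

lemma L2_edge_integrable_mult:
  assumes "L2_edge u" "L2_edge v"
  shows "integrable I01 (\<lambda>t. u t * v t)"
proof (rule Bochner_Integration.integrable_bound)
  show "integrable I01 (\<lambda>t. (cmod (u t))\<^sup>2 + (cmod (v t))\<^sup>2)"
    using assms by (simp add: L2_edge_def)
  show "(\<lambda>t. u t * v t) \<in> borel_measurable I01" using assms by (auto simp: L2_edge_def)
  show "AE t in I01. norm (u t * v t) \<le> norm ((cmod (u t))\<^sup>2 + (cmod (v t))\<^sup>2)"
  proof (rule AE_I2)
    fix t
    have "cmod (u t) * cmod (v t) \<le> (cmod (u t))\<^sup>2 + (cmod (v t))\<^sup>2"
      using sum_squares_bound[of "cmod (u t)" "cmod (v t)"]
        mult_nonneg_nonneg[OF norm_ge_zero[of "u t"] norm_ge_zero[of "v t"]] by linarith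
    then show "norm (u t * v t) \<le> norm ((cmod (u t))\<^sup>2 + (cmod (v t))\<^sup>2)"
      by (simp add: norm_mult)
  qed
qed

lemma L2_edge_cnj: "L2_edge u \<Longrightarrow> L2_edge (\<lambda>t. cnj (u t))"
  by (auto simp: L2_edge_def)

lemma L2_edge_integrable_eip: "\<lbrakk>L2_edge u; L2_edge v\<rbrakk> \<Longrightarrow> integrable I01 (\<lambda>t. u t * cnj (v t))"
  by (intro L2_edge_integrable_mult L2_edge_cnj)

lemma L2_edge_zero: "L2_edge (\<lambda>t. 0)"
  by (simp add: L2_edge_def)

lemma L2_edge_scale: "L2_edge u \<Longrightarrow> L2_edge (\<lambda>t. c * u t)"
  by (auto simp: L2_edge_def norm_mult power_mult_distrib)

lemma L2_edge_bounded_mult: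
  assumes "L2_edge u" and b: "b \<in> borel_measurable I01" and B: "AE t in I01. cmod (b t) \<le> B"
  shows "L2_edge (\<lambda>t. b t * u t)"
  unfolding L2_edge_def
proof
  have u: "u \<in> borel_measurable I01" "integrable I01 (\<lambda>t. (cmod (u t))\<^sup>2)"
    using assms(1) by (auto simp: L2_edge_def)
  show "(\<lambda>t. b t * u t) \<in> borel_measurable I01" using u b by auto
  show "integrable I01 (\<lambda>t. (cmod (b t * u t))\<^sup>2)"
  proof (rule Bochner_Integration.integrable_bound)
    show "integrable I01 (\<lambda>t. B\<^sup>2 * (cmod (u t))\<^sup>2)" using u by simp
    show "(\<lambda>t. (cmod (b t * u t))\<^sup>2) \<in> borel_measurable I01" using u b by auto
    show "AE t in I01. norm ((cmod (b t * u t))\<^sup>2) \<le> norm (B\<^sup>2 * (cmod (u t))\<^sup>2)"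
      using B
    proof (rule eventually_mono)
      fix t assume "cmod (b t) \<le> B"
      then have "(cmod (b t))\<^sup>2 \<le> B\<^sup>2" by (intro power_mono) auto
      then show "norm ((cmod (b t * u t))\<^sup>2) \<le> norm (B\<^sup>2 * (cmod (u t))\<^sup>2)"
        by (simp add: norm_mult power_mult_distrib mult_right_mono)
    qed
  qed
qed

lemma L2_edge_add:
  assumes "L2_edge u" "L2_edge v"
  shows "L2_edge (\<lambda>t. u t + v t)"
  unfolding L2_edge_def
proof
  show "(\<lambda>t. u t + v t) \<in> borel_measurable I01" using assms by (auto simp: L2_edge_def)
  show "integrable I01 (\<lambda>t. (cmod (u t + v t))\<^sup>2)"
  proof (rule Bochner_Integration.integrable_bound)
    show "integrable I01 (\<lambda>t. 2 * (cmod (u t))\<^sup>2 + 2 * (cmod (v t))\<^sup>2)"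
      using assms by (simp add: L2_edge_def)
    show "(\<lambda>t. (cmod (u t + v t))\<^sup>2) \<in> borel_measurable I01" using assms by (auto simp: L2_edge_def)
    show "AE t in I01. norm ((cmod (u t + v t))\<^sup>2) \<le> norm (2 * (cmod (u t))\<^sup>2 + 2 * (cmod (v t))\<^sup>2)"
    proof (rule AE_I2)
      fix t
      have "(cmod (u t + v t))\<^sup>2 \<le> (cmod (u t) + cmod (v t))\<^sup>2"
        by (intro power_mono norm_triangle_ineq) simp
      also have "\<dots> \<le> 2 * (cmod (u t))\<^sup>2 + 2 * (cmod (v t))\<^sup>2"
        using sum_squares_bound[of "cmod (u t)" "cmod (v t)"] by (simp add: power2_sum)
      finally show "norm ((cmod (u t + v t))\<^sup>2) \<le> norm (2 * (cmod (u t))\<^sup>2 + 2 * (cmod (v t))\<^sup>2)" by simp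
    qed
  qed
qed

lemma L2_edge_diff: "\<lbrakk>L2_edge u; L2_edge v\<rbrakk> \<Longrightarrow> L2_edge (\<lambda>t. u t - v t)"
  using L2_edge_add[OF _ L2_edge_scale[of v "-1"]] by simp

lemma L2_edge_bounded:
  assumes "b \<in> borel_measurable I01" "AE t in I01. cmod (b t) \<le> B"
  shows "L2_edge b"
  using L2_edge_bounded_mult[OF _ assms, of "\<lambda>_. 1"] by (simp add: L2_edge_def)

lemma continuous_imp_L2_edge:
  assumes "continuous_on {0..1} w"
  shows "L2_edge w"
proof -
  have "compact (w ` {0..1})" by (intro compact_continuous_image assms) simp
  then obtain B where "\<And>t. t \<in> {0..1} \<Longrightarrow> norm (w t) \<le> B"
    using compact_imp_bounded bounded_iff by (metis imageI)
  then show ?thesis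
    by (intro L2_edge_bounded[of _ B] continuous_imp_measurable_I01 assms AE_I2) simp
qed

lemma L2_edge_imp_integrable: "L2_edge u \<Longrightarrow> integrable I01 u"
  using L2_edge_integrable_mult[of u "\<lambda>_. 1"] by (simp add: L2_edge_def)

interpretation escale: vector_space escale
  by standard (auto simp: escale_def fun_eq_iff algebra_simps)

interpretation E: hermitian_form escale "Collect L2_edge" eip
proof
  show "escale.subspace (Collect L2_edge)"
    unfolding escale.subspace_def
    using L2_edge_zero L2_edge_add L2_edge_scale by (auto simp: escale_def zero_fun_def plus_fun_def)
  show "eip (x + y) z = eip x z + eip y z"
    if "x \<in> Collect L2_edge" "y \<in> Collect L2_edge" "z \<in> Collect L2_edge" for x y z
    using that by (simp add: eip_def distrib_right L2_edge_integrable_eip)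
  show "eip (escale c x) z = c * eip x z" for c x z
    by (simp add: eip_def escale_def mult.assoc)
  show "eip y x = cnj (eip x y)" for x y
    unfolding eip_def by (subst Bochner_Integration.integral_cnj[symmetric]) (simp add: mult.commute)
qed

lemma E_sq: "E.sq u = (LINT t|I01. (cmod (u t))\<^sup>2)"
proof -
  have "eip u u = (LINT t|I01. of_real ((cmod (u t))\<^sup>2))"
    unfolding eip_def by (intro Bochner_Integration.integral_cong complex_norm_square[symmetric] refl)
  then show ?thesis by (simp add: E.sq_def del: of_real_power)
qed

interpretation E: semi_inner escale "Collect L2_edge" eip
  by standard (simp add: E_sq)

lemma E_sq_eq_0_iff: "L2_edge u \<Longrightarrow> E.sq u = 0 \<longleftrightarrow> (AE t in I01. u t = 0)"
  unfolding E_sq by (subst integral_nonneg_eq_0_iff_AE) (auto simp: L2_edge_def)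

lemma E_sq_cong_AE:
  "\<lbrakk>L2_edge u; L2_edge v; AE t in I01. u t = v t\<rbrakk> \<Longrightarrow> E.sq u = E.sq v"
  unfolding E_sq by (rule integral_cong_AE) (auto simp: L2_edge_def elim: eventually_mono)

lemma eip_cong_AE:
  assumes "L2_edge u" "L2_edge v" "L2_edge u'" "L2_edge v'"
    "AE t in I01. u t = u' t" "AE t in I01. v t = v' t"
  shows "eip u v = eip u' v'"
  unfolding eip_def
proof (rule integral_cong_AE)
  show "AE t in I01. u t * cnj (v t) = u' t * cnj (v' t)"
    using assms(5,6) by eventually_elim simp
qed (use assms in \<open>auto simp: L2_edge_def\<close>)

lemma E_sq_le_sup:
  assumes "L2_edge u" "\<And>t. t \<in> {0..1} \<Longrightarrow> cmod (u t) \<le> B"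
  shows "E.sq u \<le> B\<^sup>2"
proof -
  have "(LINT t|I01. (cmod (u t))\<^sup>2) \<le> (LINT t|I01. B\<^sup>2)"
    using assms by (intro integral_mono) (auto simp: L2_edge_def intro!: power_mono)
  then show ?thesis by (simp add: E_sq measure_restrict_space)
qed

text \<open>Riesz--Fischer, by means of an almost everywhere convergent subsequence and Fatou's lemma.\<close>

lemma E_complete: "E.is_complete"
  unfolding E.is_complete_def
proof (intro allI impI)
  fix u :: "nat \<Rightarrow> real \<Rightarrow> complex"
  assume "\<forall>n. u n \<in> Collect L2_edge" and cauchy: "E.cauchy_seq u"
  then have u: "L2_edge (u n)" for n by simp
  then have [measurable]: "u n \<in> borel_measurable I01" for n by (simp add: L2_edge_def)
  \<comment> \<open>The interval has measure one, so the L1 distance is at most the L2 distance;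
    L1-Cauchy sequences provide the almost everywhere convergent subsequence.\<close>
  have L1: "(LINT t|I01. norm (u i t - u j t)) \<le> E.nrm (u i - u j)" for i j
  proof -
    let ?w = "\<lambda>t. of_real (norm (u i t - u j t)) :: complex"
    have w: "L2_edge ?w" using L2_edge_diff[OF u u, of i j] by (auto simp: L2_edge_def)
    have one: "L2_edge (\<lambda>_. 1)" by (simp add: L2_edge_def)
    have "cmod (eip ?w (\<lambda>_. 1)) \<le> E.nrm ?w * E.nrm (\<lambda>_. 1)"
      using w one by (intro E.Cauchy_Schwarz) auto
    also have "E.nrm (\<lambda>_. 1) = 1" by (simp add: E.nrm_def E_sq measure_restrict_space)
    also have "E.nrm ?w = E.nrm (u i - u j)" by (simp add: E.nrm_def E_sq)
    also have "eip ?w (\<lambda>_. 1) = of_real (LINT t|I01. norm (u i t - u j t))"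
      by (simp add: eip_def)
    finally have "\<bar>LINT t|I01. norm (u i t - u j t)\<bar> \<le> E.nrm (u i - u j)" by (simp only: norm_of_real)
    then show ?thesis by linarith
  qed
  obtain r where r: "strict_mono r" "AE x in I01. Cauchy (\<lambda>i. u (r i) x)"
  proof (rule cauchy_L1_AE_cauchy_subseq)
    show "integrable I01 (u n)" for n by (rule L2_edge_imp_integrable[OF u])
    fix e :: real assume e: "0 < e"
    then have "0 < e\<^sup>2" by simp
    then obtain N where N: "\<forall>i\<ge>N. \<forall>j\<ge>N. E.sq (u i - u j) < e\<^sup>2"
      using cauchy unfolding E.cauchy_seq_def by blast
    have "(LINT t|I01. norm (u i t - u j t)) < e" if "i \<ge> N" "j \<ge> N" for i j
    proof -
      have "E.nrm (u i - u j) < e"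
        using N that e real_sqrt_less_mono[of "E.sq (u i - u j)" "e\<^sup>2"] by (simp add: E.nrm_def)
      then show ?thesis using L1[of i j] by simp
    qed
    then show "\<exists>N. \<forall>i\<ge>N. \<forall>j\<ge>N. (LINT t|I01. norm (u i t - u j t)) < e" by blast
  qed
  define h where "h x = lim (\<lambda>i. u (r i) x)" for x
  have [measurable]: "h \<in> borel_measurable I01"
    unfolding h_def[abs_def] by (intro borel_measurable_lim_metric) simp
  have lim: "AE x in I01. (\<lambda>i. u (r i) x) \<longlonglongrightarrow> h x"
    using r(2) by (rule eventually_mono) (simp add: h_def Cauchy_convergent_iff convergent_LIMSEQ_iff)
  \<comment> \<open>Fatou's lemma along the subsequence with \<open>n\<close> fixed. It also yields
    that \<open>u n - h\<close>, and hence \<open>h\<close>, is square integrable.\<close>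
  have key: "L2_edge (\<lambda>x. u n x - h x) \<and> E.sq (\<lambda>x. u n x - h x) \<le> e"
    if e: "0 < e" and N: "\<And>i j. i \<ge> N \<Longrightarrow> j \<ge> N \<Longrightarrow> E.sq (u i - u j) < e" and n: "n \<ge> N" for e N n
  proof -
    have "(\<integral>\<^sup>+x. ennreal ((cmod (u n x - h x))\<^sup>2) \<partial>I01)
        = (\<integral>\<^sup>+x. liminf (\<lambda>i. ennreal ((cmod (u n x - u (r i) x))\<^sup>2)) \<partial>I01)"
    proof (rule nn_integral_cong_AE)
      show "AE x in I01. ennreal ((cmod (u n x - h x))\<^sup>2) = liminf (\<lambda>i. ennreal ((cmod (u n x - u (r i) x))\<^sup>2))"
        using lim
      proof (rule eventually_mono)
        fix x assume "(\<lambda>i. u (r i) x) \<longlonglongrightarrow> h x"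
        then have "(\<lambda>i. ennreal ((cmod (u n x - u (r i) x))\<^sup>2)) \<longlonglongrightarrow> ennreal ((cmod (u n x - h x))\<^sup>2)"
          by (intro tendsto_ennrealI tendsto_intros)
        from lim_imp_Liminf[OF _ this]
        show "ennreal ((cmod (u n x - h x))\<^sup>2) = liminf (\<lambda>i. ennreal ((cmod (u n x - u (r i) x))\<^sup>2))"
          by simp
      qed
    qed
    also have "\<dots> \<le> liminf (\<lambda>i. \<integral>\<^sup>+x. ennreal ((cmod (u n x - u (r i) x))\<^sup>2) \<partial>I01)"
      by (rule nn_integral_liminf) simp
    also have "\<dots> \<le> ennreal e"
    proof (rule Liminf_le)
      have "(\<integral>\<^sup>+x. ennreal ((cmod (u n x - u (r i) x))\<^sup>2) \<partial>I01) \<le> ennreal e" if "i \<ge> N" for i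
      proof -
        have "integrable I01 (\<lambda>x. (cmod (u n x - u (r i) x))\<^sup>2)"
          using L2_edge_diff[OF u u, of n "r i"] by (simp add: L2_edge_def)
        then have "(\<integral>\<^sup>+x. ennreal ((cmod (u n x - u (r i) x))\<^sup>2) \<partial>I01) = ennreal (E.sq (u n - u (r i)))"
          by (simp add: nn_integral_eq_integral E_sq)
        also have "\<dots> \<le> ennreal e"
          using N[OF n, of "r i"] seq_suble[OF r(1), of i] that by (intro ennreal_leI) simp
        finally show ?thesis .
      qed
      then show "\<forall>\<^sub>F i in sequentially. (\<integral>\<^sup>+x. ennreal ((cmod (u n x - u (r i) x))\<^sup>2) \<partial>I01) \<le> ennreal e"
        by (auto simp: eventually_sequentially)
    qed simp
    finally have fin: "(\<integral>\<^sup>+x. ennreal ((cmod (u n x - h x))\<^sup>2) \<partial>I01) \<le> ennreal e" .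
    then have int: "integrable I01 (\<lambda>x. (cmod (u n x - h x))\<^sup>2)"
      by (intro integrableI_nonneg) (auto intro: le_less_trans)
    then have "ennreal (E.sq (\<lambda>x. u n x - h x)) \<le> ennreal e"
      using fin by (simp add: nn_integral_eq_integral E_sq)
    then show ?thesis using int e by (simp add: L2_edge_def)
  qed
  obtain N1 where N1: "\<And>i j. i \<ge> N1 \<Longrightarrow> j \<ge> N1 \<Longrightarrow> E.sq (u i - u j) < 1"
    using cauchy unfolding E.cauchy_seq_def by (meson zero_less_one)
  have "L2_edge (\<lambda>x. u N1 x - h x)" using key[of 1 N1 N1, OF zero_less_one N1 order_refl] by blast
  then have "L2_edge (\<lambda>x. u N1 x - (u N1 x - h x))" by (rule L2_edge_diff[OF u])
  then have h: "L2_edge h" by simp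
  have "(\<lambda>n. E.sq (u n - h)) \<longlonglongrightarrow> 0"
  proof (rule LIMSEQ_I)
    fix e :: real assume e: "0 < e"
    then have e2: "0 < e / 2" by simp
    then obtain N where N: "\<And>i j. i \<ge> N \<Longrightarrow> j \<ge> N \<Longrightarrow> E.sq (u i - u j) < e / 2"
      using cauchy unfolding E.cauchy_seq_def by meson
    have "norm (E.sq (u n - h) - 0) < e" if "n \<ge> N" for n
    proof -
      have "u n - h = (\<lambda>x. u n x - h x)" by auto
      then have "E.sq (u n - h) \<le> e / 2" using key[of "e / 2" N n, OF e2 N that] by simp
      moreover have "0 \<le> E.sq (u n - h)" using u h by (intro E.sq_nonneg E.V_diff) auto
      ultimately show ?thesis using e by simp
    qed
    then show "\<exists>N. \<forall>n\<ge>N. norm (E.sq (u n - h) - 0) < e" by blast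
  qed
  then show "\<exists>x\<in>Collect L2_edge. E.tends_to u x" using h by (auto simp: E.tends_to_def)
qed

section \<open>The Sobolev space of an edge\<close>

lemma measure_I01_interval:
  assumes "0 \<le> s" "s \<le> t" "t \<le> 1"
  shows "(LINT x|I01. (if s < x \<and> x \<le> t then 1 else 0 :: real)) = t - s"
    and "(LINT x|I01. (if s \<le> x \<and> x \<le> t then 1 else 0 :: real)) = t - s"
proof -
  have "(LINT x|I01. (if s < x \<and> x \<le> t then 1 else 0 :: real)) = (LINT x|I01. indicator {s<..t} x)"
    by (intro Bochner_Integration.integral_cong) (auto simp: indicator_def)
  also have "\<dots> = measure I01 {s<..t}"
    using assms by (subst Bochner_Integration.integral_indicator) (auto simp: Int_absorb2 subset_iff)
  also have "\<dots> = t - s" using assms by (subst measure_restrict_space) auto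
  finally show "(LINT x|I01. (if s < x \<and> x \<le> t then 1 else 0 :: real)) = t - s" .
  have "(LINT x|I01. (if s \<le> x \<and> x \<le> t then 1 else 0 :: real)) = (LINT x|I01. indicator {s..t} x)"
    by (intro Bochner_Integration.integral_cong) (auto simp: indicator_def)
  also have "\<dots> = measure I01 {s..t}"
    using assms by (subst Bochner_Integration.integral_indicator) (auto simp: Int_absorb2 subset_iff)
  also have "\<dots> = t - s" using assms by (subst measure_restrict_space) auto
  finally show "(LINT x|I01. (if s \<le> x \<and> x \<le> t then 1 else 0 :: real)) = t - s" .
qed

text \<open>\<open>u t - u s\<close> is the inner product of \<open>g\<close> with the indicator of
  \<open>s < x \<le> t\<close>, whose squared norm is the length of the interval; the rest is
  Cauchy-Schwarz.\<close>

lemma ac_holder: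
  assumes u: "has_ac_deriv u g" and g: "L2_edge g" and st: "s \<in> {0..1}" "t \<in> {0..1}"
  shows "(cmod (u t - u s))\<^sup>2 \<le> \<bar>t - s\<bar> * E.sq g"
proof -
  have main: "(cmod (u t - u s))\<^sup>2 \<le> (t - s) * E.sq g" if st: "s \<in> {0..1}" "t \<in> {0..1}" "s \<le> t" for s t
  proof -
    define j :: "real \<Rightarrow> complex" where "j x = (if s < x \<and> x \<le> t then 1 else 0)" for x
    have [measurable]: "j \<in> borel_measurable I01" unfolding j_def[abs_def] by measurable
    have j: "L2_edge j" by (rule L2_edge_bounded[of _ 1]) (auto simp: j_def)
    have "(\<lambda>x. (cmod (j x))\<^sup>2) = (\<lambda>x. if s < x \<and> x \<le> t then 1 else 0)" by (auto simp: j_def)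
    then have sj: "E.sq j = t - s" using measure_I01_interval(1)[of s t] st by (simp add: E_sq)
    have "u t - u s = (LINT x|I01. (if x \<le> t then g x else 0)) - (LINT x|I01. (if x \<le> s then g x else 0))"
      using ac_derivD(2)[OF u st(1)] ac_derivD(2)[OF u st(2)] by simp
    also have "\<dots> = (LINT x|I01. (if x \<le> t then g x else 0) - (if x \<le> s then g x else 0))"
      by (intro Bochner_Integration.integral_diff[symmetric] integrable_upto ac_derivD(1)[OF u])
    also have "\<dots> = eip g j"
      unfolding eip_def using st(3) by (intro Bochner_Integration.integral_cong) (auto simp: j_def)
    finally show ?thesis
      using E.Cauchy_Schwarz_sq[of g j] g j sj by (simp add: mult.commute)
  qed
  show ?thesis
    using main[of s t] main[of t s] st by (cases "s \<le> t") (auto simp: norm_minus_commute)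
qed

text \<open>Averaging \<open>cmod (u s) \<le> cmod (u t) + cmod (u t - u s)\<close> over an interval of length \<open>\<eta>\<close>.\<close>

lemma ac_trace_bound:
  assumes u: "has_ac_deriv u g" and g: "L2_edge g" and s: "s \<in> {0..1}" and \<eta>: "0 < \<eta>" "\<eta> \<le> 1 / 2"
  shows "(cmod (u s))\<^sup>2 \<le> 2 / \<eta> * E.sq u + 2 * \<eta> * E.sq g"
proof -
  \<comment> \<open>The interval from \<open>a\<close> to \<open>a + \<eta>\<close> contains
    \<open>s\<close> and stays inside \<open>{0..1}\<close>; here \<open>\<eta> \<le> 1 / 2\<close>
    enters.\<close>
  define a where "a = (if s \<le> 1 / 2 then s else s - \<eta>)"
  have a: "0 \<le> a" "a \<le> s" "s \<le> a + \<eta>" "a + \<eta> \<le> 1" using s \<eta> by (auto simp: a_def)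
  define c where "c = (cmod (u s))\<^sup>2 - 2 * \<eta> * E.sq g"
  have Eg: "0 \<le> E.sq g" by (simp add: E_sq)
  have L2u: "L2_edge u" by (rule continuous_imp_L2_edge[OF ac_continuous[OF u]])
  have "(LINT t|I01. c * (if a \<le> t \<and> t \<le> a + \<eta> then 1 else 0)) \<le> (LINT t|I01. 2 * (cmod (u t))\<^sup>2)"
  proof (rule integral_mono)
    show "integrable I01 (\<lambda>t. c * (if a \<le> t \<and> t \<le> a + \<eta> then 1 else 0))"
      by (intro integrable_mult_right I01.integrable_const_bound[of _ 1]) auto
    show "integrable I01 (\<lambda>t. 2 * (cmod (u t))\<^sup>2)" using L2u by (simp add: L2_edge_def)
    fix t assume "t \<in> space I01"
    then have t: "t \<in> {0..1}" by simp
    show "c * (if a \<le> t \<and> t \<le> a + \<eta> then 1 else 0) \<le> 2 * (cmod (u t))\<^sup>2"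
    proof (cases "a \<le> t \<and> t \<le> a + \<eta>")
      case True
      have "cmod (u s) \<le> cmod (u t) + cmod (u s - u t)"
        using norm_triangle_ineq[of "u t" "u s - u t"] by simp
      then have "(cmod (u s))\<^sup>2 \<le> (cmod (u t) + cmod (u s - u t))\<^sup>2" by (intro power_mono) auto
      also have "\<dots> \<le> 2 * (cmod (u t))\<^sup>2 + 2 * (cmod (u s - u t))\<^sup>2"
        using sum_squares_bound[of "cmod (u t)" "cmod (u s - u t)"] by (simp add: power2_sum)
      also have "(cmod (u s - u t))\<^sup>2 \<le> \<bar>s - t\<bar> * E.sq g" by (rule ac_holder[OF u g t s])
      also have "\<bar>s - t\<bar> * E.sq g \<le> \<eta> * E.sq g" using True a Eg by (intro mult_right_mono) auto
      finally show ?thesis using True by (simp add: c_def)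
    next
      case False
      then show ?thesis by (subst if_not_P) auto
    qed
  qed
  then have "c * \<eta> \<le> 2 * E.sq u"
    using measure_I01_interval(2)[of a "a + \<eta>"] a \<eta> by (simp add: E_sq)
  then have "c \<le> 2 / \<eta> * E.sq u" using \<eta> by (simp add: field_simps)
  then show ?thesis by (simp add: c_def)
qed

text \<open>The lemma of du Bois-Reymond: test functions with derivative \<open>g - H - c\<close>.\<close>

lemma weak_derivative:
  assumes g: "L2_edge g" and f: "L2_edge f"
    and weak: "\<And>v h. \<lbrakk>has_ac_deriv v h; L2_edge h; v 0 = 0; v 1 = 0\<rbrakk> \<Longrightarrow> eip g h + eip f v = 0"
  shows "\<exists>k. has_ac_deriv k f \<and> (AE t in I01. g t = k t)"
proof -
  note f1 = L2_edge_imp_integrable[OF f]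
  define H where "H t = 0 + (LINT x|I01. (if x \<le> t then f x else 0))" for t
  have H: "has_ac_deriv H f" unfolding H_def[abs_def] by (rule ac_primitive[OF f1])
  have L2H: "L2_edge H" by (rule continuous_imp_L2_edge[OF ac_continuous[OF H]])
  \<comment> \<open>The mean of \<open>g - H\<close>, so that \<open>h\<close> has integral zero and
    its primitive \<open>v\<close> vanishes at 1 as well as at 0.\<close>
  define c where "c = (LINT x|I01. g x - H x)"
  define h where "h t = g t - H t - c" for t
  have L2c: "L2_edge (\<lambda>_. c)" by (intro continuous_imp_L2_edge continuous_intros)
  have L2h: "L2_edge h" unfolding h_def[abs_def] by (intro L2_edge_diff g L2H L2c)
  have i: "integrable I01 (\<lambda>x. g x - H x)" by (intro L2_edge_imp_integrable L2_edge_diff g L2H)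
  have int_h: "integral\<^sup>L I01 h = 0"
    unfolding h_def[abs_def] using i by (simp add: c_def measure_restrict_space)
  define v where "v t = 0 + (LINT x|I01. (if x \<le> t then h x else 0))" for t
  have v: "has_ac_deriv v h"
    unfolding v_def[abs_def] by (rule ac_primitive[OF L2_edge_imp_integrable[OF L2h]])
  have v1: "v 1 = 0"
  proof -
    have "(LINT x|I01. (if x \<le> 1 then h x else 0)) = integral\<^sup>L I01 h"
      by (intro Bochner_Integration.integral_cong) auto
    then show ?thesis by (simp add: v_def int_h)
  qed
  have v0: "v 0 = 0"
    unfolding v_def using AE_I01_neq[of 0] by (subst integral_eq_zero_AE) (auto elim!: lebesgue_on_mono)
  have L2v: "L2_edge v" by (rule continuous_imp_L2_edge[OF ac_continuous[OF v]])
  \<comment> \<open>With the weak identity for \<open>v\<close> this gives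
    \<open>eip g h = eip H h\<close>. Constants are orthogonal to \<open>h\<close>, so
    \<open>eip h h\<close> vanishes.\<close>
  have "eip f v + eip H h = 0"
    using integration_by_parts[OF H ac_cnj[OF v]] L2_edge_integrable_eip[OF f L2v] L2_edge_integrable_eip[OF L2H L2h]
    by (simp add: eip_def v0 v1)
  moreover have "eip g h + eip f v = 0" by (rule weak[OF v L2h v0 v1])
  moreover have "eip (\<lambda>_. c) h = 0"
    by (simp add: eip_def int_h)
  moreover have "eip h h = eip g h - eip H h - eip (\<lambda>_. c) h"
  proof -
    have "h = (g - H) - (\<lambda>_. c)" by (auto simp: h_def)
    then have "eip h h = eip ((g - H) - (\<lambda>_. c)) h" by simp
    also have "\<dots> = eip (g - H) h - eip (\<lambda>_. c) h"
      using g L2H L2c L2h by (intro E.diff_left E.V_diff) auto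
    also have "eip (g - H) h = eip g h - eip H h" using g L2H L2h by (intro E.diff_left) auto
    finally show ?thesis .
  qed
  ultimately have "E.sq h = 0" unfolding E.sq_def by (simp add: add_eq_0_iff)
  then have "AE t in I01. h t = 0" using E_sq_eq_0_iff[OF L2h] by simp
  then have "AE t in I01. g t = c + H t" by (rule eventually_mono) (simp add: h_def algebra_simps)
  moreover have "has_ac_deriv (\<lambda>t. c + H t) f"
    using ac_add[OF ac_const[of c] H] by simp
  ultimately show ?thesis by blast
qed

text \<open>Arzela-Ascoli: the trace bound with \<open>\<eta> = 1/2\<close> bounds the functions
  uniformly by \<open>sqrt (5 * D)\<close>, and \<open>ac_holder\<close> makes them equicontinuous.
  Uniform convergence is stronger than what is asked.\<close>

lemma ac_compact:
  assumes u: "\<And>n. has_ac_deriv (u n) (g n)" "\<And>n. L2_edge (g n)"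
    and D: "\<And>n. E.sq (u n) \<le> D" "\<And>n. E.sq (g n) \<le> D"
  shows "\<exists>r::nat \<Rightarrow> nat. strict_mono r \<and> E.cauchy_seq (\<lambda>n. u (r n))"
proof -
  have D0: "0 \<le> D" using D(1)[of 0] E.sq_nonneg[of "u 0"] continuous_imp_L2_edge[OF ac_continuous[OF u(1)]]
    by (meson mem_Collect_eq order_trans)
  have bound: "norm (u n x) \<le> sqrt (5 * D)" if "x \<in> {0..1}" for n x
  proof -
    have "(cmod (u n x))\<^sup>2 \<le> 2 / (1/2) * E.sq (u n) + 2 * (1/2) * E.sq (g n)"
      using that by (intro ac_trace_bound u) auto
    also have "\<dots> \<le> 5 * D" using D[of n] by simp
    finally show ?thesis by (rule real_le_rsqrt)
  qed
  have equi: "\<exists>d>0. \<forall>n y. y \<in> {0..1} \<and> norm (x - y) < d \<longrightarrow> norm (u n x - u n y) < e"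
    if x: "x \<in> {0..1}" and e: "0 < e" for x e :: real
  proof (intro exI conjI allI impI)
    show "0 < e\<^sup>2 / (D + 1)" using e D0 by simp
    fix n y assume y: "y \<in> {0..1} \<and> norm (x - y) < e\<^sup>2 / (D + 1)"
    have "(cmod (u n x - u n y))\<^sup>2 \<le> \<bar>x - y\<bar> * E.sq (g n)"
      using y x by (intro ac_holder u) auto
    also have "\<dots> \<le> \<bar>x - y\<bar> * (D + 1)" using D(2)[of n] by (intro mult_left_mono) auto
    also have "\<dots> < e\<^sup>2" using y D0 by (simp add: field_simps)
    finally show "norm (u n x - u n y) < e" using e by (simp add: power2_less_imp_less)
  qed
  obtain w and r :: "nat \<Rightarrow> nat" where r: "strict_mono r"
    and w: "\<And>e. 0 < e \<Longrightarrow> \<exists>N. \<forall>n x. n \<ge> N \<and> x \<in> {0..1} \<longrightarrow> norm (u (r n) x - w x) < e"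
    using Arzela_Ascoli[of "{0..1::real}" u "sqrt (5 * D)"] bound equi by (metis compact_Icc)
  have L2: "L2_edge (u n)" for n by (rule continuous_imp_L2_edge[OF ac_continuous[OF u(1)]])
  have "E.cauchy_seq (\<lambda>n. u (r n))" unfolding E.cauchy_seq_def
  proof (intro allI impI)
    fix e :: real assume e: "0 < e"
    then obtain N where N: "\<And>n x. n \<ge> N \<Longrightarrow> x \<in> {0..1} \<Longrightarrow> norm (u (r n) x - w x) < sqrt e / 4"
      using w[of "sqrt e / 4"] by auto
    have "E.sq (u (r m) - u (r n)) < e" if mn: "m \<ge> N" "n \<ge> N" for m n
    proof -
      have "E.sq (u (r m) - u (r n)) \<le> (sqrt e / 2)\<^sup>2"
      proof (rule E_sq_le_sup)
        show "L2_edge (u (r m) - u (r n))" using E.V_diff[of "u (r m)" "u (r n)"] L2 by simp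
        fix t :: real assume t: "t \<in> {0..1}"
        have "norm (u (r m) t - u (r n) t) \<le> norm (u (r m) t - w t) + norm (u (r n) t - w t)"
          using norm_triangle_ineq4[of "u (r m) t - w t" "u (r n) t - w t"] by simp
        then show "cmod ((u (r m) - u (r n)) t) \<le> sqrt e / 2"
          using N[OF mn(1) t] N[OF mn(2) t] by simp
      qed
      also have "\<dots> < e" using e by (simp add: power_divide)
      finally show ?thesis .
    qed
    then show "\<exists>N. \<forall>m\<ge>N. \<forall>n\<ge>N. E.sq (u (r m) - u (r n)) < e" by blast
  qed
  then show ?thesis using r by blast
qed

section \<open>A positive operator that removes the boundary values\<close>

definition ext01 :: "(real \<Rightarrow> 'b::zero) \<Rightarrow> real \<Rightarrow> 'b" where
  "ext01 f x = (if x \<in> {0..1} then f x else 0)"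

text \<open>\<open>k'\<close> is \<open>k\<close> after the substitution \<open>b + a * x\<close>,
  including the places where this leaves the interval. With zero extensions, scalings and the
  reflection all reduce to one affine change of variables on the line.\<close>

definition affine_image :: "real \<Rightarrow> real \<Rightarrow> (real \<Rightarrow> 'b::zero) \<Rightarrow> (real \<Rightarrow> 'b) \<Rightarrow> bool" where
  "affine_image a b k k' \<longleftrightarrow> (\<forall>x. ext01 k' x = ext01 k (b + a * x))"

lemma integrable_ext01:
  fixes k :: "real \<Rightarrow> 'b::euclidean_space"
  shows "integrable lebesgue (ext01 k) \<longleftrightarrow> integrable I01 k"
  unfolding ext01_def[abs_def] by (rule Lebesgue_Measure.integrable_restrict_UNIV) simp

lemma integral_ext01:
  fixes k :: "real \<Rightarrow> 'b::euclidean_space"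
  shows "integral\<^sup>L lebesgue (ext01 k) = integral\<^sup>L I01 k"
  unfolding ext01_def[abs_def] by (rule Lebesgue_Measure.integral_restrict_UNIV) simp

lemma affine_image_integral:
  fixes k k' :: "real \<Rightarrow> 'b::euclidean_space"
  assumes k: "integrable I01 k" and a: "a \<noteq> 0" and aff: "affine_image a b k k'"
  shows "integrable I01 k'" and "integral\<^sup>L I01 k' = integral\<^sup>L I01 k /\<^sub>R \<bar>a\<bar>"
proof -
  have eq: "ext01 k' = (\<lambda>x. ext01 k (b + a * x))" using aff by (auto simp: affine_image_def)
  have "integrable lebesgue (ext01 k)" using k by (simp add: integrable_ext01)
  from lebesgue_integrable_real_affine[OF this a, of b] show "integrable I01 k'"
    by (simp add: integrable_ext01 flip: eq)
  show "integral\<^sup>L I01 k' = integral\<^sup>L I01 k /\<^sub>R \<bar>a\<bar>"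
    using lebesgue_integral_real_affine[OF a, of "ext01 k" b] a
    by (simp add: integral_ext01 flip: eq)
qed

lemma affine_image_measurable:
  fixes k k' :: "real \<Rightarrow> complex"
  assumes k: "k \<in> borel_measurable I01" and a: "a \<noteq> 0" and aff: "affine_image a b k k'"
  shows "k' \<in> borel_measurable I01"
proof -
  have eq: "ext01 k' = (\<lambda>x. ext01 k (b + a * x))" using aff by (auto simp: affine_image_def)
  have "ext01 k \<in> borel_measurable lebesgue"
    using k unfolding ext01_def[abs_def] by (subst borel_measurable_if) auto
  moreover have "(\<lambda>x. b + a * x) \<in> lebesgue \<rightarrow>\<^sub>M lebesgue"
    using lebesgue_affine_measurable[where c= "\<lambda>x::real. a" and t=b] a by simp
  ultimately have "ext01 k' \<in> borel_measurable lebesgue"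
    unfolding eq using measurable_compose by blast
  then show ?thesis
    unfolding ext01_def[abs_def] by (subst (asm) borel_measurable_if) auto
qed

lemma affine_image_L2:
  assumes k: "L2_edge k" and a: "a \<noteq> 0" and aff: "affine_image a b k k'"
  shows "L2_edge k'" and "E.sq k' = E.sq k / \<bar>a\<bar>"
proof -
  have "affine_image a b (\<lambda>t. (cmod (k t))\<^sup>2) (\<lambda>t. (cmod (k' t))\<^sup>2)"
    unfolding affine_image_def
  proof
    fix x
    have "(cmod (ext01 k' x))\<^sup>2 = (cmod (ext01 k (b + a * x)))\<^sup>2" using aff by (simp add: affine_image_def)
    then show "ext01 (\<lambda>t. (cmod (k' t))\<^sup>2) x = ext01 (\<lambda>t. (cmod (k t))\<^sup>2) (b + a * x)"
      by (auto simp: ext01_def split: if_splits)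
  qed
  note * = affine_image_integral[OF _ a this]
  show "L2_edge k'" using k affine_image_measurable[OF _ a aff] *(1) by (simp add: L2_edge_def)
  show "E.sq k' = E.sq k / \<bar>a\<bar>" using k *(2) by (simp add: E_sq L2_edge_def divide_inverse)
qed

definition compress :: "(real \<Rightarrow> complex) \<Rightarrow> real \<Rightarrow> complex" where
  "compress f t = (if t \<le> 1 / 16 then f (16 * t) else 0)"

definition dilate :: "(real \<Rightarrow> complex) \<Rightarrow> real \<Rightarrow> complex" where
  "dilate f t = f (t / 16)"

definition reflect :: "(real \<Rightarrow> complex) \<Rightarrow> real \<Rightarrow> complex" where
  "reflect f t = f (1 - t)"

lemma affine_image_compress: "affine_image 16 0 f (compress f)"
  by (auto simp: affine_image_def ext01_def compress_def)

text \<open>\<open>dilate f\<close> sees \<open>f\<close> only up to \<open>1/16\<close>; truncating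
  there makes the zero extensions match.\<close>

lemma affine_image_dilate: "affine_image (1/16) 0 (\<lambda>t. if t \<le> 1/16 then f t else 0) (dilate f)"
  by (auto simp: affine_image_def ext01_def dilate_def)

lemma affine_image_reflect: "affine_image (-1) 1 f (reflect f)"
  by (auto simp: affine_image_def ext01_def reflect_def)

lemma L2_compress: "L2_edge f \<Longrightarrow> L2_edge (compress f)"
  and sq_compress: "L2_edge f \<Longrightarrow> E.sq (compress f) = E.sq f / 16"
  using affine_image_L2[OF _ _ affine_image_compress, of f] by auto

lemma L2_reflect: "L2_edge f \<Longrightarrow> L2_edge (reflect f)"
  and sq_reflect: "L2_edge f \<Longrightarrow> E.sq (reflect f) = E.sq f"
  using affine_image_L2[OF _ _ affine_image_reflect, of f] by auto

lemma sq_bounded_mult_le: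
  assumes f: "L2_edge f" and b: "b \<in> borel_measurable I01" "\<And>t. t \<in> {0..1} \<Longrightarrow> cmod (b t) \<le> 1"
  shows "L2_edge (\<lambda>t. b t * f t)" and "E.sq (\<lambda>t. b t * f t) \<le> E.sq f"
proof -
  show L2: "L2_edge (\<lambda>t. b t * f t)"
    using b by (intro L2_edge_bounded_mult[OF f, of _ 1] AE_I2) auto
  show "E.sq (\<lambda>t. b t * f t) \<le> E.sq f"
    unfolding E_sq
  proof (rule integral_mono)
    fix t assume "t \<in> space I01"
    then have "cmod (b t) * cmod (f t) \<le> 1 * cmod (f t)" using b(2)[of t] by (intro mult_right_mono) auto
    then show "(cmod (b t * f t))\<^sup>2 \<le> (cmod (f t))\<^sup>2" by (intro power_mono) (auto simp: norm_mult)
  qed (use f L2 in \<open>auto simp: L2_edge_def\<close>)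
qed

lemma truncate_L2:
  assumes "L2_edge f"
  shows "L2_edge (\<lambda>t. if t \<le> 1/16 then f t else 0)" and "E.sq (\<lambda>t. if t \<le> 1/16 then f t else 0) \<le> E.sq f"
proof -
  have eq: "(\<lambda>t. if t \<le> 1/16 then f t else 0) = (\<lambda>t. (if t \<le> 1/16 then 1 else 0) * f t)" by auto
  have m: "(\<lambda>t::real. if t \<le> 1/16 then 1 else 0 :: complex) \<in> borel_measurable I01" by measurable
  show "L2_edge (\<lambda>t. if t \<le> 1/16 then f t else 0)" "E.sq (\<lambda>t. if t \<le> 1/16 then f t else 0) \<le> E.sq f"
    unfolding eq using sq_bounded_mult_le[OF assms m] by auto
qed

lemma L2_dilate: "L2_edge f \<Longrightarrow> L2_edge (dilate f)"
  and sq_dilate: "L2_edge f \<Longrightarrow> E.sq (dilate f) \<le> 16 * E.sq f"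
  using affine_image_L2[OF truncate_L2(1) _ affine_image_dilate, of f] truncate_L2(2)[of f] by auto

lemma ac_reflect:
  assumes f: "has_ac_deriv f g"
  shows "has_ac_deriv (reflect f) (\<lambda>t. - reflect g t)"
proof (rule ac_derivI)
  note g = ac_derivD(1)[OF f]
  show "integrable I01 (\<lambda>t. - reflect g t)"
    using affine_image_integral(1)[OF g _ affine_image_reflect] by simp
  fix t :: real assume t: "t \<in> {0..1}"
  define k where "k x = (if 1 - x \<le> t then g x else 0)" for x
  have k: "integrable I01 k" unfolding k_def[abs_def] using sets_I01_upto(2)[of "1 - t"]
    by (intro integrable_if_I01 g) (simp add: algebra_simps)
  have "(LINT x|I01. (if x \<le> t then - reflect g x else 0)) = (LINT x|I01. - reflect k x)"
    by (intro Bochner_Integration.integral_cong) (auto simp: k_def reflect_def)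
  also have "\<dots> = - integral\<^sup>L I01 k"
    using affine_image_integral[OF k _ affine_image_reflect] by simp
  also have "integral\<^sup>L I01 k = integral\<^sup>L I01 g - (LINT x|I01. (if x \<le> 1 - t then g x else 0))"
  proof -
    have "integral\<^sup>L I01 k = (LINT x|I01. g x - (if x \<le> 1 - t then g x else 0))"
    proof (rule integral_cong_AE)
      show "k \<in> borel_measurable I01" using k by auto
      show "(\<lambda>x. g x - (if x \<le> 1 - t then g x else 0)) \<in> borel_measurable I01"
        using g integrable_upto[OF g] by (intro borel_measurable_diff) auto
      show "AE x in I01. k x = g x - (if x \<le> 1 - t then g x else 0)"
        using AE_I01_neq[of "1 - t"] by (rule eventually_mono) (auto simp: k_def)
    qed
    also have "\<dots> = integral\<^sup>L I01 g - (LINT x|I01. (if x \<le> 1 - t then g x else 0))"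
      by (intro Bochner_Integration.integral_diff integrable_upto g)
    finally show ?thesis .
  qed
  also have "integral\<^sup>L I01 g = (LINT x|I01. (if x \<le> 1 then g x else 0))"
    by (intro Bochner_Integration.integral_cong) auto
  finally show "reflect f t = reflect f 0 + (LINT x|I01. (if x \<le> t then - reflect g x else 0))"
    using ac_derivD(2)[OF f, of 1] ac_derivD(2)[OF f, of "1 - t"] t by (simp add: reflect_def)
qed

text \<open>\<open>w 1 = 0\<close> closes the gap at \<open>1/16\<close>, where
  \<open>compress w\<close> would otherwise jump to 0.\<close>

lemma ac_compress:
  assumes w: "has_ac_deriv w m" and w1: "w 1 = 0"
  shows "has_ac_deriv (compress w) (\<lambda>t. 16 * compress m t)"
proof (rule ac_derivI)
  note m = ac_derivD(1)[OF w]
  show "integrable I01 (\<lambda>t. 16 * compress m t)"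
    using affine_image_integral(1)[OF m _ affine_image_compress] by simp
  fix t :: real assume t: "t \<in> {0..1}"
  \<comment> \<open>The point of the original interval that corresponds to \<open>t\<close>; beyond
    \<open>1/16\<close> it stays at 1.\<close>
  define s where "s = min (16 * t) 1"
  have s: "s \<in> {0..1}" using t by (auto simp: s_def)
  define k where "k x = (if x \<le> s then m x else 0)" for x
  have k: "integrable I01 k" unfolding k_def[abs_def] by (rule integrable_upto[OF m])
  have "(LINT x|I01. (if x \<le> t then 16 * compress m x else 0)) = (LINT x|I01. 16 * compress k x)"
    by (intro Bochner_Integration.integral_cong) (auto simp: k_def compress_def s_def)
  also have "\<dots> = integral\<^sup>L I01 k"
    using affine_image_integral[OF k _ affine_image_compress] by (simp add: scaleR_conv_of_real mult.commute)
  also have "\<dots> = w s - w 0" using ac_derivD(2)[OF w s] by (simp add: k_def[abs_def])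
  also have "w s = compress w t" using t w1 by (auto simp: compress_def s_def min_def)
  finally show "compress w t = compress w 0 + (LINT x|I01. (if x \<le> t then 16 * compress m x else 0))"
    by (simp add: compress_def)
qed

lemma ac_dilate:
  assumes f: "has_ac_deriv f g"
  shows "has_ac_deriv (dilate f) (\<lambda>t. 1 / 16 * dilate g t)"
proof (rule ac_derivI)
  note g = ac_derivD(1)[OF f]
  show "integrable I01 (\<lambda>t. 1 / 16 * dilate g t)"
    using affine_image_integral(1)[OF integrable_upto[OF g] _ affine_image_dilate] by simp
  fix t :: real assume t: "t \<in> {0..1}"
  define k where "k x = (if x \<le> t / 16 then g x else 0)" for x
  have k: "integrable I01 k" unfolding k_def[abs_def] by (rule integrable_upto[OF g])
  have k': "(\<lambda>x. if x \<le> 1/16 then k x else 0) = k" using t by (auto simp: k_def)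
  have "(LINT x|I01. (if x \<le> t then 1 / 16 * dilate g x else 0)) = (LINT x|I01. 1 / 16 * dilate k x)"
    by (intro Bochner_Integration.integral_cong) (auto simp: k_def dilate_def)
  also have "\<dots> = integral\<^sup>L I01 k"
    using affine_image_integral[OF integrable_upto[OF k] _ affine_image_dilate, unfolded k']
    by (simp add: scaleR_conv_of_real mult.commute)
  also have "\<dots> = f (t / 16) - f 0" using ac_derivD(2)[OF f, of "t / 16"] t by (simp add: k_def[abs_def])
  finally show "dilate f t = dilate f 0 + (LINT x|I01. (if x \<le> t then 1 / 16 * dilate g x else 0))"
    by (simp add: dilate_def)
qed

text \<open>The factor \<open>1 - t\<close> removes the value at 1 and keeps the one at 0. Hence
  compression stays within absolutely continuous functions, and corrections at one end do not
  disturb the other.\<close>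

definition taper :: "(real \<Rightarrow> complex) \<Rightarrow> real \<Rightarrow> complex" where
  "taper f t = of_real (1 - t) * f t"

lemma L2_taper: "L2_edge f \<Longrightarrow> L2_edge (taper f)"
  and sq_taper: "L2_edge f \<Longrightarrow> E.sq (taper f) \<le> E.sq f"
proof -
  have m: "(\<lambda>t. complex_of_real (1 - t)) \<in> borel_measurable I01" by measurable
  show "L2_edge f \<Longrightarrow> L2_edge (taper f)" "L2_edge f \<Longrightarrow> E.sq (taper f) \<le> E.sq f"
    using sq_bounded_mult_le[OF _ m, of f] unfolding taper_def[abs_def]
    by (auto simp: norm_of_real simp del: of_real_diff)
qed

lemma ac_taper:
  assumes f: "has_ac_deriv f g"
  shows "has_ac_deriv (taper f) (\<lambda>t. taper g t - f t)"
proof -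
  have "has_ac_deriv (\<lambda>t. (1 - of_real t) * f t) (\<lambda>t. (0 - 1) * f t + (1 - of_real t) * g t)"
    by (intro ac_mult ac_diff ac_const ac_ident f)
  then show ?thesis by (simp add: taper_def[abs_def] algebra_simps)
qed

text \<open>Compression divides the squared norm by 16, so 4 is the largest factor for which this
  estimate still gives a contraction.\<close>

definition squeeze :: "(real \<Rightarrow> complex) \<Rightarrow> real \<Rightarrow> complex" where
  "squeeze f = escale 4 (compress (taper f))"

definition squeeze_adj :: "(real \<Rightarrow> complex) \<Rightarrow> real \<Rightarrow> complex" where
  "squeeze_adj f = escale (1/4) (taper (dilate f))"

lemma L2_squeeze: "L2_edge f \<Longrightarrow> L2_edge (squeeze f)"
  unfolding squeeze_def using E.V_scale[of "compress (taper f)" 4] by (simp add: L2_compress L2_taper)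

lemma L2_squeeze_adj: "L2_edge f \<Longrightarrow> L2_edge (squeeze_adj f)"
  unfolding squeeze_adj_def using E.V_scale[of "taper (dilate f)" "1/4"] by (simp add: L2_dilate L2_taper)

lemma nrm_squeeze: "L2_edge f \<Longrightarrow> E.nrm (squeeze f) \<le> E.nrm f"
  using E.sq_scale[of "compress (taper f)" 4] sq_taper[of f]
  by (simp add: E.nrm_def squeeze_def L2_compress L2_taper sq_compress)

lemma nrm_squeeze_adj: "L2_edge f \<Longrightarrow> E.nrm (squeeze_adj f) \<le> E.nrm f"
  using E.sq_scale[of "taper (dilate f)" "1/4"] sq_taper[of "dilate f"] sq_dilate[of f]
  by (simp add: E.nrm_def squeeze_adj_def L2_dilate L2_taper power2_eq_square)

lemma nrm_reflect: "L2_edge f \<Longrightarrow> E.nrm (reflect f) = E.nrm f"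
  by (simp add: E.nrm_def sq_reflect)

text \<open>Rescaling by 16 turns the factor 4 into \<open>4/16 = 1/4\<close>; the weight of
  \<open>taper\<close> is real and moves to the other argument.\<close>

lemma eip_squeeze:
  assumes f: "L2_edge f" and g: "L2_edge g"
  shows "eip (squeeze f) g = eip f (squeeze_adj g)"
proof -
  define k where "k t = taper f t * cnj (dilate g t)" for t
  have k: "integrable I01 k"
    unfolding k_def[abs_def] by (intro L2_edge_integrable_eip L2_taper L2_dilate f g)
  have "eip (squeeze f) g = (LINT t|I01. 4 * compress k t)"
    unfolding eip_def
    by (intro Bochner_Integration.integral_cong) (auto simp: squeeze_def escale_def compress_def k_def dilate_def)
  also have "\<dots> = (LINT t|I01. 1/4 * k t)"
    using affine_image_integral[OF k _ affine_image_compress] by (simp add: scaleR_conv_of_real mult.commute)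
  also have "\<dots> = eip f (squeeze_adj g)"
    unfolding eip_def
    by (intro Bochner_Integration.integral_cong) (auto simp: squeeze_adj_def escale_def taper_def k_def)
  finally show ?thesis .
qed

lemma eip_reflect:
  assumes f: "L2_edge f" and g: "L2_edge g"
  shows "eip (reflect f) g = eip f (reflect g)"
proof -
  have k: "integrable I01 (\<lambda>t. f t * cnj (reflect g t))"
    by (intro L2_edge_integrable_eip L2_reflect f g)
  have "reflect (\<lambda>t. f t * cnj (reflect g t)) = (\<lambda>t. reflect f t * cnj (g t))"
    by (auto simp: reflect_def)
  then show ?thesis
    unfolding eip_def using affine_image_integral(2)[OF k _ affine_image_reflect] by simp
qed

text \<open>The constant \<open>4/17\<close> is \<open>1/(4 + 1/4)\<close>, where \<open>4\<close> and \<open>1/4\<close> are the factors by which the scaling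
  operators \<open>squeeze\<close> and \<open>squeeze_adj\<close> change the value at \<open>0\<close>.\<close>

definition vanish_op :: "(real \<Rightarrow> complex) \<Rightarrow> real \<Rightarrow> complex" where
  "vanish_op f = f - escale (4/17) (squeeze f + squeeze_adj f + reflect (squeeze (reflect f)) + reflect (squeeze_adj (reflect f)))"

text \<open>At 0 the two direct terms add up to \<open>4 + 1/4 = 17/4\<close> times the value there,
  and the two reflected terms contribute nothing, since compressed and tapered functions vanish at
  1. The other end is symmetric.\<close>

lemma vanish_op_ends: "vanish_op f 0 = 0" "vanish_op f 1 = 0"
  by (simp_all add: vanish_op_def escale_def squeeze_def squeeze_adj_def compress_def taper_def dilate_def reflect_def)

lemmas L2_vanish_op_parts = L2_squeeze L2_squeeze_adj L2_reflect

lemma L2_vanish_op: "L2_edge f \<Longrightarrow> L2_edge (vanish_op f)"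
proof -
  assume f: "L2_edge f"
  have "vanish_op f \<in> Collect L2_edge"
    unfolding vanish_op_def using f by (intro E.V_diff E.V_scale E.V_add) (auto intro: L2_vanish_op_parts)
  then show ?thesis by simp
qed

lemma nrm_vanish_op: "L2_edge f \<Longrightarrow> E.nrm (vanish_op f) \<le> 2 * E.nrm f"
proof -
  assume f: "L2_edge f"
  let ?s = "squeeze f + squeeze_adj f + reflect (squeeze (reflect f)) + reflect (squeeze_adj (reflect f))"
  have V: "squeeze f \<in> Collect L2_edge" "squeeze_adj f \<in> Collect L2_edge"
    "reflect (squeeze (reflect f)) \<in> Collect L2_edge" "reflect (squeeze_adj (reflect f)) \<in> Collect L2_edge"
    using f by (auto intro: L2_vanish_op_parts)
  have "E.nrm ?s \<le> E.nrm (squeeze f) + E.nrm (squeeze_adj f) + E.nrm (reflect (squeeze (reflect f)))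
      + E.nrm (reflect (squeeze_adj (reflect f)))"
    using E.nrm_triangle[of "squeeze f" "squeeze_adj f"] E.nrm_triangle[of "squeeze f + squeeze_adj f" "reflect (squeeze (reflect f))"]
      E.nrm_triangle[of "squeeze f + squeeze_adj f + reflect (squeeze (reflect f))" "reflect (squeeze_adj (reflect f))"]
      E.V_add[OF E.V_add[OF V(1,2)] V(3)] E.V_add[OF V(1,2)] V by linarith
  also have "\<dots> \<le> E.nrm f + E.nrm f + E.nrm f + E.nrm f"
    using nrm_squeeze[OF f] nrm_squeeze_adj[OF f] nrm_squeeze[OF L2_reflect[OF f]] nrm_squeeze_adj[OF L2_reflect[OF f]]
    by (simp add: nrm_reflect f L2_vanish_op_parts)
  finally have s: "E.nrm ?s \<le> 4 * E.nrm f" by simp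
  have sV: "?s \<in> Collect L2_edge" by (intro E.V_add V)
  have "E.nrm (vanish_op f) \<le> E.nrm f + E.nrm (escale (4/17) ?s)"
    unfolding vanish_op_def using f sV by (intro E.nrm_triangle_diff E.V_scale) auto
  also have "E.nrm (escale (4/17) ?s) = 4/17 * E.nrm ?s"
    using sV by (simp add: E.nrm_def E.sq_scale real_sqrt_mult del: mem_Collect_eq)
  also have "E.nrm f + 4/17 * E.nrm ?s \<le> 2 * E.nrm f"
  proof -
    have "0 \<le> E.nrm f" using f by simp
    then show ?thesis using s by linarith
  qed
  finally show ?thesis .
qed

lemma eip_vanish_op:
  assumes f: "L2_edge f" and g: "L2_edge g"
  shows "eip (vanish_op f) g = eip f g - 4/17 * (eip (squeeze f) g + eip (squeeze_adj f) g
     + eip (reflect (squeeze (reflect f))) g + eip (reflect (squeeze_adj (reflect f))) g)"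
proof -
  have V: "f \<in> Collect L2_edge" "g \<in> Collect L2_edge" "squeeze f \<in> Collect L2_edge" "squeeze_adj f \<in> Collect L2_edge"
    "reflect (squeeze (reflect f)) \<in> Collect L2_edge" "reflect (squeeze_adj (reflect f)) \<in> Collect L2_edge"
    using f g by (auto intro: L2_vanish_op_parts)
  show ?thesis
    unfolding vanish_op_def using V
    by (simp only: E.diff_left E.scale_left E.add_left E.V_add E.V_scale)
qed

lemma eip_squeeze_adj:
  assumes f: "L2_edge f" and g: "L2_edge g"
  shows "eip (squeeze_adj f) g = eip f (squeeze g)"
  using eip_squeeze[OF g f] E.herm[of "squeeze g" f] E.herm[of g "squeeze_adj f"] f g by (simp add: L2_vanish_op_parts)

text \<open>The four subtracted terms form two adjoint pairs, and \<open>reflect\<close> is its own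
  adjoint.\<close>

lemma vanish_op_symmetric:
  assumes f: "L2_edge f" and g: "L2_edge g"
  shows "eip (vanish_op f) g = eip f (vanish_op g)"
proof -
  have V: "f \<in> Collect L2_edge" "vanish_op g \<in> Collect L2_edge" using f g L2_vanish_op by auto
  have "eip f (vanish_op g) = cnj (eip (vanish_op g) f)" using E.herm[OF V(2,1)] .
  also have "\<dots> = eip f g - 4/17 * (eip f (squeeze g) + eip f (squeeze_adj g)
     + eip f (reflect (squeeze (reflect g))) + eip f (reflect (squeeze_adj (reflect g))))"
    unfolding eip_vanish_op[OF g f] using f g
    by (simp add: L2_vanish_op_parts E.herm[of f g] E.herm[of f "squeeze g"] E.herm[of f "squeeze_adj g"]
       E.herm[of f "reflect (squeeze (reflect g))"] E.herm[of f "reflect (squeeze_adj (reflect g))"])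
  also have "\<dots> = eip (vanish_op f) g"
    unfolding eip_vanish_op[OF f g] using f g
    by (simp add: eip_squeeze eip_squeeze_adj eip_reflect L2_vanish_op_parts)
  finally show ?thesis by simp
qed

text \<open>Each of the four terms is a contraction, so at most \<open>4 * 4/17 = 16/17\<close> of
  \<open>E.sq f\<close> is subtracted.\<close>

lemma vanish_op_positive:
  assumes f: "L2_edge f"
  shows "E.sq f / 17 \<le> Re (eip (vanish_op f) f)"
proof -
  have fV: "f \<in> Collect L2_edge" using f by simp
  have bd: "Re (eip h f) \<le> E.sq f" if h: "L2_edge h" "E.nrm h \<le> E.nrm f" for h
  proof -
    have "Re (eip h f) \<le> E.nrm h * E.nrm f"
      using order_trans[OF complex_Re_le_cmod E.Cauchy_Schwarz[of h f]] h f by simp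
    also have "\<dots> \<le> E.nrm f * E.nrm f" using h E.nrm_nonneg[OF fV] by (intro mult_right_mono)
    also have "\<dots> = E.sq f" using E.nrm_power2[OF fV] by (simp add: power2_eq_square)
    finally show ?thesis .
  qed
  have 1: "Re (eip (squeeze f) f) \<le> E.sq f" by (rule bd[OF L2_squeeze[OF f] nrm_squeeze[OF f]])
  have 2: "Re (eip (squeeze_adj f) f) \<le> E.sq f" by (rule bd[OF L2_squeeze_adj[OF f] nrm_squeeze_adj[OF f]])
  have 3: "Re (eip (reflect (squeeze (reflect f))) f) \<le> E.sq f"
    using nrm_squeeze[OF L2_reflect[OF f]] by (intro bd) (simp_all add: f L2_vanish_op_parts nrm_reflect)
  have 4: "Re (eip (reflect (squeeze_adj (reflect f))) f) \<le> E.sq f"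
    using nrm_squeeze_adj[OF L2_reflect[OF f]] by (intro bd) (simp_all add: f L2_vanish_op_parts nrm_reflect)
  have "Re (eip (vanish_op f) f) = E.sq f - 4/17 * (Re (eip (squeeze f) f) + Re (eip (squeeze_adj f) f)
     + Re (eip (reflect (squeeze (reflect f))) f) + Re (eip (reflect (squeeze_adj (reflect f))) f))"
    unfolding eip_vanish_op[OF f f] by (simp add: E.sq_def)
  moreover have "Re (eip (squeeze f) f) + Re (eip (squeeze_adj f) f)
     + Re (eip (reflect (squeeze (reflect f))) f) + Re (eip (reflect (squeeze_adj (reflect f))) f) \<le> 4 * E.sq f"
    using 1 2 3 4 by linarith
  ultimately show ?thesis by (simp only:) (simp add: field_simps)
qed

lemma nrm_escale: "L2_edge f \<Longrightarrow> E.nrm (escale c f) = cmod c * E.nrm f"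
  by (simp add: E.nrm_def E.sq_scale real_sqrt_mult)

lemma ac_squeeze:
  assumes f: "has_ac_deriv f g" and g: "L2_edge g"
  shows "\<exists>h. has_ac_deriv (squeeze f) h \<and> L2_edge h \<and> E.nrm h \<le> 16 * (E.nrm f + E.nrm g)"
proof -
  have L2f: "L2_edge f" by (rule continuous_imp_L2_edge[OF ac_continuous[OF f]])
  let ?m = "taper g - f"
  have V: "taper g \<in> Collect L2_edge" "f \<in> Collect L2_edge" using L2f g L2_taper by auto
  have m: "L2_edge ?m" using E.V_diff[OF V] by simp
  have ac: "has_ac_deriv (taper f) ?m" using ac_taper[OF f] by (simp add: fun_diff_def)
  \<comment> \<open>64 is the 4 of \<open>squeeze\<close> times 16 from the chain rule; compression
    divides the norm by 4, which leaves the 16 of the bound.\<close>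
  have "has_ac_deriv (squeeze f) (escale 64 (compress ?m))"
    unfolding squeeze_def using ac_scale[OF ac_compress[OF ac], of 4]
    by (simp add: escale_def mult.assoc[symmetric] taper_def)
  moreover have "L2_edge (escale 64 (compress ?m))"
    using E.V_scale[of "compress ?m" 64] m by (simp add: L2_compress)
  moreover have "E.nrm (escale 64 (compress ?m)) \<le> 16 * (E.nrm f + E.nrm g)"
  proof -
    have "E.nrm (compress ?m) = E.nrm ?m / 4"
      using m by (simp add: E.nrm_def sq_compress real_sqrt_divide)
    moreover have "E.nrm ?m \<le> E.nrm (taper g) + E.nrm f" by (rule E.nrm_triangle_diff[OF V])
    moreover have "E.nrm (taper g) \<le> E.nrm g" using sq_taper[OF g] by (simp add: E.nrm_def)
    ultimately show ?thesis using m by (simp add: nrm_escale L2_compress)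
  qed
  ultimately show ?thesis by blast
qed

lemma ac_squeeze_adj:
  assumes f: "has_ac_deriv f g" and g: "L2_edge g"
  shows "\<exists>h. has_ac_deriv (squeeze_adj f) h \<and> L2_edge h \<and> E.nrm h \<le> E.nrm f + E.nrm g"
proof -
  have L2f: "L2_edge f" by (rule continuous_imp_L2_edge[OF ac_continuous[OF f]])
  let ?m = "taper (escale (1/16) (dilate g)) - dilate f"
  have dg: "L2_edge (escale (1/16) (dilate g))"
    using E.V_scale[of "dilate g" "1/16"] g by (simp add: L2_dilate)
  have V: "taper (escale (1/16) (dilate g)) \<in> Collect L2_edge" "dilate f \<in> Collect L2_edge"
    using L2_taper[OF dg] L2_dilate[OF L2f] by auto
  have m: "L2_edge ?m" using E.V_diff[OF V] by simp
  have "has_ac_deriv (taper (dilate f)) ?m"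
    using ac_taper[OF ac_dilate[OF f]] by (simp add: fun_diff_def escale_def)
  from ac_scale[OF this, of "1/4"] have "has_ac_deriv (squeeze_adj f) (escale (1/4) ?m)"
    by (simp add: squeeze_adj_def escale_def)
  moreover have "L2_edge (escale (1/4) ?m)" using E.V_scale[of ?m "1/4"] m by simp
  moreover have "E.nrm (escale (1/4) ?m) \<le> E.nrm f + E.nrm g"
  proof -
    have d: "E.nrm (dilate h) \<le> 4 * E.nrm h" if "L2_edge h" for h
      using real_sqrt_le_mono[OF sq_dilate[OF that]] by (simp add: E.nrm_def real_sqrt_mult)
    have "E.nrm ?m \<le> E.nrm (taper (escale (1/16) (dilate g))) + E.nrm (dilate f)"
      by (rule E.nrm_triangle_diff[OF V])
    moreover have "E.nrm (taper (escale (1/16) (dilate g))) \<le> E.nrm (escale (1/16) (dilate g))"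
      using sq_taper[OF dg] by (simp add: E.nrm_def)
    moreover have "E.nrm (escale (1/16) (dilate g)) = E.nrm (dilate g) / 16"
      using g by (simp add: nrm_escale L2_dilate)
    ultimately have "E.nrm ?m \<le> E.nrm (dilate g) / 16 + E.nrm (dilate f)" by linarith
    then have "E.nrm ?m \<le> E.nrm g / 4 + 4 * E.nrm f" using d[OF g] d[OF L2f] by simp
    moreover have "0 \<le> E.nrm g" using g by simp
    ultimately show ?thesis using m by (simp add: nrm_escale)
  qed
  ultimately show ?thesis by blast
qed

text \<open>Boundedness in the Sobolev norm. The constant is
  \<open>1 + 4/17 * (16 + 1 + 16 + 1) = 9\<close>; smallness is needed only in L2, here a finite
  bound is enough.\<close>

lemma ac_vanish_op:
  assumes f: "has_ac_deriv f g" and g: "L2_edge g"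
  shows "\<exists>h. has_ac_deriv (vanish_op f) h \<and> L2_edge h \<and> E.nrm h \<le> 9 * (E.nrm f + E.nrm g)"
proof -
  have L2f: "L2_edge f" by (rule continuous_imp_L2_edge[OF ac_continuous[OF f]])
  let ?N = "E.nrm f + E.nrm g"
  have refl_deriv: "\<exists>h. has_ac_deriv (reflect u) h \<and> L2_edge h \<and> E.nrm h \<le> B"
    if ex: "\<exists>h. has_ac_deriv u h \<and> L2_edge h \<and> E.nrm h \<le> B" for u B
  proof -
    obtain h where h: "has_ac_deriv u h" "L2_edge h" "E.nrm h \<le> B" using ex by blast
    have eq: "(\<lambda>t. - reflect h t) = escale (-1) (reflect h)" by (simp add: escale_def)
    have L2: "L2_edge (escale (-1) (reflect h))"
      using E.V_scale[of "reflect h" "-1"] h by (simp add: L2_reflect)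
    show ?thesis using ac_reflect[OF h(1)] h L2 nrm_escale[OF L2_reflect[OF h(2)], of "-1"] unfolding eq
      by (intro exI[of _ "escale (-1) (reflect h)"]) (simp add: nrm_escale L2_reflect nrm_reflect)
  qed
  obtain h1 where h1: "has_ac_deriv (squeeze f) h1" "L2_edge h1" "E.nrm h1 \<le> 16 * ?N"
    using ac_squeeze[OF f g] by blast
  obtain h2 where h2: "has_ac_deriv (squeeze_adj f) h2" "L2_edge h2" "E.nrm h2 \<le> ?N"
    using ac_squeeze_adj[OF f g] by blast
  have rf: "has_ac_deriv (reflect f) (\<lambda>t. - reflect g t)" by (rule ac_reflect[OF f])
  have eq: "(\<lambda>t. - reflect g t) = escale (-1) (reflect g)" by (simp add: escale_def)
  have rg: "L2_edge (\<lambda>t. - reflect g t)"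
    unfolding eq using E.V_scale[of "reflect g" "-1"] g by (simp add: L2_reflect)
  have nr: "E.nrm (reflect f) + E.nrm (\<lambda>t. - reflect g t) = ?N"
    unfolding eq using g L2f nrm_escale[OF L2_reflect[OF g], of "-1"]
    by (simp add: nrm_escale L2_reflect nrm_reflect)
  obtain h3 where h3: "has_ac_deriv (reflect (squeeze (reflect f))) h3" "L2_edge h3" "E.nrm h3 \<le> 16 * ?N"
    using refl_deriv[OF ac_squeeze[OF rf rg]] unfolding nr by blast
  obtain h4 where h4: "has_ac_deriv (reflect (squeeze_adj (reflect f))) h4" "L2_edge h4" "E.nrm h4 \<le> ?N"
    using refl_deriv[OF ac_squeeze_adj[OF rf rg]] unfolding nr by blast
  let ?s = "h1 + h2 + h3 + h4"
  have V: "h1 \<in> Collect L2_edge" "h2 \<in> Collect L2_edge" "h3 \<in> Collect L2_edge" "h4 \<in> Collect L2_edge"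
    "g \<in> Collect L2_edge"
    using h1 h2 h3 h4 g by auto
  have sV: "?s \<in> Collect L2_edge" by (intro E.V_add V)
  have "E.nrm ?s \<le> E.nrm h1 + E.nrm h2 + E.nrm h3 + E.nrm h4"
    using E.nrm_triangle[of h1 h2] E.nrm_triangle[of "h1 + h2" h3] E.nrm_triangle[of "h1 + h2 + h3" h4]
      E.V_add[OF E.V_add[OF V(1,2)] V(3)] E.V_add[OF V(1,2)] V by linarith
  also have "\<dots> \<le> 16 * ?N + ?N + 16 * ?N + ?N" by (intro add_mono h1 h2 h3 h4)
  finally have s: "E.nrm ?s \<le> 34 * ?N" by (simp add: algebra_simps)
  have "has_ac_deriv (vanish_op f) (g - escale (4/17) ?s)"
  proof -
    have "has_ac_deriv (\<lambda>t. f t - (4/17) * (squeeze f t + squeeze_adj f t + reflect (squeeze (reflect f)) t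
        + reflect (squeeze_adj (reflect f)) t)) (\<lambda>t. g t - (4/17) * (h1 t + h2 t + h3 t + h4 t))"
      by (intro ac_diff ac_scale ac_add f h1 h2 h3 h4)
    then show ?thesis by (simp add: vanish_op_def fun_diff_def plus_fun_def escale_def)
  qed
  moreover have "L2_edge (g - escale (4/17) ?s)" using E.V_diff[OF V(5) E.V_scale[OF sV]] by simp
  moreover have "E.nrm (g - escale (4/17) ?s) \<le> 9 * ?N"
  proof -
    have "E.nrm (g - escale (4/17) ?s) \<le> E.nrm g + E.nrm (escale (4/17) ?s)"
      by (rule E.nrm_triangle_diff[OF V(5) E.V_scale[OF sV]])
    also have "E.nrm (escale (4/17) ?s) = 4/17 * E.nrm ?s" using sV by (subst nrm_escale) auto
    also have "E.nrm g + 4/17 * E.nrm ?s \<le> 9 * ?N"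
    proof -
      have "0 \<le> E.nrm f" using L2f by simp
      then show ?thesis using s by (simp add: algebra_simps)
    qed
    finally show ?thesis .
  qed
  ultimately show ?thesis by blast
qed

section \<open>Function spaces on the graph\<close>

definition gscale :: "complex \<Rightarrow> gfun \<Rightarrow> gfun" where
  "gscale c u = (\<lambda>i t. c * u i t)"

interpretation gscale: vector_space gscale
  by standard (auto simp: gscale_def fun_eq_iff algebra_simps)

lemma ip_eq: "ip K u v = (\<Sum>i=1..K. eip (u i) (v i))"
  by (simp add: ip_def graph_integral_def eip_def)

lemma L2_graphD: "u \<in> L2_graph K \<Longrightarrow> i \<in> {1..K} \<Longrightarrow> L2_edge (u i)"
  by (simp add: L2_graph_def)

lemma gscale_apply: "gscale c u i = escale c (u i)"
  by (simp add: gscale_def escale_def)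

lemma hermitian_form_ip: "hermitian_form gscale (L2_graph K) (ip K)"
proof
  have V: "u i \<in> Collect L2_edge" if "u \<in> L2_graph K" "i \<in> {1..K}" for u i
    using L2_graphD that by simp
  show "gscale.subspace (L2_graph K)"
    unfolding gscale.subspace_def
  proof (intro conjI ballI allI)
    show "0 \<in> L2_graph K" using E.V_zero by (auto simp: L2_graph_def)
    show "x + y \<in> L2_graph K" if "x \<in> L2_graph K" "y \<in> L2_graph K" for x y
      using E.V_add[OF V[OF that(1)] V[OF that(2)]] by (simp add: L2_graph_def)
    show "gscale c x \<in> L2_graph K" if "x \<in> L2_graph K" for c x
      using E.V_scale[OF V[OF that], of _ c] by (simp add: L2_graph_def gscale_apply)
  qed
  show "ip K (x + y) z = ip K x z + ip K y z"
    if "x \<in> L2_graph K" "y \<in> L2_graph K" "z \<in> L2_graph K" for x y z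
    using V[OF that(1)] V[OF that(2)] V[OF that(3)]
    by (simp add: ip_eq E.add_left sum.distrib[symmetric])
  show "ip K (gscale c x) z = c * ip K x z" if "x \<in> L2_graph K" "z \<in> L2_graph K" for c x z
    using V[OF that(1)] V[OF that(2)]
    by (simp add: ip_eq gscale_apply E.scale_left sum_distrib_left)
  show "ip K y x = cnj (ip K x y)" if "x \<in> L2_graph K" "y \<in> L2_graph K" for x y
    using E.herm[OF V[OF that(1)] V[OF that(2)]] by (simp add: ip_eq)
qed

lemma ip_sq: "hermitian_form.sq (ip K) u = (\<Sum>i=1..K. E.sq (u i))"
  using hermitian_form.sq_def[OF hermitian_form_ip, of K u] by (simp add: ip_eq E.sq_def)

lemma semi_inner_ip: "semi_inner gscale (L2_graph K) (ip K)"
proof -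
  interpret hermitian_form gscale "L2_graph K" "ip K" by (rule hermitian_form_ip)
  show ?thesis
  proof
    show "0 \<le> sq x" if "x \<in> L2_graph K" for x
      unfolding ip_sq using that by (intro sum_nonneg E.sq_nonneg) (simp add: L2_graph_def)
  qed
qed

interpretation L2: semi_inner gscale "L2_graph K" "ip K" for K
  by (rule semi_inner_ip)

lemma E_sq_le_ip_sq:
  assumes "u \<in> L2_graph K" "i \<in> {1..K}"
  shows "E.sq (u i) \<le> L2.sq K u"
proof -
  have "E.sq (u i) \<le> (\<Sum>i=1..K. E.sq (u i))"
    using assms by (intro member_le_sum E.sq_nonneg) (auto simp: L2_graph_def)
  then show ?thesis by (simp add: ip_sq)
qed

lemma L2_norm_graph_eq: "L2_norm_graph K u = L2.nrm K u"
  by (simp add: L2_norm_graph_def L2.nrm_def L2.sq_def)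

lemma L2_graph_complete: "L2.is_complete K"
  unfolding L2.is_complete_def
proof (intro allI impI)
  fix u assume u: "\<forall>n. u n \<in> L2_graph K" and c: "L2.cauchy_seq K u"
  have "\<exists>w. L2_edge w \<and> E.tends_to (\<lambda>n. u n i) w" if i: "i \<in> {1..K}" for i
  proof -
    have "E.cauchy_seq (\<lambda>n. u n i)" unfolding E.cauchy_seq_def
    proof (intro allI impI)
      fix e :: real assume "0 < e"
      then obtain N where N: "\<And>m n. m \<ge> N \<Longrightarrow> n \<ge> N \<Longrightarrow> L2.sq K (u m - u n) < e"
        using c unfolding L2.cauchy_seq_def by meson
      have "E.sq (u m i - u n i) < e" if "m \<ge> N" "n \<ge> N" for m n
        using E_sq_le_ip_sq[of "u m - u n" K i] u i N[OF that] by simp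
      then show "\<exists>N. \<forall>m\<ge>N. \<forall>n\<ge>N. E.sq (u m i - u n i) < e" by blast
    qed
    then obtain w where "w \<in> Collect L2_edge" "E.tends_to (\<lambda>n. u n i) w"
      using E.is_completeE[OF E_complete, of "\<lambda>n. u n i"] u L2_graphD i by (metis mem_Collect_eq)
    then show ?thesis by auto
  qed
  then obtain w where w: "\<And>i. i \<in> {1..K} \<Longrightarrow> L2_edge (w i) \<and> E.tends_to (\<lambda>n. u n i) (w i)" by metis
  have "L2.tends_to K u w"
    unfolding L2.tends_to_def ip_sq using w by (intro tendsto_null_sum) (simp add: E.tends_to_def)
  moreover have "w \<in> L2_graph K" using w by (simp add: L2_graph_def)
  ultimately show "\<exists>x\<in>L2_graph K. L2.tends_to K u x" by blast
qed

lemma L2_edge_cong_AE: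
  assumes "L2_edge g" "h \<in> borel_measurable I01" "AE t in I01. h t = g t"
  shows "L2_edge h"
  unfolding L2_edge_def
proof
  show "integrable I01 (\<lambda>t. (cmod (h t))\<^sup>2)"
    by (rule integrable_cong_AE_imp[of I01 "\<lambda>t. (cmod (g t))\<^sup>2"])
       (use assms in \<open>auto simp: L2_edge_def elim: eventually_mono\<close>)
qed (rule assms)

lemma edge_deriv_measurable: "has_ac_deriv u g \<Longrightarrow> edge_deriv u \<in> borel_measurable I01"
  using ac_derivD(1)[OF ac_edge_deriv] by auto

lemma edge_deriv_L2: "\<lbrakk>has_ac_deriv u g; L2_edge g\<rbrakk> \<Longrightarrow> L2_edge (edge_deriv u)"
  by (rule L2_edge_cong_AE[OF _ edge_deriv_measurable edge_deriv_AE])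

text \<open>Subsequences are extracted for one index after another; \<open>sub\<close> guarantees
  that what was gained for earlier indices survives later extractions.\<close>

lemma finite_common_subsequence:
  fixes P :: "'i \<Rightarrow> (nat \<Rightarrow> nat) \<Rightarrow> bool"
  assumes "finite A"
    and ex: "\<And>i s. \<lbrakk>i \<in> A; strict_mono s\<rbrakk> \<Longrightarrow> \<exists>r::nat \<Rightarrow> nat. strict_mono r \<and> P i (s \<circ> r)"
    and sub: "\<And>i s (r::nat \<Rightarrow> nat). \<lbrakk>i \<in> A; P i s; strict_mono r\<rbrakk> \<Longrightarrow> P i (s \<circ> r)"
  shows "\<exists>r::nat \<Rightarrow> nat. strict_mono r \<and> (\<forall>i\<in>A. P i r)"
  using assms
proof (induction A rule: finite_induct)
  case empty
  show ?case by (intro exI[of _ id]) (auto simp: strict_mono_def)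
next
  case (insert a A)
  have "\<exists>s::nat \<Rightarrow> nat. strict_mono s \<and> (\<forall>i\<in>A. P i s)"
    by (rule insert.IH) (use insert.prems in auto)
  then obtain s where s: "strict_mono s" "\<forall>i\<in>A. P i s" by blast
  obtain r where r: "strict_mono r" "P a (s \<circ> r)" using insert.prems(1)[of a s] s(1) by blast
  have "strict_mono (s \<circ> r)" using s r by (simp add: strict_mono_o)
  moreover have "P i (s \<circ> r)" if "i \<in> insert a A" for i
    using that r s insert.prems(2)[OF that] by (cases "i = a") blast+
  ultimately show ?case by blast
qed

lemma E_cauchy_subseq:
  fixes r :: "nat \<Rightarrow> nat"
  assumes "E.cauchy_seq u" "strict_mono r"
  shows "E.cauchy_seq (\<lambda>n. u (r n))"
  unfolding E.cauchy_seq_def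
proof (intro allI impI)
  fix e :: real assume "0 < e"
  then obtain N where "\<forall>m\<ge>N. \<forall>n\<ge>N. E.sq (u m - u n) < e"
    using assms(1) unfolding E.cauchy_seq_def by blast
  then show "\<exists>N. \<forall>m\<ge>N. \<forall>n\<ge>N. E.sq (u (r m) - u (r n)) < e"
    using seq_suble[OF assms(2)] by (meson order_trans)
qed

section \<open>The form domain and its Sobolev norm\<close>

locale bvp =
  fixes P :: "'v graph_bvp" and f :: gfun
  assumes setting: "graph_bvp_setting P" and conormal: "conormal_with P f"
begin

abbreviation K where "K \<equiv> nedges P"
abbreviation V where "V \<equiv> dom_F P"

lemma V_I: "u \<in> V \<Longrightarrow> satisfies_I P u"
  by (simp add: dom_F_def)

lemma V_ac:
  assumes "u \<in> V" "i \<in> {1..K}"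
  shows "has_ac_deriv (u i) (gderiv u i)" "L2_edge (gderiv u i)" "L2_edge (u i)"
proof -
  obtain g where g: "has_ac_deriv (u i) g"
    using assms unfolding dom_F_def H1_graph_def AC_def by blast
  then show "has_ac_deriv (u i) (gderiv u i)" by (simp add: gderiv_def ac_edge_deriv)
  show "L2_edge (gderiv u i)" using assms by (simp add: dom_F_def H1_graph_def L2_graph_def)
  show "L2_edge (u i)" by (rule continuous_imp_L2_edge[OF ac_continuous[OF g]])
qed

lemma V_intro:
  assumes "\<And>i. i \<in> {1..K} \<Longrightarrow> \<exists>g. has_ac_deriv (u i) g \<and> L2_edge g" "satisfies_I P u"
  shows "u \<in> V"
  using assms edge_deriv_L2 unfolding dom_F_def H1_graph_def L2_graph_def gderiv_def AC_def by blast

lemma gderiv_AE: "has_ac_deriv (u i) g \<Longrightarrow> AE t in I01. gderiv u i t = g t"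
  by (simp add: gderiv_def edge_deriv_AE)

lemma satisfies_I_ends:
  assumes "\<And>i. i \<in> {1..K} \<Longrightarrow> u i 0 = v i 0 \<and> u i 1 = v i 1"
  shows "satisfies_I P u \<longleftrightarrow> satisfies_I P v"
proof -
  have "(\<Sum>j=1..K. coeff_a P i j * u j 0 + coeff_c P i j * u j 1)
      = (\<Sum>j=1..K. coeff_a P i j * v j 0 + coeff_c P i j * v j 1)" for i
    using assms by (intro sum.cong) auto
  then show ?thesis by (simp add: satisfies_I_def)
qed

text \<open>The source of elements of \<open>V\<close> that works without knowing the coefficients
  in (I): it serves for test functions on one edge and for the image of \<open>W\<close>.\<close>

lemma V_zero_ends:
  assumes "\<And>i. i \<in> {1..K} \<Longrightarrow> \<exists>g. has_ac_deriv (u i) g \<and> L2_edge g"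
    and "\<And>i. i \<in> {1..K} \<Longrightarrow> u i 0 = 0 \<and> u i 1 = 0"
  shows "u \<in> V"
proof (rule V_intro[OF assms(1)])
  show "satisfies_I P u"
    using satisfies_I_ends[of u "\<lambda>_ _. 0"] assms(2) by (simp add: satisfies_I_def)
qed

definition single :: "nat \<Rightarrow> (real \<Rightarrow> complex) \<Rightarrow> gfun" where
  "single i v = (\<lambda>j. if j = i then v else (\<lambda>_. 0))"

lemma single_V:
  assumes "has_ac_deriv v h" "L2_edge h" "v 0 = 0" "v 1 = 0"
  shows "single i v \<in> V"
proof (rule V_zero_ends)
  show "\<exists>g. has_ac_deriv (single i v j) g \<and> L2_edge g" for j
    using assms ac_const[of 0] L2_edge_zero by (cases "j = i") (auto simp: single_def)
qed (auto simp: single_def assms)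

lemma V_sub_L2: "V \<subseteq> L2_graph K"
  using V_ac(3) by (auto simp: L2_graph_def)

lemma add_ac:
  assumes "u \<in> V" "v \<in> V" "i \<in> {1..K}"
  shows "has_ac_deriv ((u + v) i) (gderiv u i + gderiv v i)"
  using ac_add[OF V_ac(1)[OF assms(1,3)] V_ac(1)[OF assms(2,3)]] by (simp add: plus_fun_def)

lemma scale_ac:
  assumes "u \<in> V" "i \<in> {1..K}"
  shows "has_ac_deriv (gscale c u i) (escale c (gderiv u i))"
  using ac_scale[OF V_ac(1)[OF assms], of c] by (simp add: gscale_def escale_def)

lemma gderiv_V: "\<lbrakk>u \<in> V; i \<in> {1..K}\<rbrakk> \<Longrightarrow> gderiv u i \<in> Collect L2_edge"
  using V_ac(2) by simp

lemma subspace_V: "gscale.subspace V"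
  unfolding gscale.subspace_def
proof (intro conjI ballI allI)
  show "0 \<in> V"
    using ac_const[of 0] L2_edge_zero by (intro V_zero_ends) (auto simp: zero_fun_def)
  show "u + v \<in> V" if uv: "u \<in> V" "v \<in> V" for u v
  proof (rule V_intro)
    show "\<exists>g. has_ac_deriv ((u + v) i) g \<and> L2_edge g" if i: "i \<in> {1..K}" for i
      using add_ac[OF uv i] E.V_add[OF gderiv_V[OF uv(1) i] gderiv_V[OF uv(2) i]] by auto
    have "(\<Sum>j=1..K. coeff_a P i j * (u + v) j 0 + coeff_c P i j * (u + v) j 1)
      = (\<Sum>j=1..K. coeff_a P i j * u j 0 + coeff_c P i j * u j 1)
        + (\<Sum>j=1..K. coeff_a P i j * v j 0 + coeff_c P i j * v j 1)" for i
      unfolding sum.distrib[symmetric] by (intro sum.cong) (auto simp: algebra_simps)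
    then show "satisfies_I P (u + v)"
      using V_I[OF uv(1)] V_I[OF uv(2)] by (simp add: satisfies_I_def)
  qed
  show "gscale c u \<in> V" if u: "u \<in> V" for c u
  proof (rule V_intro)
    show "\<exists>g. has_ac_deriv (gscale c u i) g \<and> L2_edge g" if i: "i \<in> {1..K}" for i
      using scale_ac[OF u i, of c] E.V_scale[OF gderiv_V[OF u i], of c] by auto
    have "(\<Sum>j=1..K. coeff_a P i j * gscale c u j 0 + coeff_c P i j * gscale c u j 1)
      = c * (\<Sum>j=1..K. coeff_a P i j * u j 0 + coeff_c P i j * u j 1)" for i
      unfolding sum_distrib_left by (intro sum.cong) (auto simp: algebra_simps gscale_def)
    then show "satisfies_I P (gscale c u)"
      using V_I[OF u] by (simp add: satisfies_I_def)
  qed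
qed

sublocale S: semi_inner gscale V "ip K"
  by (rule L2.semi_inner_subspace[OF subspace_V V_sub_L2])

lemma E_sq_le_S: "\<lbrakk>u \<in> V; i \<in> {1..K}\<rbrakk> \<Longrightarrow> E.sq (u i) \<le> S.sq u"
  using E_sq_le_ip_sq V_sub_L2 by blast

definition dirichlet :: "gfun \<Rightarrow> gfun \<Rightarrow> complex" where
  "dirichlet u v = (\<Sum>i=1..K. eip (gderiv u i) (gderiv v i))"

text \<open>\<open>gderiv\<close> selects a representative, so it is additive only almost
  everywhere; forms in it are compared through \<open>eip_cong_AE\<close>.\<close>

lemma gderiv_add_AE:
  "\<lbrakk>u \<in> V; v \<in> V; i \<in> {1..K}\<rbrakk> \<Longrightarrow> AE t in I01. gderiv (u + v) i t = (gderiv u i + gderiv v i) t"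
  by (rule gderiv_AE[where u = "u + v", OF add_ac])

lemma gderiv_scale_AE:
  "\<lbrakk>u \<in> V; i \<in> {1..K}\<rbrakk> \<Longrightarrow> AE t in I01. gderiv (gscale c u) i t = escale c (gderiv u i) t"
  by (rule gderiv_AE[where u = "gscale c u", OF scale_ac])

lemma hermitian_form_dirichlet: "hermitian_form gscale V dirichlet"
proof
  show "gscale.subspace V" by (rule subspace_V)
  show "dirichlet (u + v) w = dirichlet u w + dirichlet v w" if uvw: "u \<in> V" "v \<in> V" "w \<in> V" for u v w
  proof -
    have "eip (gderiv (u + v) i) (gderiv w i) = eip (gderiv u i) (gderiv w i) + eip (gderiv v i) (gderiv w i)"
      if i: "i \<in> {1..K}" for i
    proof -
      have "eip (gderiv (u + v) i) (gderiv w i) = eip (gderiv u i + gderiv v i) (gderiv w i)"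
        using gderiv_add_AE[OF uvw(1,2) i] E.V_add[OF gderiv_V[OF uvw(1) i] gderiv_V[OF uvw(2) i]] uvw i V_ac(2) S.V_add
        by (intro eip_cong_AE) auto
      then show ?thesis using gderiv_V uvw i by (simp only: E.add_left)
    qed
    then show ?thesis by (simp add: dirichlet_def sum.distrib[symmetric])
  qed
  show "dirichlet (gscale c u) w = c * dirichlet u w" if uw: "u \<in> V" "w \<in> V" for c u w
  proof -
    have "eip (gderiv (gscale c u) i) (gderiv w i) = c * eip (gderiv u i) (gderiv w i)"
      if i: "i \<in> {1..K}" for i
    proof -
      have "eip (gderiv (gscale c u) i) (gderiv w i) = eip (escale c (gderiv u i)) (gderiv w i)"
        using gderiv_scale_AE[OF uw(1) i] E.V_scale[OF gderiv_V[OF uw(1) i]] uw i V_ac(2) S.V_scale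
        by (intro eip_cong_AE) auto
      then show ?thesis using gderiv_V uw i by (simp only: E.scale_left)
    qed
    then show ?thesis by (simp add: dirichlet_def sum_distrib_left)
  qed
  show "dirichlet v u = cnj (dirichlet u v)" if uv: "u \<in> V" "v \<in> V" for u v
  proof -
    have "eip (gderiv v i) (gderiv u i) = cnj (eip (gderiv u i) (gderiv v i))" if i: "i \<in> {1..K}" for i
      using gderiv_V uv i by (intro E.herm)
    then show ?thesis by (simp add: dirichlet_def)
  qed
qed

sublocale D: hermitian_form gscale V dirichlet
  by (rule hermitian_form_dirichlet)

lemma D_sq: "D.sq u = (\<Sum>i=1..K. E.sq (gderiv u i))"
  by (simp add: D.sq_def dirichlet_def E.sq_def)

lemma E_sq_le_D:
  assumes "u \<in> V" "i \<in> {1..K}"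
  shows "E.sq (gderiv u i) \<le> D.sq u"
  unfolding D_sq using assms gderiv_V by (intro member_le_sum E.sq_nonneg) auto

lemma S_sq: "S.sq u = (\<Sum>i=1..K. E.sq (u i))"
  by (rule ip_sq)

lemma S_sq_nonneg: "u \<in> V \<Longrightarrow> 0 \<le> S.sq u"
  by (rule S.sq_nonneg)

lemma D_sq_nonneg: "u \<in> V \<Longrightarrow> 0 \<le> D.sq u"
  unfolding D_sq using gderiv_V by (intro sum_nonneg E.sq_nonneg) auto

lemma E_sq_gderiv:
  assumes "u \<in> V" "i \<in> {1..K}" "has_ac_deriv (u i) g" "L2_edge g"
  shows "E.sq (gderiv u i) = E.sq g"
  using gderiv_AE[where u = u, OF assms(3)] V_ac(2)[OF assms(1,2)] assms(4) by (intro E_sq_cong_AE)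

text \<open>Stated for any form equivalent to the Sobolev norm because it serves twice: for
  \<open>F\<close> shifted by a multiple of \<open>ip\<close>, when \<open>F\<close> itself is not
  yet known to be coercive, and afterwards for \<open>F\<close>. Compactness comes from
  \<open>ac_compact\<close> on each edge.\<close>

lemma compact_embedding_if_equivalent:
  assumes G: "hermitian_form gscale V G"
    and c: "0 < c" "\<And>u. u \<in> V \<Longrightarrow> c * (D.sq u + S.sq u) \<le> hermitian_form.sq G u"
    and C: "\<And>u. u \<in> V \<Longrightarrow> hermitian_form.sq G u \<le> C * (D.sq u + S.sq u)"
  shows "compact_embedding gscale V G (ip K) (1 / c)"
proof -
  interpret G: hermitian_form gscale V G by fact
  interpret G: semi_inner gscale V G
  proof
    show "0 \<le> G.sq u" if "u \<in> V" for u
      using c(2)[OF that] c(1) D_sq_nonneg[OF that] S_sq_nonneg[OF that]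
      by (meson add_nonneg_nonneg less_imp_le mult_nonneg_nonneg order_trans)
  qed
  have le: "D.sq u \<le> G.sq u / c" "S.sq u \<le> G.sq u / c" if "u \<in> V" for u
  proof -
    have *: "D.sq u + S.sq u \<le> G.sq u / c" using c(2)[OF that] c(1) by (simp add: field_simps)
    show "D.sq u \<le> G.sq u / c" "S.sq u \<le> G.sq u / c"
      using * D_sq_nonneg[OF that] S_sq_nonneg[OF that] by linarith+
  qed
  have edge_le: "E.sq (u i) \<le> G.sq u / c" "E.sq (gderiv u i) \<le> G.sq u / c" if "u \<in> V" "i \<in> {1..K}" for u i
    using le[OF that(1)] E_sq_le_S[OF that] E_sq_le_D[OF that] by linarith+
  have diff_deriv: "has_ac_deriv ((u - v) i) (gderiv u i - gderiv v i)"
    if "u \<in> V" "v \<in> V" "i \<in> {1..K}" for u v i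
    using ac_diff[OF V_ac(1)[OF that(1,3)] V_ac(1)[OF that(2,3)]] by (simp add: fun_diff_def)
  show ?thesis
  proof
    show "0 < 1 / c" using c by simp
    show "S.sq x \<le> 1 / c * G.sq x" if "x \<in> V" for x using le(2)[OF that] by simp
    show "G.is_complete"
      unfolding G.is_complete_def
    proof (intro allI impI)
      fix u :: "nat \<Rightarrow> gfun"
      assume "\<forall>n. u n \<in> V" and cauchy: "G.cauchy_seq u"
      then have u: "u n \<in> V" for n by blast
      have small: "\<exists>N. \<forall>m\<ge>N. \<forall>n\<ge>N. G.sq (u m - u n) / c < e" if e: "0 < e" for e
      proof -
        have "0 < e * c" using e c(1) by simp
        then obtain N where "\<forall>m\<ge>N. \<forall>n\<ge>N. G.sq (u m - u n) < e * c"
          using cauchy unfolding G.cauchy_seq_def by blast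
        then show ?thesis using c by (auto simp: field_simps intro!: exI[of _ N])
      qed
      \<comment> \<open>The limit will be rebuilt from its value at 0 and its derivative: the trace
        bound makes the former converge, completeness of L2 provides the latter.\<close>
      have "\<exists>a g. L2_edge g \<and> (\<lambda>n. u n i 0) \<longlonglongrightarrow> a \<and> E.tends_to (\<lambda>n. gderiv (u n) i) g"
        if i: "i \<in> {1..K}" for i
      proof -
        have d: "E.sq (gderiv (u m) i - gderiv (u n) i) \<le> G.sq (u m - u n) / c" for m n
        proof -
          have "L2_edge (gderiv (u m) i - gderiv (u n) i)"
            using E.V_diff[OF gderiv_V[OF u i] gderiv_V[OF u i]] by simp
          from E_sq_gderiv[OF S.V_diff[OF u u] i diff_deriv[OF u u i] this]
          show ?thesis using edge_le(2)[OF S.V_diff[OF u u] i, of m n] by (rule subst)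
        qed
        have "E.cauchy_seq (\<lambda>n. gderiv (u n) i)"
          unfolding E.cauchy_seq_def using small d by (meson le_less_trans)
        then obtain g where g: "g \<in> Collect L2_edge" "E.tends_to (\<lambda>n. gderiv (u n) i) g"
          using E.is_completeE[OF E_complete, of "\<lambda>n. gderiv (u n) i"] gderiv_V[OF u i] by blast
        have ends: "(cmod (u m i 0 - u n i 0))\<^sup>2 \<le> 5 * (G.sq (u m - u n) / c)" for m n
        proof -
          have "L2_edge (gderiv (u m) i - gderiv (u n) i)"
            using E.V_diff[OF gderiv_V[OF u i] gderiv_V[OF u i]] by simp
          then have "(cmod ((u m - u n) i 0))\<^sup>2 \<le> 2 / (1/2) * E.sq ((u m - u n) i)
              + 2 * (1/2) * E.sq (gderiv (u m) i - gderiv (u n) i)"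
            by (intro ac_trace_bound[OF diff_deriv[OF u u i]]) auto
          also have "\<dots> \<le> 4 * (G.sq (u m - u n) / c) + G.sq (u m - u n) / c"
            using d[of m n] edge_le(1)[OF S.V_diff[OF u u] i, of m n] by simp
          finally show ?thesis by simp
        qed
        have "Cauchy (\<lambda>n. u n i 0)"
        proof (rule metric_CauchyI)
          fix e :: real assume e: "0 < e"
          then obtain N where N: "\<forall>m\<ge>N. \<forall>n\<ge>N. G.sq (u m - u n) / c < e\<^sup>2 / 5"
            using small[of "e\<^sup>2 / 5"] by auto
          have "dist (u m i 0) (u n i 0) < e" if "m \<ge> N" "n \<ge> N" for m n
          proof -
            have "G.sq (u m - u n) / c < e\<^sup>2 / 5" using N that by blast
            then have "5 * (G.sq (u m - u n) / c) < e\<^sup>2" by linarith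
            then have "(cmod (u m i 0 - u n i 0))\<^sup>2 < e\<^sup>2" using ends[of m n] by linarith
            then show ?thesis using e by (simp add: dist_norm power2_less_imp_less)
          qed
          then show "\<exists>N. \<forall>m\<ge>N. \<forall>n\<ge>N. dist (u m i 0) (u n i 0) < e" by blast
        qed
        then obtain a where "(\<lambda>n. u n i 0) \<longlonglongrightarrow> a"
          using Cauchy_convergent_iff convergent_def by blast
        then show ?thesis using g by blast
      qed
      then obtain a g where ag: "\<And>i. i \<in> {1..K} \<Longrightarrow> L2_edge (g i) \<and> (\<lambda>n. u n i 0) \<longlonglongrightarrow> a i
          \<and> E.tends_to (\<lambda>n. gderiv (u n) i) (g i)" by metis
      define x :: gfun where "x i t = a i + (LINT s|I01. (if s \<le> t then g i s else 0))" for i t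
      have x: "has_ac_deriv (x i) (g i)" if "i \<in> {1..K}" for i
        unfolding x_def[abs_def] using ag[OF that] by (intro ac_primitive L2_edge_imp_integrable) blast
      have x0: "x i 0 = a i" for i
        unfolding x_def using AE_I01_neq[of 0] by (subst integral_eq_zero_AE) (auto elim!: lebesgue_on_mono)
      have ac_diff_x: "has_ac_deriv (\<lambda>t. u n i t - x i t) (gderiv (u n) i - g i)" if "i \<in> {1..K}" for n i
        using ac_diff[OF V_ac(1)[OF u that] x[OF that]] by (simp add: fun_diff_def)
      have L2_diff: "L2_edge (gderiv (u n) i - g i)" if "i \<in> {1..K}" for n i
        using E.V_diff[OF gderiv_V[OF u that], of "g i"] ag[OF that] by simp
      \<comment> \<open>A uniform bound for \<open>u n i - x i\<close> on the edge: the error at 0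
        plus the norm of the error of the derivative.\<close>
      define \<epsilon> where "\<epsilon> i n = cmod (u n i 0 - a i) + E.nrm (gderiv (u n) i - g i)" for i n
      have \<epsilon>: "\<epsilon> i \<longlonglongrightarrow> 0" if i: "i \<in> {1..K}" for i
      proof -
        have "(\<lambda>n. cmod (u n i 0 - a i)) \<longlonglongrightarrow> 0"
          using ag[OF i] LIM_zero tendsto_norm_zero by blast
        moreover have "(\<lambda>n. E.nrm (gderiv (u n) i - g i)) \<longlonglongrightarrow> 0"
          using ag[OF i] E.tends_to_nrm by blast
        ultimately show ?thesis unfolding \<epsilon>_def[abs_def] using tendsto_add by fastforce
      qed
      have unif: "cmod (u n i t - x i t) \<le> \<epsilon> i n" if i: "i \<in> {1..K}" and t: "t \<in> {0..1}" for n i t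
      proof -
        have "(cmod ((u n i t - x i t) - (u n i 0 - x i 0)))\<^sup>2 \<le> \<bar>t - 0\<bar> * E.sq (gderiv (u n) i - g i)"
          by (rule ac_holder[OF ac_diff_x[OF i] L2_diff[OF i]]) (use t in auto)
        also have "\<dots> \<le> 1 * E.sq (gderiv (u n) i - g i)"
          using t L2_diff[OF i] E.sq_nonneg by (intro mult_right_mono) auto
        also have "\<dots> = (E.nrm (gderiv (u n) i - g i))\<^sup>2" using L2_diff[OF i] by simp
        finally have "cmod ((u n i t - x i t) - (u n i 0 - x i 0)) \<le> E.nrm (gderiv (u n) i - g i)"
          by (rule power2_le_imp_le) (use L2_diff[OF i] in simp)
        then show ?thesis
          using norm_triangle_ineq[of "(u n i t - x i t) - (u n i 0 - x i 0)" "u n i 0 - x i 0"]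
          by (simp add: \<epsilon>_def x0)
      qed
      have pointwise: "(\<lambda>n. u n i t) \<longlonglongrightarrow> x i t" if i: "i \<in> {1..K}" and t: "t \<in> {0..1}" for i t
      proof -
        have "(\<lambda>n. u n i t - x i t) \<longlonglongrightarrow> 0"
        proof (rule tendsto_0_le[OF \<epsilon>[OF i], where K=1], intro always_eventually allI)
          show "norm (u n i t - x i t) \<le> norm (\<epsilon> i n) * 1" for n
            using unif[OF i t, of n] by simp
        qed
        then show ?thesis by (simp add: LIM_zero_iff)
      qed
      \<comment> \<open>Conditions (I) survive because convergence is pointwise at the edge
        ends.\<close>
      have xV: "x \<in> V"
      proof (rule V_intro)
        show "\<exists>g. has_ac_deriv (x i) g \<and> L2_edge g" if "i \<in> {1..K}" for i
          using x[OF that] ag[OF that] by blast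
        show "satisfies_I P x"
          unfolding satisfies_I_def
        proof
          fix i assume i: "i \<in> {1..ndir P}"
          have "(\<lambda>n. \<Sum>j=1..K. coeff_a P i j * u n j 0 + coeff_c P i j * u n j 1)
            \<longlonglongrightarrow> (\<Sum>j=1..K. coeff_a P i j * x j 0 + coeff_c P i j * x j 1)"
            by (intro tendsto_sum tendsto_add tendsto_mult tendsto_const pointwise) auto
          moreover have "(\<Sum>j=1..K. coeff_a P i j * u n j 0 + coeff_c P i j * u n j 1) = 0" for n
            using V_I[OF u[of n]] i by (simp add: satisfies_I_def)
          ultimately show "(\<Sum>j=1..K. coeff_a P i j * x j 0 + coeff_c P i j * x j 1) = 0"
            by (simp add: LIMSEQ_const_iff)
        qed
      qed
      have Sdiff: "S.sq (u n - x) \<le> (\<Sum>i=1..K. (\<epsilon> i n)\<^sup>2)" for n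
        unfolding S_sq
      proof (rule sum_mono)
        fix i assume i: "i \<in> {1..K}"
        show "E.sq ((u n - x) i) \<le> (\<epsilon> i n)\<^sup>2"
          using V_ac(3)[OF S.V_diff[OF u xV] i] unif[OF i] by (intro E_sq_le_sup) auto
      qed
      have Ddiff: "D.sq (u n - x) = (\<Sum>i=1..K. E.sq (gderiv (u n) i - g i))" for n
        unfolding D_sq
      proof (rule sum.cong)
        fix i assume i: "i \<in> {1..K}"
        have "has_ac_deriv ((u n - x) i) (gderiv (u n) i - g i)"
          using ac_diff_x[OF i] by (simp add: fun_diff_def)
        then show "E.sq (gderiv (u n - x) i) = E.sq (gderiv (u n) i - g i)"
          by (intro E_sq_gderiv[OF S.V_diff[OF u xV] i] L2_diff[OF i])
      qed simp
      have "(\<lambda>n. C * ((\<Sum>i=1..K. E.sq (gderiv (u n) i - g i)) + (\<Sum>i=1..K. (\<epsilon> i n)\<^sup>2)))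
          \<longlonglongrightarrow> C * ((\<Sum>i=1..K. 0) + (\<Sum>i=1..K. 0\<^sup>2))"
        using ag by (intro tendsto_mult tendsto_const tendsto_add tendsto_sum tendsto_power \<epsilon>)
          (auto simp: E.tends_to_def)
      then have lim: "(\<lambda>n. C * ((\<Sum>i=1..K. E.sq (gderiv (u n) i - g i)) + (\<Sum>i=1..K. (\<epsilon> i n)\<^sup>2))) \<longlonglongrightarrow> 0"
        by simp
      \<comment> \<open>The sign of \<open>C\<close> is not known here, hence the absolute
        value.\<close>
      have C0: "C * (D.sq (u n - x) + S.sq (u n - x))
          \<le> \<bar>C\<bar> * ((\<Sum>i=1..K. E.sq (gderiv (u n) i - g i)) + (\<Sum>i=1..K. (\<epsilon> i n)\<^sup>2))" for n
      proof -
        have "C * (D.sq (u n - x) + S.sq (u n - x)) \<le> \<bar>C\<bar> * (D.sq (u n - x) + S.sq (u n - x))"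
          using D_sq_nonneg[OF S.V_diff[OF u xV]] S_sq_nonneg[OF S.V_diff[OF u xV]]
          by (intro mult_right_mono) auto
        also have "\<dots> \<le> \<bar>C\<bar> * ((\<Sum>i=1..K. E.sq (gderiv (u n) i - g i)) + (\<Sum>i=1..K. (\<epsilon> i n)\<^sup>2))"
          using Sdiff[of n] by (intro mult_left_mono) (auto simp: Ddiff)
        finally show ?thesis .
      qed
      have "(\<lambda>n. G.sq (u n - x)) \<longlonglongrightarrow> 0"
      proof (rule tendsto_sandwich[OF _ _ tendsto_const])
        show "\<forall>\<^sub>F n in sequentially. 0 \<le> G.sq (u n - x)"
          using G.sq_nonneg[OF S.V_diff[OF u xV]] by (intro always_eventually allI)
        show "\<forall>\<^sub>F n in sequentially. G.sq (u n - x)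
            \<le> \<bar>C\<bar> * ((\<Sum>i=1..K. E.sq (gderiv (u n) i - g i)) + (\<Sum>i=1..K. (\<epsilon> i n)\<^sup>2))"
          using order_trans[OF C[OF S.V_diff[OF u xV]] C0] by (intro always_eventually allI)
        show "(\<lambda>n. \<bar>C\<bar> * ((\<Sum>i=1..K. E.sq (gderiv (u n) i - g i)) + (\<Sum>i=1..K. (\<epsilon> i n)\<^sup>2))) \<longlonglongrightarrow> 0"
          using tendsto_rabs_zero[OF lim] by (simp add: abs_mult sum_nonneg E_sq)
      qed
      then show "\<exists>x\<in>V. G.tends_to u x" using xV by (auto simp: G.tends_to_def)
    qed
    fix u :: "nat \<Rightarrow> gfun" and B
    assume u: "\<And>n. u n \<in> V" and B: "\<And>n. G.sq (u n) \<le> B"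
    have "\<exists>r::nat \<Rightarrow> nat. strict_mono r \<and> (\<forall>i\<in>{1..K}. E.cauchy_seq (\<lambda>n. u (r n) i))"
    proof (rule finite_common_subsequence)
      fix i and s :: "nat \<Rightarrow> nat" assume i: "i \<in> {1..K}"
      have bd: "G.sq (u n) / c \<le> B / c" for n using B[of n] c by (simp add: divide_right_mono)
      have "\<exists>r::nat \<Rightarrow> nat. strict_mono r \<and> E.cauchy_seq (\<lambda>n. u (s (r n)) i)"
        using V_ac[OF u i] order_trans[OF edge_le(1)[OF u i] bd] order_trans[OF edge_le(2)[OF u i] bd]
        by (intro ac_compact[of "\<lambda>n. u (s n) i" "\<lambda>n. gderiv (u (s n)) i"]) auto
      then show "\<exists>r::nat \<Rightarrow> nat. strict_mono r \<and> E.cauchy_seq (\<lambda>n. u ((s \<circ> r) n) i)" by simp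
    next
      fix i and s r :: "nat \<Rightarrow> nat"
      assume "E.cauchy_seq (\<lambda>n. u (s n) i)" "strict_mono r"
      then show "E.cauchy_seq (\<lambda>n. u ((s \<circ> r) n) i)"
        using E_cauchy_subseq[of "\<lambda>n. u (s n) i" r] by simp
    qed simp
    then obtain r :: "nat \<Rightarrow> nat" where r: "strict_mono r" "\<And>i. i \<in> {1..K} \<Longrightarrow> E.cauchy_seq (\<lambda>n. u (r n) i)"
      by blast
    have "S.cauchy_seq (\<lambda>n. u (r n))" unfolding S.cauchy_seq_def
    proof (intro allI impI)
      fix e :: real assume e: "0 < e"
      then have e': "0 < e / (real K + 1)" by simp
      have "\<forall>i\<in>{1..K}. \<exists>N. \<forall>m\<ge>N. \<forall>n\<ge>N. E.sq (u (r m) i - u (r n) i) < e / (real K + 1)"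
        using r(2) e' unfolding E.cauchy_seq_def by blast
      then obtain N where N: "\<And>i m n. i \<in> {1..K} \<Longrightarrow> m \<ge> N i \<Longrightarrow> n \<ge> N i \<Longrightarrow>
          E.sq (u (r m) i - u (r n) i) < e / (real K + 1)" by metis
      have "S.sq (u (r m) - u (r n)) < e"
        if mn: "m \<ge> Max (insert 0 (N ` {1..K}))" "n \<ge> Max (insert 0 (N ` {1..K}))" for m n
      proof -
        have "S.sq (u (r m) - u (r n)) \<le> (\<Sum>i=1..K. e / (real K + 1))"
          unfolding S_sq
        proof (rule sum_mono)
          fix i assume i: "i \<in> {1..K}"
          then have "N i \<le> Max (insert 0 (N ` {1..K}))" by (intro Max_ge) auto
          then have "N i \<le> m" "N i \<le> n" using mn by (blast intro: order_trans)+
          then show "E.sq ((u (r m) - u (r n)) i) \<le> e / (real K + 1)"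
            using N[OF i, of m n] by simp
        qed
        also have "\<dots> < e" using e by (simp add: field_simps)
        finally show ?thesis .
      qed
      then show "\<exists>N. \<forall>m\<ge>N. \<forall>n\<ge>N. S.sq (u (r m) - u (r n)) < e" by blast
    qed
    then show "\<exists>r::nat \<Rightarrow> nat. strict_mono r \<and> S.cauchy_seq (\<lambda>n. u (r n))" using r(1) by blast
  qed
qed

end

section \<open>The quadratic form of the boundary value problem\<close>

lemma ac_poly: "has_ac_deriv (\<lambda>t. poly p (of_real t)) (\<lambda>t. poly (pderiv p) (of_real t))"
proof (induction p)
  case 0
  show ?case using ac_const[of 0] by simp
next
  case (pCons a p)
  have "has_ac_deriv (\<lambda>t. a + of_real t * poly p (of_real t))
      (\<lambda>t. 0 + (1 * poly p (of_real t) + of_real t * poly (pderiv p) (of_real t)))"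
    by (intro ac_add ac_const ac_mult ac_ident pCons.IH)
  then show ?case by (simp add: pderiv_pCons)
qed

lemma E_nrm_AE_bounded_mult:
  assumes u: "L2_edge u" and b: "b \<in> borel_measurable I01" and B: "AE t in I01. cmod (b t) \<le> B" "0 \<le> B"
  shows "E.nrm (\<lambda>t. b t * u t) \<le> B * E.nrm u"
proof -
  have L2: "L2_edge (\<lambda>t. b t * u t)" by (rule L2_edge_bounded_mult[OF u b B(1)])
  have "(LINT t|I01. (cmod (b t * u t))\<^sup>2) \<le> (LINT t|I01. B\<^sup>2 * (cmod (u t))\<^sup>2)"
  proof (rule integral_mono_AE)
    show "AE t in I01. (cmod (b t * u t))\<^sup>2 \<le> B\<^sup>2 * (cmod (u t))\<^sup>2"
      using B(1)
    proof (rule eventually_mono)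
      fix t assume "cmod (b t) \<le> B"
      then have "(cmod (b t))\<^sup>2 \<le> B\<^sup>2" by (intro power_mono) auto
      then show "(cmod (b t * u t))\<^sup>2 \<le> B\<^sup>2 * (cmod (u t))\<^sup>2"
        by (simp add: norm_mult power_mult_distrib mult_right_mono)
    qed
  qed (use u L2 in \<open>auto simp: L2_edge_def\<close>)
  then have "E.sq (\<lambda>t. b t * u t) \<le> B\<^sup>2 * E.sq u" by (simp add: E_sq)
  from real_sqrt_le_mono[OF this] show ?thesis
    using B(2) by (simp add: E.nrm_def real_sqrt_mult)
qed

text \<open>Start from \<open>t * (1 - t)\<close>; each compression multiplies the quotient of the
  two squared norms by \<open>16\<^sup>2 = 256\<close> and keeps the zero end values.\<close>

lemma unbounded_derivative:
  "\<exists>v h. has_ac_deriv v h \<and> L2_edge h \<and> v 0 = 0 \<and> v 1 = 0 \<and> 0 < E.sq v \<and> 256 ^ n * E.sq v \<le> E.sq h"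
proof (induction n)
  case 0
  define v where "v = (\<lambda>t. poly [:0, 1, -1 :: complex:] (of_real t))"
  define h where "h = (\<lambda>t. poly (pderiv [:0, 1, -1 :: complex:]) (of_real t))"
  have ac: "has_ac_deriv v h" unfolding v_def h_def by (rule ac_poly)
  have ch: "continuous_on {0..1} h" unfolding h_def by (rule ac_continuous[OF ac_poly])
  have L2h: "L2_edge h" by (rule continuous_imp_L2_edge[OF ch])
  have L2v: "L2_edge v" by (rule continuous_imp_L2_edge[OF ac_continuous[OF ac]])
  have ends: "v 0 = 0" "v 1 = 0" by (simp_all add: v_def)
  have "E.sq v \<noteq> 0"
  proof
    assume "E.sq v = 0"
    then have "AE t in I01. v t = 0" using E_sq_eq_0_iff[OF L2v] by simp
    then have "v (1/2) = 0"
      by (intro AE_eq_imp_eq_continuous[OF ac_continuous[OF ac] continuous_on_const[of _ 0]]) auto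
    then show False by (simp add: v_def)
  qed
  then have pos: "0 < E.sq v" using E.sq_nonneg[of v] L2v by simp
  have "E.sq v \<le> (E.nrm h)\<^sup>2"
  proof (rule E_sq_le_sup[OF L2v])
    fix t :: real assume t: "t \<in> {0..1}"
    have "(cmod (v t - v 0))\<^sup>2 \<le> \<bar>t - 0\<bar> * E.sq h" by (rule ac_holder[OF ac L2h]) (use t in auto)
    also have "\<dots> \<le> 1 * E.sq h" using t E.sq_nonneg[of h] L2h by (intro mult_right_mono) auto
    also have "\<dots> = (E.nrm h)\<^sup>2" using E.nrm_power2[of h] L2h by simp
    finally have "cmod (v t - v 0) \<le> E.nrm h"
      by (rule power2_le_imp_le) (use E.nrm_nonneg[of h] L2h in simp)
    then show "cmod (v t) \<le> E.nrm h" by (simp add: ends)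
  qed
  then have "256 ^ 0 * E.sq v \<le> E.sq h" using E.nrm_power2[of h] L2h by simp
  then show ?case using ac L2h ends pos by blast
next
  case (Suc n)
  then obtain v h where v: "has_ac_deriv v h" "L2_edge h" "v 0 = 0" "v 1 = 0" "0 < E.sq v"
    "256 ^ n * E.sq v \<le> E.sq h" by blast
  have L2v: "L2_edge v" by (rule continuous_imp_L2_edge[OF ac_continuous[OF v(1)]])
  have eq: "(\<lambda>t. 16 * compress h t) = escale 16 (compress h)" by (simp add: escale_def)
  have L2: "L2_edge (escale 16 (compress h))"
    using E.V_scale[of "compress h" 16] v by (simp add: L2_compress)
  have "E.sq (escale 16 (compress h)) = 16 * E.sq h"
    using E.sq_scale[of "compress h" 16] v by (simp add: L2_compress sq_compress)
  then have "256 ^ Suc n * E.sq (compress v) \<le> E.sq (escale 16 (compress h))"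
    using v(6) L2v by (simp add: sq_compress mult.commute)
  moreover have "0 < E.sq (compress v)" using v(5) L2v by (simp add: sq_compress)
  moreover have "compress v 0 = 0" "compress v 1 = 0" using v by (auto simp: compress_def)
  moreover have "has_ac_deriv (compress v) (escale 16 (compress h))"
    using ac_compress[OF v(1,4)] by (simp add: eq)
  ultimately show ?case using L2 by blast
qed

context bvp
begin

definition boundary_form :: "gfun \<Rightarrow> gfun \<Rightarrow> complex" where
  "boundary_form u v = boundary_integral K (\<lambda>i t. f i t * u i t * cnj (v i t))"

definition potential_form :: "gfun \<Rightarrow> gfun \<Rightarrow> complex" where
  "potential_form u v = (\<Sum>i=1..K. eip (\<lambda>t. of_real (potential P i t) * u i t) (v i))"

lemma potential_measurable: "i \<in> {1..K} \<Longrightarrow> (\<lambda>t. complex_of_real (potential P i t)) \<in> borel_measurable I01"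
proof -
  assume "i \<in> {1..K}"
  then have "potential P i \<in> borel_measurable I01"
    using setting unfolding graph_bvp_setting_def potential_bounded_def by blast
  from borel_measurable_continuous_on[OF _ this, of complex_of_real] show ?thesis
    by (simp add: continuous_on_of_real_id)
qed

lemma potential_bound: "\<exists>B\<ge>0. \<forall>i\<in>{1..K}. AE t in I01. cmod (of_real (potential P i t)) \<le> B"
proof -
  have "\<forall>i\<in>{1..K}. \<exists>C. AE t in I01. \<bar>potential P i t\<bar> \<le> C"
    using setting unfolding graph_bvp_setting_def potential_bounded_def by blast
  then obtain C where C: "\<And>i. i \<in> {1..K} \<Longrightarrow> AE t in I01. \<bar>potential P i t\<bar> \<le> C i" by metis
  show ?thesis
  proof (intro exI conjI ballI)
    show "0 \<le> (\<Sum>i=1..K. \<bar>C i\<bar>)" by (intro sum_nonneg) simp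
    fix i assume i: "i \<in> {1..K}"
    have "C i \<le> (\<Sum>i=1..K. \<bar>C i\<bar>)"
      using member_le_sum[OF i, of "\<lambda>i. \<bar>C i\<bar>"] by simp
    then show "AE t in I01. cmod (of_real (potential P i t)) \<le> (\<Sum>i=1..K. \<bar>C i\<bar>)"
      using C[OF i] by (auto elim!: eventually_mono)
  qed
qed

lemma potential_L2:
  assumes "L2_edge w" "i \<in> {1..K}"
  shows "L2_edge (\<lambda>t. of_real (potential P i t) * w t)"
  using potential_bound assms potential_measurable L2_edge_bounded_mult by blast

lemma F_form_eq:
  assumes u: "u \<in> V" and v: "v \<in> V"
  shows "F_form P f u v = boundary_form u v + (dirichlet u v + potential_form u v)"
proof -
  have "(LINT t|I01. gderiv u i t * cnj (gderiv v i t) + of_real (potential P i t) * u i t * cnj (v i t))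
      = eip (gderiv u i) (gderiv v i) + eip (\<lambda>t. of_real (potential P i t) * u i t) (v i)"
    if i: "i \<in> {1..K}" for i
    unfolding eip_def using L2_edge_integrable_eip[OF V_ac(2)[OF u i] V_ac(2)[OF v i]]
      L2_edge_integrable_eip[OF potential_L2[OF V_ac(3)[OF u i] i] V_ac(3)[OF v i]]
    by (rule Bochner_Integration.integral_add)
  then show ?thesis
    by (simp add: F_form_def boundary_form_def graph_integral_def dirichlet_def potential_form_def sum.distrib[symmetric])
qed

lemma eip_potential_herm:
  "eip (\<lambda>t. of_real (potential P i t) * v t) u = cnj (eip (\<lambda>t. of_real (potential P i t) * u t) v)"
  unfolding eip_def by (subst Bochner_Integration.integral_cnj[symmetric]) (simp add: mult_ac)

lemma hermitian_form_potential_form: "hermitian_form gscale V potential_form"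
proof
  show "gscale.subspace V" by (rule subspace_V)
  show "potential_form (u + v) w = potential_form u w + potential_form v w" if uvw: "u \<in> V" "v \<in> V" "w \<in> V" for u v w
  proof -
    have "eip (\<lambda>t. of_real (potential P i t) * (u + v) i t) (w i)
      = eip (\<lambda>t. of_real (potential P i t) * u i t) (w i) + eip (\<lambda>t. of_real (potential P i t) * v i t) (w i)"
      if i: "i \<in> {1..K}" for i
    proof -
      have "(\<lambda>t. of_real (potential P i t) * (u + v) i t)
         = (\<lambda>t. of_real (potential P i t) * u i t) + (\<lambda>t. of_real (potential P i t) * v i t)"
        by (auto simp: algebra_simps)
      then show ?thesis
        using E.add_left potential_L2[OF V_ac(3)[OF uvw(1) i] i] potential_L2[OF V_ac(3)[OF uvw(2) i] i]
          V_ac(3)[OF uvw(3) i] by simp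
    qed
    then show ?thesis by (simp add: potential_form_def sum.distrib[symmetric])
  qed
  show "potential_form (gscale c u) w = c * potential_form u w" if uw: "u \<in> V" "w \<in> V" for c u w
  proof -
    have "eip (\<lambda>t. of_real (potential P i t) * gscale c u i t) (w i)
      = c * eip (\<lambda>t. of_real (potential P i t) * u i t) (w i)" if i: "i \<in> {1..K}" for i
      unfolding eip_def by (simp add: gscale_def mult_ac flip: Bochner_Integration.integral_mult_right_zero)
    then show ?thesis by (simp add: potential_form_def sum_distrib_left)
  qed
  show "potential_form v u = cnj (potential_form u v)" for u v
    unfolding potential_form_def cnj_sum by (intro sum.cong refl eip_potential_herm)
qed

lemma H2_ac:
  assumes "x \<in> H2_graph K" "i \<in> {1..K}"
  shows "has_ac_deriv (gderiv x i) (gderiv (gderiv x) i)" "L2_edge (gderiv (gderiv x) i)"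
proof -
  have "AC (gderiv x i)" using assms unfolding H2_graph_def by blast
  then obtain g where "has_ac_deriv (gderiv x i) g" by (auto simp: AC_def)
  then show "has_ac_deriv (gderiv x i) (gderiv (gderiv x) i)"
    using ac_edge_deriv by (simp add: gderiv_def[of "gderiv x"])
  show "L2_edge (gderiv (gderiv x) i)"
    using assms unfolding H2_graph_def by (auto simp: L2_graph_def)
qed

lemma dirichlet_by_parts:
  assumes x: "x \<in> V" and h: "\<And>i. i \<in> {1..K} \<Longrightarrow> has_ac_deriv (gderiv x i) (h i)"
    "\<And>i. i \<in> {1..K} \<Longrightarrow> L2_edge (h i)" and v: "v \<in> V"
  shows "dirichlet x v = boundary_integral K (\<lambda>i t. gderiv x i t * cnj (v i t)) - (\<Sum>i=1..K. eip (h i) (v i))"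
proof -
  have "eip (gderiv x i) (gderiv v i) = gderiv x i 1 * cnj (v i 1) - gderiv x i 0 * cnj (v i 0) - eip (h i) (v i)"
    if i: "i \<in> {1..K}" for i
    using integration_by_parts[OF h(1)[OF i] ac_cnj[OF V_ac(1)[OF v i]]
      L2_edge_integrable_eip[OF h(2)[OF i] V_ac(3)[OF v i]]
      L2_edge_integrable_eip[OF V_ac(2)[OF x i] V_ac(2)[OF v i]]]
    by (simp add: eip_def algebra_simps)
  then show ?thesis by (simp add: dirichlet_def boundary_integral_def sum_subtractf)
qed

lemma boundary_integral_add:
  "boundary_integral K a + boundary_integral K b = boundary_integral K (\<lambda>i t. a i t + b i t)"
  unfolding boundary_integral_def sum.distrib[symmetric] by (intro sum.cong) auto

text \<open>Integration by parts leaves exactly the boundary integral of the co-normal condition,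
  which vanishes when (II) holds.\<close>

lemma F_form_H2:
  assumes x: "x \<in> V" "x \<in> H2_graph K" "satisfies_II P x" and v: "v \<in> V"
  shows "F_form P f x v = ip K (l_expr P x) v"
proof -
  have "boundary_integral K (\<lambda>i t. (f i t * x i t + gderiv x i t) * cnj (v i t)) = 0"
    using conormal x v unfolding conormal_with_def by blast
  then have bd: "boundary_form x v + boundary_integral K (\<lambda>i t. gderiv x i t * cnj (v i t)) = 0"
    unfolding boundary_form_def boundary_integral_add by (simp add: algebra_simps)
  have "eip (l_expr P x i) (v i) = eip (\<lambda>t. of_real (potential P i t) * x i t) (v i) - eip (gderiv (gderiv x) i) (v i)"
    if i: "i \<in> {1..K}" for i
  proof -
    have "l_expr P x i = (\<lambda>t. of_real (potential P i t) * x i t) - gderiv (gderiv x) i"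
      by (auto simp: l_expr_def)
    then show ?thesis
      using E.diff_left[of "\<lambda>t. of_real (potential P i t) * x i t" "gderiv (gderiv x) i" "v i"]
        potential_L2[OF V_ac(3)[OF x(1) i] i] H2_ac(2)[OF x(2) i] V_ac(3)[OF v i] by simp
  qed
  then have "ip K (l_expr P x) v = potential_form x v - (\<Sum>i=1..K. eip (gderiv (gderiv x) i) (v i))"
    by (simp add: ip_eq potential_form_def sum_subtractf)
  moreover have "F_form P f x v = (boundary_form x v + boundary_integral K (\<lambda>i t. gderiv x i t * cnj (v i t)))
      + potential_form x v - (\<Sum>i=1..K. eip (gderiv (gderiv x) i) (v i))"
  proof -
    have "dirichlet x v = boundary_integral K (\<lambda>i t. gderiv x i t * cnj (v i t))
        - (\<Sum>i=1..K. eip (gderiv (gderiv x) i) (v i))"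
      by (rule dirichlet_by_parts[OF x(1) _ _ v]) (use H2_ac[OF x(2)] in blast)+
    then show ?thesis unfolding F_form_eq[OF x(1) v] by simp
  qed
  ultimately show ?thesis using bd by simp
qed

lemma l_expr_L2:
  assumes "x \<in> V" "x \<in> H2_graph K"
  shows "l_expr P x \<in> L2_graph K"
proof -
  have "L2_edge (l_expr P x i)" if i: "i \<in> {1..K}" for i
    using L2_edge_diff[OF potential_L2[OF V_ac(3)[OF assms(1) i] i] H2_ac(2)[OF assms(2) i]]
    by (simp add: l_expr_def)
  then show ?thesis by (simp add: L2_graph_def)
qed

lemma hermite_interpolation:
  fixes a b a' b' :: "nat \<Rightarrow> complex"
  shows "\<exists>x. x \<in> H2_graph K \<and> (\<forall>i\<in>{1..K}. \<exists>g. has_ac_deriv (x i) g \<and> L2_edge g) \<and>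
    (\<forall>i. x i 0 = a i \<and> x i 1 = b i \<and> gderiv x i 0 = a' i \<and> gderiv x i 1 = b' i)"
proof -
  \<comment> \<open>The cubic Hermite polynomial with values \<open>a i\<close>, \<open>b i\<close>
    and slopes \<open>a' i\<close>, \<open>b' i\<close> at the ends; so all end data can be
    prescribed independently.\<close>
  define p where "p i = [:a i, a' i, 3 * (b i - a i) - 2 * a' i - b' i, 2 * (a i - b i) + a' i + b' i:]" for i
  define x :: gfun where "x i = (\<lambda>t. poly (p i) (of_real t))" for i
  have x: "has_ac_deriv (x i) (\<lambda>t. poly (pderiv (p i)) (of_real t))" for i
    unfolding x_def by (rule ac_poly)
  have c: "continuous_on {0..1} (\<lambda>t::real. poly q (of_real t) :: complex)" for q
    by (rule ac_continuous[OF ac_poly])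
  have d: "gderiv x i t = poly (pderiv (p i)) (of_real t)" if "t \<in> {0..1}" for i t
    unfolding gderiv_def by (rule edge_deriv_continuous[OF x c that])
  have x2: "has_ac_deriv (gderiv x i) (\<lambda>t. poly (pderiv (pderiv (p i))) (of_real t))" for i
    by (rule ac_deriv_cong[OF ac_poly[of "pderiv (p i)"] d])
       (auto intro: continuous_imp_measurable_I01 c)
  have L2: "L2_edge (\<lambda>t. poly q (of_real t))" for q by (rule continuous_imp_L2_edge[OF c])
  have "L2_edge (gderiv (gderiv x) i)" for i
    unfolding gderiv_def[of "gderiv x"] by (rule edge_deriv_L2[OF x2 L2])
  then have "x \<in> H2_graph K"
    using x x2 by (auto simp: H2_graph_def AC_def L2_graph_def)
  moreover have "x i 0 = a i" "x i 1 = b i" for i by (simp_all add: x_def p_def)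
  moreover have "gderiv x i 0 = a' i" "gderiv x i 1 = b' i" for i
    using d[of 0 i] d[of 1 i] by (simp_all add: p_def pderiv_pCons algebra_simps)
  ultimately show ?thesis using x L2 by blast
qed

text \<open>Formal self-adjointness only concerns functions that satisfy all the conditions, but every element of
  \<open>V\<close> has the same boundary values as such a function: prescribe the derivative \<open>-fx\<close> at the ends.\<close>

lemma boundary_form_herm:
  assumes x: "x \<in> V" and y: "y \<in> V"
  shows "boundary_form y x = cnj (boundary_form x y)"
proof -
  have ex: "\<exists>w. w \<in> V \<and> w \<in> H2_graph K \<and> satisfies_II P w \<and> (\<forall>i. w i 0 = u i 0 \<and> w i 1 = u i 1)"
    if u: "u \<in> V" for u
  proof -
    obtain w where w: "w \<in> H2_graph K" "\<forall>i\<in>{1..K}. \<exists>g. has_ac_deriv (w i) g \<and> L2_edge g"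
      "\<And>i. w i 0 = u i 0 \<and> w i 1 = u i 1 \<and> gderiv w i 0 = - f i 0 * u i 0 \<and> gderiv w i 1 = - f i 1 * u i 1"
      using hermite_interpolation[of "\<lambda>i. u i 0" "\<lambda>i. u i 1" "\<lambda>i. - f i 0 * u i 0" "\<lambda>i. - f i 1 * u i 1"]
      by blast
    have wV: "w \<in> V"
      using w satisfies_I_ends[of w u] V_I[OF u] by (intro V_intro) auto
    have "boundary_integral K (\<lambda>i t. (f i t * w i t + gderiv w i t) * cnj (v i t)) = 0" for v
      using w(3) by (simp add: boundary_integral_def)
    then have "satisfies_II P w" using conormal wV w(1) unfolding conormal_with_def by blast
    then show ?thesis using w wV by blast
  qed
  obtain X where X: "X \<in> V" "X \<in> H2_graph K" "satisfies_II P X" "\<And>i. X i 0 = x i 0 \<and> X i 1 = x i 1"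
    using ex[OF x] by blast
  obtain Y where Y: "Y \<in> V" "Y \<in> H2_graph K" "satisfies_II P Y" "\<And>i. Y i 0 = y i 0 \<and> Y i 1 = y i 1"
    using ex[OF y] by blast
  have "ip K (l_expr P X) Y = ip K X (l_expr P Y)"
    using setting X Y V_I unfolding graph_bvp_setting_def formally_self_adjoint_def by blast
  also have "\<dots> = cnj (ip K (l_expr P Y) X)"
    by (rule L2.herm) (use l_expr_L2[OF Y(1,2)] X(1) V_sub_L2 in auto)
  finally have "F_form P f X Y = cnj (F_form P f Y X)"
    using F_form_H2[OF X(1-3) Y(1)] F_form_H2[OF Y(1-3) X(1)] by simp
  \<comment> \<open>The Dirichlet and potential parts are Hermitian on their own, so the identity
    for \<open>F\<close> reduces to its boundary part, which depends on end values only.\<close>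
  then have "boundary_form X Y = cnj (boundary_form Y X)"
    unfolding F_form_eq[OF X(1) Y(1)] F_form_eq[OF Y(1) X(1)]
    using D.herm[OF Y(1) X(1)] hermitian_form.herm[OF hermitian_form_potential_form Y(1) X(1)] by simp
  moreover have "boundary_form X Y = boundary_form x y" "boundary_form Y X = boundary_form y x"
    using X(4) Y(4) by (simp_all add: boundary_form_def boundary_integral_def)
  ultimately show ?thesis by simp
qed

lemma hermitian_form_F: "hermitian_form gscale V (F_form P f)"
proof
  interpret p: hermitian_form gscale V potential_form by (rule hermitian_form_potential_form)
  show "gscale.subspace V" by (rule subspace_V)
  have b_add: "boundary_form (u + v) w = boundary_form u w + boundary_form v w" for u v w
    unfolding boundary_form_def boundary_integral_add by (simp add: algebra_simps)
  have b_scale: "boundary_form (gscale c u) w = c * boundary_form u w" for c u w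
    unfolding boundary_form_def boundary_integral_def sum_distrib_left
    by (intro sum.cong) (auto simp: gscale_def algebra_simps)
  show "F_form P f (u + v) w = F_form P f u w + F_form P f v w" if "u \<in> V" "v \<in> V" "w \<in> V" for u v w
    using that by (simp add: F_form_eq b_add D.add_left p.add_left)
  show "F_form P f (gscale c u) w = c * F_form P f u w" if "u \<in> V" "w \<in> V" for c u w
    using that by (simp add: F_form_eq b_scale D.scale_left p.scale_left distrib_left)
  show "F_form P f v u = cnj (F_form P f u v)" if "u \<in> V" "v \<in> V" for u v
    using that boundary_form_herm[OF that] D.herm[OF that] p.herm[OF that] by (simp add: F_form_eq)
qed

sublocale F: hermitian_form gscale V "F_form P f"
  by (rule hermitian_form_F)

text \<open>The trace bound with small \<open>\<eta>\<close> lets the Dirichlet form absorb the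
  boundary part up to the factor one half, at the cost of a large multiple of \<open>S.sq\<close>;
  the bounded potential costs a multiple of \<open>S.sq\<close> only.\<close>

lemma garding:
  "\<exists>k\<ge>0. \<forall>u\<in>V. \<bar>F.sq u - D.sq u\<bar> \<le> D.sq u / 2 + k * S.sq u"
proof -
  obtain B where B: "0 \<le> B" "\<And>i. i \<in> {1..K} \<Longrightarrow> AE t in I01. cmod (of_real (potential P i t)) \<le> B"
    using potential_bound by blast
  define Cf where "Cf = (\<Sum>i=1..K. cmod (f i 0) + cmod (f i 1))"
  have Cf0: "0 \<le> Cf" unfolding Cf_def by (intro sum_nonneg) simp
  have Cf: "cmod (f i 0) \<le> Cf" "cmod (f i 1) \<le> Cf" if i: "i \<in> {1..K}" for i
  proof -
    have "cmod (f i 0) + cmod (f i 1) \<le> Cf"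
      unfolding Cf_def using member_le_sum[OF i, of "\<lambda>i. cmod (f i 0) + cmod (f i 1)"] by simp
    then show "cmod (f i 0) \<le> Cf" "cmod (f i 1) \<le> Cf"
      using norm_ge_zero[of "f i 0"] norm_ge_zero[of "f i 1"] by linarith+
  qed
  \<comment> \<open>Makes \<open>4 * \<eta> * Cf \<le> 1 / 2\<close>, the share charged to the
    Dirichlet form; the summand 2 keeps \<open>\<eta> \<le> 1 / 2\<close>, also for
    \<open>Cf = 0\<close>.\<close>
  define \<eta> where "\<eta> = 1 / (8 * Cf + 2)"
  have \<eta>: "0 < \<eta>" "\<eta> \<le> 1 / 2" using Cf0 by (simp_all add: \<eta>_def field_simps)
  have \<eta>C: "4 * \<eta> * Cf \<le> 1 / 2" using Cf0 by (simp add: \<eta>_def field_simps)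
  define k where "k = Cf * (4 / \<eta>) + B"
  have main: "\<bar>F.sq u - D.sq u\<bar> \<le> D.sq u / 2 + k * S.sq u" if u: "u \<in> V" for u
  proof -
    have tr: "(cmod (u i s))\<^sup>2 \<le> 2 / \<eta> * E.sq (u i) + 2 * \<eta> * E.sq (gderiv u i)"
      if "i \<in> {1..K}" "s \<in> {0..1}" for i s
      by (rule ac_trace_bound[OF V_ac(1,2)[OF u that(1)] that(2) \<eta>])
    have "cmod (boundary_form u u) \<le> (\<Sum>i=1..K. cmod (f i 1 * u i 1 * cnj (u i 1) - f i 0 * u i 0 * cnj (u i 0)))"
      unfolding boundary_form_def boundary_integral_def by (rule norm_sum)
    also have "\<dots> \<le> (\<Sum>i=1..K. Cf * (4 / \<eta>) * E.sq (u i) + Cf * (4 * \<eta>) * E.sq (gderiv u i))"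
    proof (rule sum_mono)
      fix i assume i: "i \<in> {1..K}"
      have one: "cmod (f i s * u i s * cnj (u i s)) \<le> Cf * (2 / \<eta> * E.sq (u i) + 2 * \<eta> * E.sq (gderiv u i))"
        if s: "s = 0 \<or> s = 1" for s
      proof -
        have "cmod (f i s * u i s * cnj (u i s)) = cmod (f i s) * (cmod (u i s))\<^sup>2"
          by (simp add: norm_mult power2_eq_square)
        also have "\<dots> \<le> Cf * (2 / \<eta> * E.sq (u i) + 2 * \<eta> * E.sq (gderiv u i))"
          using Cf[OF i] tr[OF i, of s] s Cf0 by (intro mult_mono) auto
        finally show ?thesis .
      qed
      have "cmod (f i 1 * u i 1 * cnj (u i 1) - f i 0 * u i 0 * cnj (u i 0))
          \<le> cmod (f i 1 * u i 1 * cnj (u i 1)) + cmod (f i 0 * u i 0 * cnj (u i 0))"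
        by (rule norm_triangle_ineq4)
      also have "\<dots> \<le> Cf * (2 / \<eta> * E.sq (u i) + 2 * \<eta> * E.sq (gderiv u i))
          + Cf * (2 / \<eta> * E.sq (u i) + 2 * \<eta> * E.sq (gderiv u i))"
        by (intro add_mono one) auto
      also have "\<dots> = Cf * (4 / \<eta>) * E.sq (u i) + Cf * (4 * \<eta>) * E.sq (gderiv u i)"
        by (simp add: algebra_simps)
      finally show "cmod (f i 1 * u i 1 * cnj (u i 1) - f i 0 * u i 0 * cnj (u i 0))
          \<le> Cf * (4 / \<eta>) * E.sq (u i) + Cf * (4 * \<eta>) * E.sq (gderiv u i)" .
    qed
    also have "\<dots> = Cf * (4 / \<eta>) * S.sq u + Cf * (4 * \<eta>) * D.sq u"
      by (simp add: S_sq D_sq sum.distrib sum_distrib_left)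
    also have "Cf * (4 * \<eta>) * D.sq u \<le> 1 / 2 * D.sq u"
      using \<eta>C D_sq_nonneg[OF u] by (intro mult_right_mono) (simp_all add: mult_ac)
    finally have boundary_form: "cmod (boundary_form u u) \<le> Cf * (4 / \<eta>) * S.sq u + 1 / 2 * D.sq u" by simp
    have "cmod (potential_form u u) \<le> (\<Sum>i=1..K. cmod (eip (\<lambda>t. of_real (potential P i t) * u i t) (u i)))"
      unfolding potential_form_def by (rule norm_sum)
    also have "\<dots> \<le> (\<Sum>i=1..K. B * E.sq (u i))"
    proof (rule sum_mono)
      fix i assume i: "i \<in> {1..K}"
      let ?w = "\<lambda>t. of_real (potential P i t) * u i t"
      have V: "?w \<in> Collect L2_edge" "u i \<in> Collect L2_edge"
        using potential_L2[OF V_ac(3)[OF u i] i] V_ac(3)[OF u i] by auto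
      have "cmod (eip ?w (u i)) \<le> E.nrm ?w * E.nrm (u i)" by (rule E.Cauchy_Schwarz[OF V])
      also have "\<dots> \<le> (B * E.nrm (u i)) * E.nrm (u i)"
        by (intro mult_right_mono E.nrm_nonneg[OF V(2)]
            E_nrm_AE_bounded_mult[OF V_ac(3)[OF u i] potential_measurable[OF i] B(2)[OF i] B(1)])
      also have "\<dots> = B * E.sq (u i)" using E.nrm_power2[OF V(2)] by (simp add: power2_eq_square)
      finally show "cmod (eip ?w (u i)) \<le> B * E.sq (u i)" .
    qed
    also have "\<dots> = B * S.sq u" by (simp add: S_sq sum_distrib_left)
    finally have potential_form: "cmod (potential_form u u) \<le> B * S.sq u" .
    have "F.sq u - D.sq u = Re (boundary_form u u) + Re (potential_form u u)"
      by (simp add: F.sq_def D.sq_def F_form_eq[OF u u])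
    moreover have "\<bar>Re (boundary_form u u) + Re (potential_form u u)\<bar> \<le> cmod (boundary_form u u) + cmod (potential_form u u)"
      using abs_Re_le_cmod[of "boundary_form u u"] abs_Re_le_cmod[of "potential_form u u"] by linarith
    moreover have "k * S.sq u = Cf * (4 / \<eta>) * S.sq u + B * S.sq u"
      by (simp add: k_def algebra_simps)
    ultimately show ?thesis using boundary_form potential_form by linarith
  qed
  have "0 \<le> k" using Cf0 \<eta> B by (simp add: k_def)
  then show ?thesis using main by blast
qed

text \<open>Regularity: test functions on single edges yield the second derivative; integration by
  parts against all of \<open>V\<close> then leaves the co-normal boundary integral, hence (II). The
  multiplier depends on the edge so that it can absorb the sign b: it is \<open>b_weight P i\<close>
  over a number for the indefinite problem, and constant for the lowest eigenvalue of L.\<close>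

lemma weak_solution:
  assumes y: "y \<in> V"
    and weak: "\<And>v. v \<in> V \<Longrightarrow> F_form P f y v = (\<Sum>i=1..K. c i * eip (y i) (v i))"
  shows "y \<in> dom_L P" and "\<And>i. i \<in> {1..K} \<Longrightarrow> AE t in I01. l_expr P y i t = c i * y i t"
proof -
  \<comment> \<open>The second derivative that the equation prescribes.\<close>
  define h where "h i t = of_real (potential P i t) * y i t - c i * y i t" for i t
  have L2q: "L2_edge (\<lambda>t. of_real (potential P i t) * y i t)" if i: "i \<in> {1..K}" for i
    using potential_L2 V_ac(3)[OF y i] i by blast
  have L2h: "L2_edge (h i)" if i: "i \<in> {1..K}" for i
    unfolding h_def[abs_def] by (intro L2_edge_diff L2q L2_edge_scale V_ac(3)[OF y i] i)
  have eip_h: "eip (h i) w = eip (\<lambda>t. of_real (potential P i t) * y i t) w - c i * eip (y i) w"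
    if i: "i \<in> {1..K}" and w: "L2_edge w" for i w
  proof -
    have "h i = (\<lambda>t. of_real (potential P i t) * y i t) - escale (c i) (y i)"
      by (auto simp: h_def escale_def)
    then show ?thesis
      using E.diff_left[of "\<lambda>t. of_real (potential P i t) * y i t" "escale (c i) (y i)" w]
        E.scale_left[of "y i" w "c i"] E.V_scale[of "y i" "c i"] L2q[OF i] V_ac(3)[OF y i] w by simp
  qed
  have weak_sum: "boundary_form y v + (\<Sum>i=1..K. eip (gderiv y i) (gderiv v i) + eip (h i) (v i)) = 0" if v: "v \<in> V" for v
  proof -
    have "(\<Sum>i=1..K. eip (gderiv y i) (gderiv v i) + eip (h i) (v i))
      = (\<Sum>i=1..K. eip (gderiv y i) (gderiv v i) + eip (\<lambda>t. of_real (potential P i t) * y i t) (v i)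
          - c i * eip (y i) (v i))"
      by (intro sum.cong refl) (simp add: eip_h V_ac(3)[OF v])
    also have "\<dots> = dirichlet y v + potential_form y v - (\<Sum>i=1..K. c i * eip (y i) (v i))"
      by (simp add: dirichlet_def potential_form_def sum.distrib sum_subtractf)
    finally show ?thesis using weak[OF v] F_form_eq[OF y v] by (simp add: add_diff_eq)
  qed
  have "\<exists>k. has_ac_deriv k (h i) \<and> (AE t in I01. gderiv y i t = k t)" if i: "i \<in> {1..K}" for i
  proof (rule weak_derivative[OF V_ac(2)[OF y i] L2h[OF i]])
    fix v g assume v: "has_ac_deriv v g" "L2_edge g" "v 0 = 0" "v 1 = 0"
    let ?v = "single i v"
    have vV: "?v \<in> V" by (rule single_V[OF v])
    have L2v: "L2_edge v" by (rule continuous_imp_L2_edge[OF ac_continuous[OF v(1)]])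
    have "boundary_form y ?v = 0" using v by (auto simp: boundary_form_def boundary_integral_def single_def intro!: sum.neutral)
    moreover have "eip (gderiv y j) (gderiv ?v j) + eip (h j) (?v j)
        = (if j = i then eip (gderiv y i) g + eip (h i) v else 0)" if j: "j \<in> {1..K}" for j
    proof (cases "j = i")
      case True
      have "eip (gderiv y i) (gderiv ?v i) = eip (gderiv y i) g"
        using gderiv_AE[where u = ?v and i = i and g = g] v V_ac(2)[OF y i] V_ac(2)[OF vV i]
        by (intro eip_cong_AE) (auto simp: single_def)
      then show ?thesis using True by (simp add: single_def)
    next
      case False
      have "AE t in I01. gderiv ?v j t = 0"
        using gderiv_AE[where u = ?v and i = j and g = "\<lambda>_. 0"] ac_const[of 0] False by (simp add: single_def)
      then have "eip (gderiv y j) (gderiv ?v j) = eip (gderiv y j) (\<lambda>_. 0)"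
        using V_ac(2)[OF y j] V_ac(2)[OF vV j] L2_edge_zero by (intro eip_cong_AE) auto
      then show ?thesis using False by (simp add: single_def eip_def)
    qed
    ultimately have "0 = (\<Sum>j=1..K. if j = i then eip (gderiv y i) g + eip (h i) v else 0)"
      using weak_sum[OF vV] by simp
    then show "eip (gderiv y i) g + eip (h i) v = 0" using i by simp
  qed
  then obtain k where k: "\<And>i. i \<in> {1..K} \<Longrightarrow> has_ac_deriv (k i) (h i)"
    "\<And>i. i \<in> {1..K} \<Longrightarrow> AE t in I01. gderiv y i t = k i t" by metis
  \<comment> \<open>Equality at every point of the edge, because \<open>gderiv\<close> takes the
    continuous representative; absolute continuity of \<open>gderiv y\<close> and its end values
    rest on this.\<close>
  have d: "gderiv y i t = k i t" if i: "i \<in> {1..K}" and t: "t \<in> {0..1}" for i t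
  proof -
    have ck: "continuous_on {0..1} (k i)" by (rule ac_continuous[OF k(1)[OF i]])
    have "AE t in I01. k i t = gderiv y i t" using k(2)[OF i] by (rule eventually_mono) simp
    then have "has_ac_deriv (y i) (k i)"
      by (intro ac_deriv_cong[OF V_ac(1)[OF y i]] continuous_imp_measurable_I01 ck) auto
    then show ?thesis unfolding gderiv_def using ck t by (rule edge_deriv_continuous)
  qed
  have dd: "has_ac_deriv (gderiv y i) (h i)" if i: "i \<in> {1..K}" for i
    using L2h[OF i] by (intro ac_deriv_cong[OF k(1)[OF i] d[OF i]]) (auto simp: L2_edge_def)
  have d2: "AE t in I01. gderiv (gderiv y) i t = h i t" if i: "i \<in> {1..K}" for i
    by (rule gderiv_AE[where u = "gderiv y", OF dd[OF i]])
  have "L2_edge (gderiv (gderiv y) i)" if i: "i \<in> {1..K}" for i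
    unfolding gderiv_def[of "gderiv y"] by (rule edge_deriv_L2[OF dd[OF i] L2h[OF i]])
  then have H2: "y \<in> H2_graph K"
    using V_ac(1)[OF y] dd unfolding H2_graph_def AC_def L2_graph_def by blast
  have "boundary_integral K (\<lambda>i t. (f i t * y i t + gderiv y i t) * cnj (v i t)) = 0" if v: "v \<in> V" for v
  proof -
    have "boundary_form y v + (dirichlet y v + (\<Sum>i=1..K. eip (h i) (v i))) = 0"
      using weak_sum[OF v] by (simp add: dirichlet_def sum.distrib)
    moreover have "dirichlet y v = boundary_integral K (\<lambda>i t. gderiv y i t * cnj (v i t))
        - (\<Sum>i=1..K. eip (h i) (v i))"
      by (rule dirichlet_by_parts[OF y _ _ v]) (use dd L2h in blast)+
    ultimately have "boundary_form y v + boundary_integral K (\<lambda>i t. gderiv y i t * cnj (v i t)) = 0"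
      by simp
    then show ?thesis unfolding boundary_form_def boundary_integral_add by (simp add: algebra_simps)
  qed
  then have II: "satisfies_II P y" using conormal y H2 unfolding conormal_with_def by blast
  show "y \<in> dom_L P"
    unfolding dom_L_def AC_def using V_ac(1)[OF y] dd l_expr_L2[OF y H2] V_I[OF y] II by blast
  show "AE t in I01. l_expr P y i t = c i * y i t" if i: "i \<in> {1..K}" for i
    using d2[OF i] by (rule eventually_mono) (simp add: l_expr_def h_def)
qed

lemma unbounded_ratio: "\<exists>x\<in>V. 0 < S.sq x \<and> B * S.sq x < D.sq x"
proof -
  have "1 \<le> K" using setting by (simp add: graph_bvp_setting_def)
  then have i: "1 \<in> {1..K}" by simp
  obtain n where n: "B < 256 ^ n" using real_arch_pow[of 256 B] by auto
  obtain v h where v: "has_ac_deriv v h" "L2_edge h" "v 0 = 0" "v 1 = 0" "0 < E.sq v" "256 ^ n * E.sq v \<le> E.sq h"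
    using unbounded_derivative[of n] by blast
  let ?x = "single 1 v"
  have x: "?x \<in> V" by (rule single_V[OF v(1-4)])
  have z: "E.sq (\<lambda>_. 0) = 0" by (simp add: E_sq)
  have "S.sq ?x = (\<Sum>j=1..K. if j = 1 then E.sq v else 0)"
    unfolding S_sq by (intro sum.cong) (auto simp: single_def z)
  then have S: "S.sq ?x = E.sq v" using i by simp
  have "E.sq (gderiv ?x 1) = E.sq h"
    by (rule E_sq_gderiv[OF x i _ v(2)]) (simp add: single_def v(1))
  then have "E.sq h \<le> D.sq ?x" using E_sq_le_D[OF x i] by simp
  moreover have "B * E.sq v < 256 ^ n * E.sq v" using n v(5) by simp
  ultimately have "B * S.sq ?x < D.sq ?x" unfolding S using v(6) by (meson less_le_trans order_trans)
  then show ?thesis using x S v(5) by (intro bexI[of _ ?x]) simp_all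
qed

end

section \<open>The eigenfunction expansion\<close>

context bvp
begin

lemma S_sq_pos_nontrivial:
  assumes "S.sq y \<noteq> 0"
  shows "nontrivial P y"
proof (rule ccontr)
  assume "\<not> nontrivial P y"
  then have z: "y i t = 0" if "i \<in> {1..K}" "t \<in> {0..1}" for i t
    using that unfolding nontrivial_def by blast
  have "E.sq (y i) = 0" if i: "i \<in> {1..K}" for i
    unfolding E_sq by (rule integral_eq_zero_AE) (auto simp: z[OF i] intro!: AE_I2)
  then show False using assms by (simp add: S_sq)
qed

definition W :: "gfun \<Rightarrow> gfun" where
  "W x = (\<lambda>i. escale (b_weight P i) (vanish_op (x i)))"

lemma b_weight_norm [simp]: "cmod (b_weight P i) = 1"
  by (simp add: b_weight_def)

lemma b_weight_mult [simp]: "b_weight P i * b_weight P i = 1" "cnj (b_weight P i) = b_weight P i"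
  by (simp_all add: b_weight_def)

lemma indef_ip_eq: "indef_ip P u v = (\<Sum>i=1..K. b_weight P i * eip (u i) (v i))"
  by (simp add: indef_ip_def ip_eq B_op_def eip_def mult.assoc)

text \<open>\<open>166 = 162 + 4\<close>, with \<open>162 = 2 * 9\<^sup>2\<close> from
  \<open>ac_vanish_op\<close> and \<open>4 = 2\<^sup>2\<close> from
  \<open>nrm_vanish_op\<close>.\<close>

lemma W_V:
  assumes x: "x \<in> V"
  shows "W x \<in> V" and "D.sq (W x) + S.sq (W x) \<le> 166 * (D.sq x + S.sq x)"
proof -
  have ex: "\<exists>h. has_ac_deriv (W x i) h \<and> L2_edge h \<and> E.sq h \<le> 162 * (E.sq (x i) + E.sq (gderiv x i))"
    if i: "i \<in> {1..K}" for i
  proof -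
    obtain h where h: "has_ac_deriv (vanish_op (x i)) h" "L2_edge h"
      "E.nrm h \<le> 9 * (E.nrm (x i) + E.nrm (gderiv x i))"
      using ac_vanish_op[OF V_ac(1,2)[OF x i]] by blast
    have V: "h \<in> Collect L2_edge" "x i \<in> Collect L2_edge" "gderiv x i \<in> Collect L2_edge"
      using h(2) V_ac(2,3)[OF x i] by auto
    have "(E.nrm h)\<^sup>2 \<le> (9 * (E.nrm (x i) + E.nrm (gderiv x i)))\<^sup>2"
      by (intro power_mono h E.nrm_nonneg V)
    also have "\<dots> = 81 * (E.nrm (x i) + E.nrm (gderiv x i))\<^sup>2" unfolding power_mult_distrib by simp
    also have "(E.nrm (x i) + E.nrm (gderiv x i))\<^sup>2 \<le> 2 * ((E.nrm (x i))\<^sup>2 + (E.nrm (gderiv x i))\<^sup>2)"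
      using sum_squares_bound[of "E.nrm (x i)" "E.nrm (gderiv x i)"] by (simp add: power2_sum)
    finally have "E.sq h \<le> 162 * (E.sq (x i) + E.sq (gderiv x i))"
      using V by (simp add: E.nrm_power2 del: mem_Collect_eq)
    then show ?thesis
      using ac_scale[OF h(1), of "b_weight P i"] E.V_scale[OF V(1), of "b_weight P i"] E.sq_scale[OF V(1), of "b_weight P i"]
      by (intro exI[of _ "escale (b_weight P i) h"]) (simp add: W_def escale_def)
  qed
  show WV: "W x \<in> V"
    using ex by (intro V_zero_ends) (auto simp: W_def escale_def vanish_op_ends)
  have "E.sq (gderiv (W x) i) \<le> 162 * (E.sq (x i) + E.sq (gderiv x i))" if i: "i \<in> {1..K}" for i
    using ex[OF i] E_sq_gderiv[OF WV i] by auto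
  then have "D.sq (W x) \<le> (\<Sum>i=1..K. 162 * (E.sq (x i) + E.sq (gderiv x i)))"
    unfolding D_sq by (intro sum_mono)
  also have "\<dots> = 162 * (S.sq x + D.sq x)"
    by (simp add: S_sq D_sq sum.distrib sum_distrib_left)
  finally have 1: "D.sq (W x) \<le> 162 * (S.sq x + D.sq x)" .
  have "E.sq (W x i) \<le> 4 * E.sq (x i)" if i: "i \<in> {1..K}" for i
  proof -
    have V: "x i \<in> Collect L2_edge" "vanish_op (x i) \<in> Collect L2_edge"
      using V_ac(3)[OF x i] L2_vanish_op by auto
    have "(E.nrm (vanish_op (x i)))\<^sup>2 \<le> (2 * E.nrm (x i))\<^sup>2"
      using nrm_vanish_op[OF V_ac(3)[OF x i]] by (intro power_mono E.nrm_nonneg V)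
    then have "E.sq (vanish_op (x i)) \<le> 4 * E.sq (x i)"
      using V by (simp add: power_mult_distrib del: mem_Collect_eq)
    then show ?thesis unfolding W_def E.sq_scale[OF V(2)] by simp
  qed
  then have "S.sq (W x) \<le> (\<Sum>i=1..K. 4 * E.sq (x i))"
    unfolding S_sq by (intro sum_mono)
  also have "\<dots> = 4 * S.sq x" by (simp add: S_sq sum_distrib_left)
  finally have "S.sq (W x) \<le> 4 * S.sq x" .
  then show "D.sq (W x) + S.sq (W x) \<le> 166 * (D.sq x + S.sq x)"
    using 1 D_sq_nonneg[OF x] by (simp add: algebra_simps)
qed

lemma hermitian_form_indef: "hermitian_form gscale V (indef_ip P)"
proof
  have V: "u i \<in> Collect L2_edge" if "u \<in> V" "i \<in> {1..K}" for u i
    using V_ac(3)[OF that] by simp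
  show "gscale.subspace V" by (rule subspace_V)
  show "indef_ip P (u + v) w = indef_ip P u w + indef_ip P v w" if uvw: "u \<in> V" "v \<in> V" "w \<in> V" for u v w
    unfolding indef_ip_eq sum.distrib[symmetric]
    using E.add_left[OF V[OF uvw(1)] V[OF uvw(2)] V[OF uvw(3)]] by (intro sum.cong) (simp_all add: distrib_left)
  show "indef_ip P (gscale c u) w = c * indef_ip P u w" if uw: "u \<in> V" "w \<in> V" for c u w
    unfolding indef_ip_eq sum_distrib_left
    using E.scale_left[OF V[OF uw(1)] V[OF uw(2)]] by (intro sum.cong) (simp_all add: gscale_apply)
  show "indef_ip P v u = cnj (indef_ip P u v)" if uv: "u \<in> V" "v \<in> V" for u v
    unfolding indef_ip_eq cnj_sum
    using E.herm[OF V[OF uv(1)] V[OF uv(2)]] by (intro sum.cong) simp_all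
qed

lemma indef_ip_le:
  assumes u: "u \<in> V" and v: "v \<in> V"
  shows "cmod (indef_ip P u v) \<le> S.nrm u * S.nrm v"
proof -
  have B: "B_op P u i = escale (b_weight P i) (u i)" for i by (auto simp: B_op_def escale_def)
  have Vi: "u i \<in> Collect L2_edge" if "i \<in> {1..K}" for i using V_ac(3)[OF u that] by simp
  have "B_op P u \<in> L2_graph K"
    using E.V_scale[OF Vi] by (auto simp: L2_graph_def B)
  moreover have "S.sq (B_op P u) = S.sq u"
    unfolding S_sq B using E.sq_scale[OF Vi] by (intro sum.cong) auto
  ultimately show ?thesis
    using L2.Cauchy_Schwarz[of "B_op P u" K v] V_sub_L2 v by (auto simp: indef_ip_def L2.nrm_def)
qed

lemma W_symmetric:
  assumes "x \<in> V" "v \<in> V"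
  shows "indef_ip P (W x) v = indef_ip P x (W v)"
proof -
  have Vi: "u i \<in> Collect L2_edge" "vanish_op (u i) \<in> Collect L2_edge" if "u \<in> V" "i \<in> {1..K}" for u i
    using V_ac(3)[OF that] L2_vanish_op by auto
  have "b_weight P i * eip (W x i) (v i) = b_weight P i * eip (x i) (W v i)" if i: "i \<in> {1..K}" for i
    using Vi[OF assms(1) i] Vi[OF assms(2) i] vanish_op_symmetric[OF V_ac(3)[OF assms(1) i] V_ac(3)[OF assms(2) i]]
    by (simp only: W_def E.scale_left E.scale_right b_weight_mult)
  then show ?thesis unfolding indef_ip_eq by (intro sum.cong) auto
qed

text \<open>The sign in \<open>W\<close> cancels the sign in the indefinite product, and positivity
  of \<open>vanish_op\<close> remains on every edge.\<close>

lemma W_positive: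
  assumes x: "x \<in> V"
  shows "1 / 17 * S.sq x \<le> Re (indef_ip P (W x) x)"
proof -
  have Vi: "x i \<in> Collect L2_edge" "vanish_op (x i) \<in> Collect L2_edge" if "i \<in> {1..K}" for i
    using V_ac(3)[OF x that] L2_vanish_op by auto
  have "b_weight P i * eip (W x i) (x i) = eip (vanish_op (x i)) (x i)" if i: "i \<in> {1..K}" for i
    using Vi[OF i] by (simp only: W_def E.scale_left mult.assoc[symmetric] b_weight_mult mult_1)
  then have "Re (indef_ip P (W x) x) = (\<Sum>i=1..K. Re (eip (vanish_op (x i)) (x i)))"
    by (simp add: indef_ip_eq)
  moreover have "(\<Sum>i=1..K. E.sq (x i) / 17) \<le> (\<Sum>i=1..K. Re (eip (vanish_op (x i)) (x i)))"
    using vanish_op_positive[OF V_ac(3)[OF x]] by (intro sum_mono)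
  ultimately show ?thesis by (simp add: S_sq sum_divide_distrib)
qed

text \<open>By continuity a function in \<open>V\<close> that is null in L2 vanishes at every point
  of the edges, so its derivative is null as well; \<open>garding\<close> transfers this to
  \<open>F\<close>.\<close>

lemma S_null_imp_F_null:
  assumes x: "x \<in> V" and 0: "S.sq x = 0"
  shows "F.sq x = 0"
proof -
  have z: "x i t = 0" if i: "i \<in> {1..K}" and t: "t \<in> {0..1}" for i t
  proof -
    have "E.sq (x i) = 0"
      using E_sq_le_S[OF x i] 0 E.sq_nonneg[of "x i"] V_ac(3)[OF x i] by simp
    then have "AE t in I01. x i t = 0" using E_sq_eq_0_iff[OF V_ac(3)[OF x i]] by simp
    then show ?thesis
      by (intro AE_eq_imp_eq_continuous[OF ac_continuous[OF V_ac(1)[OF x i]] continuous_on_const[of _ 0] _ t])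
  qed
  have "E.sq (gderiv x i) = 0" if i: "i \<in> {1..K}" for i
  proof -
    have "has_ac_deriv (x i) (\<lambda>_. 0)"
      by (rule ac_deriv_cong[OF ac_const[of 0]]) (auto simp: z[OF i])
    then have "E.sq (gderiv x i) = E.sq (\<lambda>_. 0)" by (rule E_sq_gderiv[OF x i _ L2_edge_zero])
    then show ?thesis by (simp add: E_sq)
  qed
  then have "D.sq x = 0" by (simp add: D_sq)
  then show ?thesis using garding x 0 by fastforce
qed

text \<open>If \<open>x\<close> is orthogonal to the test functions on single edges,
  \<open>weak_derivative\<close> for the pair of 0 and \<open>x\<close> says that \<open>x\<close>
  is a derivative of the zero function.\<close>

lemma V_dense:
  assumes u: "u \<in> L2_graph K" and e: "0 < e"
  shows "\<exists>d\<in>V. L2.sq K (u - d) < e"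
proof (rule L2.dense_if_orthogonal_complement_null[OF L2_graph_complete subspace_V V_sub_L2 _ u e])
  fix x assume x: "x \<in> L2_graph K" and ortho: "\<And>d. d \<in> V \<Longrightarrow> ip K x d = 0"
  have "E.sq (x i) = 0" if i: "i \<in> {1..K}" for i
  proof -
    have L2x: "L2_edge (x i)" by (rule L2_graphD[OF x i])
    have "\<exists>k. has_ac_deriv k (x i) \<and> (AE t in I01. 0 = k t)"
    proof (rule weak_derivative[OF L2_edge_zero L2x])
      fix v h assume v: "has_ac_deriv v h" "L2_edge h" "v 0 = 0" "v 1 = 0"
      have "ip K x (single i v) = (\<Sum>j=1..K. if j = i then eip (x i) v else 0)"
        unfolding ip_eq by (intro sum.cong) (auto simp: single_def eip_def)
      then have "eip (x i) v = 0" using ortho[OF single_V[OF v]] i by simp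
      then show "eip (\<lambda>_. 0) h + eip (x i) v = 0" by (simp add: eip_def)
    qed
    then obtain k where k: "has_ac_deriv k (x i)" "AE t in I01. 0 = k t" by blast
    have "k t = 0" if "t \<in> {0..1}" for t
      using AE_eq_imp_eq_continuous[OF continuous_on_const ac_continuous[OF k(1)] k(2) that] by simp
    then have "has_ac_deriv k (\<lambda>_. 0)" by (intro ac_deriv_cong[OF ac_const[of 0]]) auto
    from ac_deriv_unique[OF k(1) this] show ?thesis using E_sq_eq_0_iff[OF L2x] by simp
  qed
  then show "L2.sq K x = 0" by (simp add: ip_sq)
qed

text \<open>A lower bound for \<open>F\<close>: its lowest eigenvalue, which exists by compactness for \<open>F\<close> shifted by
  a multiple of the inner product, is an eigenvalue of \<open>L\<close>.\<close>

lemma F_coercive: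
  assumes posdef: "L_positive_definite P"
  shows "\<exists>c>0. \<forall>u\<in>V. c * (D.sq u + S.sq u) \<le> F.sq u"
proof -
  obtain k0 where k0: "0 \<le> k0" "\<And>u. u \<in> V \<Longrightarrow> \<bar>F.sq u - D.sq u\<bar> \<le> D.sq u / 2 + k0 * S.sq u"
    using garding by blast
  \<comment> \<open>One more than the constant of \<open>garding\<close>, so that the shifted form
    dominates half the squared Sobolev norm.\<close>
  define k where "k = k0 + 1"
  define G where "G = (\<lambda>u v. of_real 1 * F_form P f u v + of_real k * ip K u v)"
  have Gh: "hermitian_form gscale V G"
    unfolding G_def by (rule hermitian_form_lincomb[OF hermitian_form_F S.hermitian_form_axioms])
  interpret G: hermitian_form gscale V G by (rule Gh)
  have Gsq: "G.sq u = F.sq u + k * S.sq u" for u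
    unfolding G.sq_def F.sq_def S.sq_def by (simp add: G_def)
  have G_lower: "1 / 2 * (D.sq u + S.sq u) \<le> G.sq u" if u: "u \<in> V" for u
  proof -
    have "k * S.sq u = k0 * S.sq u + S.sq u" by (simp add: k_def algebra_simps)
    then show ?thesis
      using k0(2)[OF u] S_sq_nonneg[OF u] unfolding Gsq by (simp add: abs_le_iff algebra_simps)
  qed
  have G_upper: "G.sq u \<le> (3 / 2 + k0 + k) * (D.sq u + S.sq u)" if u: "u \<in> V" for u
  proof -
    have "F.sq u \<le> 3 / 2 * D.sq u + k0 * S.sq u" using k0(2)[OF u] by linarith
    moreover have "0 \<le> k0 * D.sq u" "0 \<le> k * D.sq u" "0 \<le> S.sq u"
      using k0(1) D_sq_nonneg[OF u] S_sq_nonneg[OF u] by (auto simp: k_def)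
    ultimately show ?thesis unfolding Gsq by (simp add: algebra_simps)
  qed
  interpret CE: compact_embedding gscale V G "ip K" "1 / (1 / 2)"
    by (rule compact_embedding_if_equivalent[OF Gh _ G_lower G_upper]) simp_all
  interpret CF: compact_form gscale V G "ip K" "1 / (1 / 2)" "ip K"
    by standard (rule S.Cauchy_Schwarz)
  \<comment> \<open>Maximising \<open>S.sq\<close> relative to \<open>G.sq\<close> is minimising
    \<open>F.sq\<close> relative to \<open>S.sq\<close>: if the maximum is \<open>m\<close>, the
    minimum is \<open>1 / m - k\<close>.\<close>
  have "\<exists>y\<in>V. \<exists>m::real. m \<noteq> 0 \<and> G.sq y = 1 \<and> (\<forall>v\<in>V. ip K y v = of_real m * G y v)
    \<and> (\<forall>u\<in>V. \<bar>S.sq u\<bar> \<le> \<bar>m\<bar> * G.sq u)"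
  proof (rule CF.maximum_attained_abs[OF subspace_V order_refl])
    show "\<exists>x\<in>V. S.sq x \<noteq> 0" using unbounded_ratio[of 0] by force
  qed
  then obtain y m where y: "y \<in> V" "m \<noteq> 0" "G.sq y = 1"
    "\<And>v. v \<in> V \<Longrightarrow> ip K y v = of_real m * G y v" "\<And>u. u \<in> V \<Longrightarrow> \<bar>S.sq u\<bar> \<le> \<bar>m\<bar> * G.sq u"
    by auto
  have "S.sq y = m * G.sq y" unfolding S.sq_def G.sq_def y(4)[OF y(1)] by simp
  then have Sy: "S.sq y = m" using y(3) by simp
  then have m: "0 < m" using y(2) S_sq_nonneg[OF y(1)] by simp
  define \<kappa> where "\<kappa> = 1 / m - k"
  have Fy: "F_form P f y v = (\<Sum>i=1..K. of_real \<kappa> * eip (y i) (v i))" if v: "v \<in> V" for v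
  proof -
    have "G y v = of_real (1 / m) * ip K y v" using y(4)[OF v] m by simp
    then have "F_form P f y v = of_real \<kappa> * ip K y v"
      by (simp add: G_def \<kappa>_def algebra_simps)
    then show ?thesis by (simp add: ip_eq sum_distrib_left)
  qed
  have weak: "y \<in> dom_L P"
    "\<And>i. i \<in> {1..K} \<Longrightarrow> AE t in I01. l_expr P y i t = of_real \<kappa> * y i t"
    using weak_solution[OF y(1), of "\<lambda>_. of_real \<kappa>"] Fy by blast+
  \<comment> \<open>Positive definiteness enters at this single eigenfunction of L: it makes the
    lowest eigenvalue \<open>\<kappa>\<close> positive.\<close>
  have "0 < Re (ip K (l_expr P y) y)"
    using posdef weak(1) S_sq_pos_nontrivial[of y] Sy m unfolding L_positive_definite_def by auto
  also have "ip K (l_expr P y) y = of_real \<kappa> * ip K y y"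
  proof -
    have "eip (l_expr P y i) (y i) = of_real \<kappa> * eip (y i) (y i)" if i: "i \<in> {1..K}" for i
    proof -
      have "L2_edge (l_expr P y i)" using weak(1) i by (simp add: dom_L_def L2_graph_def)
      then have "eip (l_expr P y i) (y i) = eip (escale (of_real \<kappa>) (y i)) (y i)"
        using weak(2)[OF i] V_ac(3)[OF y(1) i] E.V_scale[of "y i" "of_real \<kappa>"]
        by (intro eip_cong_AE) (auto simp: escale_def)
      then show ?thesis using E.scale_left[of "y i" "y i"] V_ac(3)[OF y(1) i] by simp
    qed
    then show ?thesis by (simp add: ip_eq sum_distrib_left)
  qed
  also have "Re (of_real \<kappa> * ip K y y) = \<kappa> * m" using Sy by (simp add: S.sq_def)
  finally have \<kappa>: "0 < \<kappa>" using m by (simp add: zero_less_mult_iff)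
  have F_S: "\<kappa> * S.sq u \<le> F.sq u" if u: "u \<in> V" for u
  proof -
    have "S.sq u \<le> m * (F.sq u + k * S.sq u)"
      using y(5)[OF u] m S_sq_nonneg[OF u] by (simp add: Gsq)
    then have "1 / m * S.sq u \<le> F.sq u + k * S.sq u" using m by (simp add: field_simps)
    then show ?thesis by (simp add: \<kappa>_def left_diff_distrib)
  qed
  \<comment> \<open>As \<open>\<kappa> * S.sq u \<le> F.sq u\<close>, the shift
    \<open>k * S.sq u\<close> is at most \<open>k / \<kappa> * F.sq u\<close>, and so
    \<open>G.sq u \<le> C * F.sq u\<close>.\<close>
  define C where "C = 1 + k / \<kappa>"
  have C: "0 < C" using \<kappa> k0 by (simp add: C_def k_def add_pos_nonneg)
  have "1 / (2 * C) * (D.sq u + S.sq u) \<le> F.sq u" if u: "u \<in> V" for u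
  proof -
    have "k * S.sq u \<le> k / \<kappa> * F.sq u"
      using mult_left_mono[OF F_S[OF u], of "k / \<kappa>"] \<kappa> k0(1) by (simp add: k_def)
    then have "G.sq u \<le> C * F.sq u" unfolding Gsq by (simp add: C_def algebra_simps)
    then have "1 / 2 * (D.sq u + S.sq u) \<le> C * F.sq u" using G_lower[OF u] by linarith
    then show ?thesis using C by (simp add: field_simps)
  qed
  then show ?thesis using C by (intro exI[of _ "1 / (2 * C)"]) auto
qed

end

lemma sum_gfun_apply: "(\<Sum>n\<in>A. (g n :: gfun)) i t = (\<Sum>n\<in>A. g n i t)"
  by (induction A rule: infinite_finite_induct) auto

lemma lincomb_eq: "lincomb N c y = (\<Sum>n<N. gscale (c n) (y n))"
  by (intro ext) (simp add: lincomb_def sum_gfun_apply gscale_def)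

lemma gdiff_eq: "gdiff u v = u - v"
  by (intro ext) (simp add: gdiff_def)

theorem theorem5p3:
  fixes P :: "'v graph_bvp"
    and f :: "nat \<Rightarrow> real \<Rightarrow> complex"
  assumes "graph_bvp_setting P"
    and "conormal_with P f"
    and "L_positive_definite P"
  shows "\<exists>(\<mu> :: nat \<Rightarrow> complex) (y :: nat \<Rightarrow> nat \<Rightarrow> real \<Rightarrow> complex).
           (\<forall>n. eigenfunction P (\<mu> n) (y n)) \<and>
           orthonormal_basis_wrt (F_form P f) (dom_F P) y \<and>
           riesz_basis_L2 (nedges P) (\<lambda>n. normalised (nedges P) (y n)) \<and>
           (\<forall>m n. m \<noteq> n \<longrightarrow> indef_ip P (y m) (y n) = 0)"
proof -
  interpret bvp P f by unfold_locales fact+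
  obtain c where c: "0 < c" "\<And>u. u \<in> V \<Longrightarrow> c * (D.sq u + S.sq u) \<le> F.sq u"
    using F_coercive[OF assms(3)] by blast
  obtain k0 where k0: "0 \<le> k0" "\<And>u. u \<in> V \<Longrightarrow> \<bar>F.sq u - D.sq u\<bar> \<le> D.sq u / 2 + k0 * S.sq u"
    using garding by blast
  define C where "C = 3 / 2 + k0"
  have C0: "0 < C" using k0(1) by (simp add: C_def)
  have F_upper: "F.sq u \<le> C * (D.sq u + S.sq u)" if u: "u \<in> V" for u
  proof -
    have "F.sq u \<le> 3 / 2 * D.sq u + k0 * S.sq u" using k0(2)[OF u] by linarith
    moreover have "0 \<le> k0 * D.sq u" "0 \<le> S.sq u"
      using k0(1) D_sq_nonneg[OF u] S_sq_nonneg[OF u] by auto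
    ultimately show ?thesis by (simp add: C_def algebra_simps)
  qed
  interpret CE: compact_embedding gscale V "F_form P f" "ip K" "1 / c"
    by (rule compact_embedding_if_equivalent[OF hermitian_form_F c F_upper])
  interpret CF: compact_form gscale V "F_form P f" "ip K" "1 / c" "indef_ip P"
    by (intro compact_form.intro CE.compact_embedding_axioms hermitian_form_indef compact_form_axioms.intro indef_ip_le)
  \<comment> \<open>Test with \<open>W x\<close>: symmetry moves \<open>W\<close> to the first
    argument, where positivity bounds \<open>S.sq x\<close>.\<close>
  have nondegenerate: "F.sq x = 0" if x: "x \<in> V" and 0: "\<And>v. v \<in> V \<Longrightarrow> indef_ip P x v = 0" for x
  proof -
    have "indef_ip P (W x) x = 0" using 0[OF W_V(1)[OF x]] W_symmetric[OF x x] by simp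
    then have "S.sq x = 0" using W_positive[OF x] S_sq_nonneg[OF x] by simp
    then show ?thesis by (rule S_null_imp_F_null[OF x])
  qed
  have "\<exists>z. \<forall>n. CF.eigen_step z n"
  proof (rule CF.eigen_sequence)
    fix B :: real
    \<comment> \<open>The factor \<open>B / c\<close> allows for the passage to \<open>F\<close>,
      which dominates \<open>c\<close> times the Dirichlet form.\<close>
    obtain x where x: "x \<in> V" "0 < S.sq x" "(B / c) * S.sq x < D.sq x"
      using unbounded_ratio by blast
    have "B * S.sq x = c * ((B / c) * S.sq x)" using c(1) by simp
    also have "\<dots> < c * D.sq x" using x(3) c(1) by (simp only: mult_less_cancel_left_pos)
    also have "\<dots> \<le> c * (D.sq x + S.sq x)" using c(1) x(2) by simp
    finally show "\<exists>x\<in>V. B * S.sq x < F.sq x" using c(2)[OF x(1)] x(1) by (meson less_le_trans)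
  qed (rule nondegenerate)
  then obtain z where z: "\<And>n. CF.eigen_step z n" by blast
  define y where "y n = fst (z n)" for n
  define \<mu> where "\<mu> n = snd (z n)" for n
  interpret SB: spectral_basis gscale V "F_form P f" "ip K" "1 / c" "indef_ip P" y \<mu>
  proof
    show "CE.F.orthonormal y UNIV"
      using CF.eigen_step_orthonormal[of UNIV z] z by (simp add: y_def[abs_def])
    show "\<mu> n \<noteq> 0" "v \<in> V \<Longrightarrow> indef_ip P (y n) v = of_real (\<mu> n) * F_form P f (y n) v"
      "\<lbrakk>u \<in> V; \<And>j. j < n \<Longrightarrow> F_form P f u (y j) = 0\<rbrakk> \<Longrightarrow> \<bar>CF.b.sq u\<bar> \<le> \<bar>\<mu> n\<bar> * F.sq u" for n u v
      using z[of n] by (auto simp: CF.eigen_step_def y_def \<mu>_def)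
  qed (rule nondegenerate)
  have yV: "y n \<in> V" for n by (rule SB.y_V)
  \<comment> \<open>The Sobolev bound 166 of \<open>W\<close>, converted to \<open>F\<close> with
    the constants \<open>C\<close> above and \<open>c\<close> below.\<close>
  define M where "M = C * 166 / c"
  have M: "0 < M" using C0 c(1) by (simp add: M_def)
  have W_bdd: "F.sq (W x) \<le> M * F.sq x" if x: "x \<in> V" for x
  proof -
    have "F.sq (W x) \<le> C * (D.sq (W x) + S.sq (W x))" by (rule F_upper[OF W_V(1)[OF x]])
    also have "\<dots> \<le> C * (166 * (D.sq x + S.sq x))"
      using W_V(2)[OF x] C0 by (intro mult_left_mono) auto
    also have "\<dots> = M * (c * (D.sq x + S.sq x))" using c(1) by (simp add: M_def)
    also have "\<dots> \<le> M * F.sq x" using c(2)[OF x] M by (intro mult_left_mono) auto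
    finally show ?thesis .
  qed
  define R where "R = sqrt M / (1 / 17)"
  have R: "0 < R" using M by (simp add: R_def)
  have equiv: "S.sq u \<le> R * SB.T.sq u" "SB.T.sq u \<le> R * S.sq u" if u: "u \<in> V" for u
    unfolding R_def
    using SB.T_equiv_S[of W M "1/17", OF W_V(1) W_symmetric W_bdd M W_positive _ u] by simp_all
  have ln: "lincomb N d (\<lambda>n. normalised K (y n)) = (\<Sum>n<N. gscale (d n / of_real (S.nrm (y n))) (y n))" for N d
    unfolding lincomb_eq by (intro sum.cong refl ext) (simp add: gscale_def normalised_def L2_norm_graph_eq)
  have ny_pos: "0 < S.nrm (y n)" for n using SB.S_sq_y_pos[of n] by (simp add: S.nrm_def)
  have nrm_sq: "(L2_norm_graph K u)\<^sup>2 = S.sq u" if "u \<in> V" for u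
    using that by (simp add: L2_norm_graph_eq)
  have sumV: "(\<Sum>n<N. gscale (d n) (y n)) \<in> V" for N d by (intro S.V_sum S.V_scale yV)
  have fourier_F: "(\<lambda>N. F.sq (u - (\<Sum>n<N. gscale (F_form P f u (y n)) (y n)))) \<longlonglongrightarrow> 0" if u: "u \<in> V" for u
  proof -
    have "F.sq ((\<Sum>n<N. gscale (F_form P f u (y n)) (y n)) - u) = F.sq (u - (\<Sum>n<N. gscale (F_form P f u (y n)) (y n)))" for N
      using CE.F.nrm_minus_commute[OF sumV u] by (simp add: CE.F.nrm_def)
    then show ?thesis using SB.fourier[OF u] by (simp add: CE.F.tends_to_def)
  qed
  have eig: "eigenfunction P (of_real (1 / \<mu> n)) (y n)" for n
  proof -
    \<comment> \<open>The eigenvector equation divided by \<open>\<mu> n\<close>; the sign b goes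
      into the edge-dependent multiplier of \<open>weak_solution\<close>.\<close>
    have weak_form: "F_form P f (y n) v = (\<Sum>i=1..K. b_weight P i / of_real (\<mu> n) * eip (y n i) (v i))" if v: "v \<in> V" for v
      using SB.eigen[OF v, of n] SB.nonzero[of n]
      by (simp add: indef_ip_eq sum_divide_distrib[symmetric] divide_simps)
    have weak: "y n \<in> dom_L P" "\<And>i. i \<in> {1..K} \<Longrightarrow>
        AE t in I01. l_expr P (y n) i t = b_weight P i / of_real (\<mu> n) * y n i t"
      using weak_solution[OF yV, of n "\<lambda>i. b_weight P i / of_real (\<mu> n)"] weak_form by blast+
    show ?thesis
      unfolding eigenfunction_def
    proof (intro conjI ballI)
      show "y n \<in> dom_L P" by (rule weak(1))
      show "nontrivial P (y n)" using SB.S_sq_y_pos[of n] by (intro S_sq_pos_nontrivial) simp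
      show "AE t in lebesgue_on {0..1}. l_expr P (y n) i t = of_real (1 / \<mu> n) * B_op P (y n) i t"
        if "i \<in> {1..K}" for i
        using weak(2)[OF that] by (rule eventually_mono) (simp add: B_op_def)
    qed
  qed
  have basis: "orthonormal_basis_wrt (F_form P f) V y"
    unfolding orthonormal_basis_wrt_def
  proof (intro conjI allI ballI)
    show "F_form P f (y m) (y n) = (if m = n then 1 else 0)" for m n by (rule SB.F_y)
    fix u assume u: "u \<in> V"
    have "(\<lambda>N. of_real (F.sq (u - (\<Sum>n<N. gscale (F_form P f u (y n)) (y n))))) \<longlonglongrightarrow> (of_real 0 :: complex)"
      by (intro tendsto_of_real fourier_F u)
    then show "(\<lambda>N. let r = gdiff u (lincomb N (\<lambda>n. F_form P f u (y n)) y) in F_form P f r r) \<longlonglongrightarrow> 0"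
      by (simp add: Let_def gdiff_eq lincomb_eq F.self_eq_sq[OF S.V_diff[OF u sumV]])
  qed (rule yV)
  have riesz: "riesz_basis_L2 K (\<lambda>n. normalised K (y n))"
    unfolding riesz_basis_L2_def
  proof (intro conjI allI ballI impI)
    show "normalised K (y n) \<in> L2_graph K" for n
    proof -
      have "normalised K (y n) = gscale (1 / of_real (L2_norm_graph K (y n))) (y n)"
        by (auto simp: normalised_def gscale_def)
      then show ?thesis using S.V_scale[OF yV] V_sub_L2 by auto
    qed
    show "\<exists>A>0. \<exists>B>0. \<forall>N d. A * (\<Sum>n<N. (cmod (d n))\<^sup>2) \<le> (L2_norm_graph K (lincomb N d (\<lambda>n. normalised K (y n))))\<^sup>2 \<and>
        (L2_norm_graph K (lincomb N d (\<lambda>n. normalised K (y n))))\<^sup>2 \<le> B * (\<Sum>n<N. (cmod (d n))\<^sup>2)"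
    proof (intro exI conjI allI)
      show "0 < 1 / R\<^sup>2" "0 < R\<^sup>2" using R by simp_all
      show "1 / R\<^sup>2 * (\<Sum>n<N. (cmod (d n))\<^sup>2) \<le> (L2_norm_graph K (lincomb N d (\<lambda>n. normalised K (y n))))\<^sup>2" for N d
        unfolding ln nrm_sq[OF sumV] by (rule SB.riesz_bounds(1)[OF R equiv])
      show "(L2_norm_graph K (lincomb N d (\<lambda>n. normalised K (y n))))\<^sup>2 \<le> R\<^sup>2 * (\<Sum>n<N. (cmod (d n))\<^sup>2)" for N d
        unfolding ln nrm_sq[OF sumV] by (rule SB.riesz_bounds(2)[OF R equiv])
    qed
    \<comment> \<open>Completeness in L2 in two stages: \<open>u\<close> is approximated by some
      \<open>d\<close> in \<open>V\<close>, and \<open>d\<close> by its Fourier sums with respect to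
      \<open>F\<close>, which controls the L2 norm.\<close>
    fix u and e :: real assume u: "u \<in> L2_graph K" and e: "0 < e"
    obtain d where d: "d \<in> V" "L2.sq K (u - d) < (e / 2)\<^sup>2"
      using V_dense[OF u, of "(e / 2)\<^sup>2"] e by auto
    have "\<forall>\<^sub>F N in sequentially. F.sq (d - (\<Sum>n<N. gscale (F_form P f d (y n)) (y n))) < c * (e / 2)\<^sup>2"
      using order_tendstoD(2)[OF fourier_F[OF d(1)]] c(1) e by simp
    then obtain N where N: "F.sq (d - (\<Sum>n<N. gscale (F_form P f d (y n)) (y n))) < c * (e / 2)\<^sup>2"
      unfolding eventually_sequentially by blast
    let ?s = "\<Sum>n<N. gscale (F_form P f d (y n)) (y n)"
    have "S.sq (d - ?s) \<le> 1 / c * F.sq (d - ?s)"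
      by (rule CE.S_le_F[OF S.V_diff[OF d(1) sumV]])
    also have "\<dots> < 1 / c * (c * (e / 2)\<^sup>2)" using N c(1) by (intro mult_strict_left_mono) auto
    finally have ds: "S.sq (d - ?s) < (e / 2)\<^sup>2" using c(1) by simp
    have n1: "L2.nrm K (u - d) < e / 2"
      using real_sqrt_less_mono[OF d(2)] e by (simp add: L2.nrm_def)
    have n2: "L2.nrm K (d - ?s) < e / 2"
      using real_sqrt_less_mono[OF ds] e by (simp add: L2.nrm_def)
    have "L2.nrm K ((u - d) + (d - ?s)) \<le> L2.nrm K (u - d) + L2.nrm K (d - ?s)"
    proof (rule L2.nrm_triangle)
      show "u - d \<in> L2_graph K" using u d(1) V_sub_L2 by (intro L2.V_diff) auto
      show "d - ?s \<in> L2_graph K" using S.V_diff[OF d(1) sumV] V_sub_L2 by auto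
    qed
    then have lt: "L2.nrm K (u - ?s) < e" using n1 n2 by simp
    \<comment> \<open>Multiplying the coefficients by the L2 norms undoes the normalisation.\<close>
    have "lincomb N (\<lambda>n. F_form P f d (y n) * of_real (S.nrm (y n))) (\<lambda>n. normalised K (y n)) = ?s"
      (is "?l = _")
      unfolding ln using ny_pos by (intro sum.cong) (auto simp: less_imp_neq[symmetric])
    then have "L2_norm_graph K (gdiff u ?l) < e"
      using lt unfolding L2_norm_graph_eq gdiff_eq by simp
    then show "\<exists>N d. L2_norm_graph K (gdiff u (lincomb N d (\<lambda>n. normalised K (y n)))) < e" by blast
  qed
  show ?thesis
  proof (intro exI conjI)
    show "\<forall>n. eigenfunction P (of_real (1 / \<mu> n)) (y n)" using eig by blast
    show "\<forall>m n. m \<noteq> n \<longrightarrow> indef_ip P (y m) (y n) = 0" by (simp add: SB.b_y)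
  qed (rule basis riesz)+
qed

end
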